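(* Let $k\ge2$ and $0<d<n$. The total number of $k$-splits of the hypersimplex $\Delta(d,n)$ equals $$\frac1k\sum_{\alpha_1=2}^{\beta_1-2(k-1)}\cdots\sum_{\alpha_{k-1}=2}^{\beta_{k-1}-2}\mu_k^{d,n}(\alpha_1,\ldots,\alpha_{k-1})\prod_{j=1}^{k-1}\binom{\beta_j}{\alpha_j},$$ where $\beta_i=n-\sum_{\ell=1}^{i-1}\alpha_\ell$, the $i$-th sum runs over $2\le\alpha_i\le\beta_i-2(k-i)$, and $$\mu_k^{d,n}(\alpha_1,\ldots,\alpha_{k-1})=\#\Big\{x\in\mathbb Z^k:\ \sum_{i=1}^k x_i=d\ \text{ and }\ 0<x_j<\alpha_j\ \text{ for all } j\le k\Big\}$$ with $\alpha_k=\beta_k$.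
   Context: $\Delta(d,n)=\{x\in[0,1]^n:\sum_i x_i=d\}$. A subdivision of a polytope (on its vertex set) is coarsest if it is non-trivial and the only strictly coarser subdivision is the trivial one. A $k$-split of a polytope is a coarsest subdivision with exactly $k$ maximal cells sharing a common cell of codimension $k-1$.
   Formalization: The common cell of codimension k-1 is additionally required to meet the relative interior of the polytope; without this the count fails, e.g. Δ(2,5) has a coarsest subdivision with 5 maximal cells sharing only a vertex, while the formula gives 0 for k=5. *)

theory Defs
  imports "HOL-Analysis.Analysis"
begin

section \<open>Hypersimplices\<close>

definition hypersimplex :: "nat \<Rightarrow> (real ^ 'n) set" where
  "hypersimplex d = {x. (\<forall>i. 0 \<le> x $ i \<and> x $ i \<le> 1) \<and> (\<Sum>i\<in>UNIV. x $ i) = real d}"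


section \<open>Polytopal subdivisions\<close>

text \<open>
  A subdivision is recorded as the set of all its cells. The library's face relation counts the
  empty set as a face, so the empty cell belongs to every subdivision of a nonempty polytope and
  the set of cells is determined uniquely. The condition on extreme points says that no new
  vertices are introduced.
\<close>

definition subdivision :: "'a::euclidean_space set \<Rightarrow> 'a set set \<Rightarrow> bool" where
  "subdivision P \<Sigma> \<longleftrightarrow>
     finite \<Sigma> \<and>
     (\<forall>C\<in>\<Sigma>. polytope C \<and> {v. v extreme_point_of C} \<subseteq> {v. v extreme_point_of P}) \<and>
     (\<forall>C\<in>\<Sigma>. \<forall>F. F face_of C \<longrightarrow> F \<in> \<Sigma>) \<and>
     (\<forall>C\<in>\<Sigma>. \<forall>D\<in>\<Sigma>. (C \<inter> D) face_of C \<and> (C \<inter> D) face_of D) \<and>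
     \<Union>\<Sigma> = P"

definition trivial_subdivision :: "'a::euclidean_space set \<Rightarrow> 'a set set" where
  "trivial_subdivision P = {F. F face_of P}"

definition coarser :: "'a set set \<Rightarrow> 'a set set \<Rightarrow> bool" where
  "coarser \<Sigma>' \<Sigma> \<longleftrightarrow> (\<forall>C\<in>\<Sigma>. \<exists>D\<in>\<Sigma>'. C \<subseteq> D)"

definition coarsest_subdivision :: "'a::euclidean_space set \<Rightarrow> 'a set set \<Rightarrow> bool" where
  "coarsest_subdivision P \<Sigma> \<longleftrightarrow>
     subdivision P \<Sigma> \<and> \<Sigma> \<noteq> trivial_subdivision P \<and>
     (\<forall>\<Sigma>'. subdivision P \<Sigma>' \<and> coarser \<Sigma>' \<Sigma> \<and> \<Sigma>' \<noteq> \<Sigma> \<longrightarrow> \<Sigma>' = trivial_subdivision P)"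

definition maximal_cells :: "'a set set \<Rightarrow> 'a set set" where
  "maximal_cells \<Sigma> = {M \<in> \<Sigma>. \<forall>D\<in>\<Sigma>. M \<subseteq> D \<longrightarrow> D = M}"

text \<open>
  The common cell is required to be an interior cell, that is, not to lie in the boundary of the
  polytope; this is implicit in the notion of a k-split. It does not follow from the other
  conditions. For instance, write e_ij for the vertices of the hypersimplex with d = 2 on the five
  coordinates u, v, a, b, c. The maximal cells that the K_{2,3} metric induces on it are cut out by

    \<^item> x_u + x_i \<ge> 1 and x_v + x_i \<ge> 1, one cell for each i among a, b, c;
    \<^item> x_u \<ge> x_v and x_v + x_i \<le> 1 for all i among a, b, c;
    \<^item> x_v \<ge> x_u and x_u + x_i \<le> 1 for all i among a, b, c.

  This is a coarsest subdivision with five maximal cells, and they share exactly the vertex e_uv,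
  which has codimension four.

  For an interior cell C the containment in all maximal cells forces C to be their intersection.
\<close>

definition k_split :: "nat \<Rightarrow> 'a::euclidean_space set \<Rightarrow> 'a set set \<Rightarrow> bool" where
  "k_split k P \<Sigma> \<longleftrightarrow>
     coarsest_subdivision P \<Sigma> \<and>
     card (maximal_cells \<Sigma>) = k \<and>
     (\<exists>C\<in>\<Sigma>. (\<forall>M\<in>maximal_cells \<Sigma>. C \<subseteq> M) \<and>
            aff_dim P - aff_dim C = int k - 1 \<and>
            C \<inter> rel_interior P \<noteq> {})"


section \<open>The counting formula\<close>

text \<open>
  Tuples of length m are extensional functions on \<open>{1..m}\<close>. The iterated sum is a single sum over
  \<open>alpha_range\<close>. Truncated subtraction is harmless there: the condition \<open>2 \<le> \<alpha> i\<close> excludes every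
  case in which one of the differences would be negative.
\<close>

definition \<beta> :: "nat \<Rightarrow> (nat \<Rightarrow> nat) \<Rightarrow> nat \<Rightarrow> nat" where
  "\<beta> n \<alpha> i = n - (\<Sum>l\<in>{1..<i}. \<alpha> l)"

definition alpha_range :: "nat \<Rightarrow> nat \<Rightarrow> (nat \<Rightarrow> nat) set" where
  "alpha_range k n =
     {\<alpha> \<in> {1..k-1} \<rightarrow>\<^sub>E UNIV. \<forall>i\<in>{1..k-1}. 2 \<le> \<alpha> i \<and> \<alpha> i \<le> \<beta> n \<alpha> i - 2 * (k - i)}"

definition \<mu> :: "nat \<Rightarrow> nat \<Rightarrow> nat \<Rightarrow> (nat \<Rightarrow> nat) \<Rightarrow> nat" where
  "\<mu> k d n \<alpha> =
     card {x \<in> {1..k} \<rightarrow>\<^sub>E (UNIV :: int set).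
             (\<Sum>i\<in>{1..k}. x i) = int d \<and>
             (\<forall>j\<in>{1..k}. 0 < x j \<and> x j < int ((\<alpha>(k := \<beta> n \<alpha> k)) j))}"

end

theory Submission
  imports Defs
begin

text \<open>
  A pair of a k-split and one of its maximal cells is the same as an ordered partition of the
  coordinates into blocks \<open>L 1, ..., L k\<close> with integers \<open>0 < dd r < card (L r)\<close> summing to d: writing
  \<open>S r\<close> for the sum of the coordinates in the first r blocks minus its prescribed value
  \<open>dd 1 + ... + dd r\<close>, the maximal cells are the regions where one of the \<open>S r\<close> is largest, and the
  chosen cell is the one belonging to \<open>S k\<close>. As every k-split has k maximal cells, counting these
  data gives k times the number of k-splits.

  The main point is that every k-split arises in this way. Its maximal cells are the regions of
  maximality of k linear forms that vanish on the common cell and whose only affine relation is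
  trivial. Every simplex spanned by the vertices \<open>chi (Y - {a})\<close> with a in Y, or by the vertices
  \<open>chi (insert b Z)\<close> with b outside Z, lies in a single cell, because its barycentre does.
  Hence a cell whose form is largest on a coordinate is closed under exchanging other coordinates
  for this one. Exchanges turn into symmetries of the cones of the fan, which shows that there are
  at most k different coordinate vectors of the k forms; independence gives exactly k, and the
  classes of equal coordinates are the blocks. The same exchange argument, applied to vertices
  whose block sums differ from the common values by at most one, finally forces the k by k matrix of
  the forms to be that of a cyclic order on the blocks.
\<close>

section \<open>Cyclic orders\<close>

text \<open>The obstacle is that only the vertices of the cells are known to be 0/1 vectors; nothing
  is given about their edges, so every exchange has to be derived from ties of forms on simplices.
  When two coordinates can be exchanged both ways in a cell, their transposition is a reflection
  preserving a simplicial cone. Written in the rays of that cone it has nonnegative entries, and a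
  reflection of this kind interchanges exactly two rays up to scaling. This is the origin of the
  relations counted in \<open>column_count\<close>. The prescribed block values are integers because
  all forms vanish at a common 0/1 vertex as well as at the interior point \<open>c0\<close>, and a
  block sum depends only on the vanishing of the forms. For the final matrix \<open>F\<close>, the
  quantity \<open>F i i - F i a\<close> behaves like a directed distance; the last step shows that
  its shortest ways run around a circle.\<close>

locale cyclic_core =
  fixes I :: "'i set" and F :: "'i \<Rightarrow> 'i \<Rightarrow> real" and \<tau> :: "'i \<Rightarrow> 'i" and J :: "('i \<Rightarrow> int) \<Rightarrow> 'i set"
  assumes fin: "finite I"
    and tau: "bij_betw \<tau> I I"
    and J_def: "J z = {t \<in> I. \<forall>u\<in>I. (\<Sum>e\<in>I. of_int (z e) * F u e) \<le> (\<Sum>e\<in>I. of_int (z e) * F t e)}"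
    and Fmax: "\<lbrakk>i \<in> I; t \<in> I; a \<in> I\<rbrakk> \<Longrightarrow> F i a - F t a \<le> F i i - F t i"
    and Fmin: "\<lbrakk>i \<in> I; t \<in> I; a \<in> I\<rbrakk> \<Longrightarrow> F i (\<tau> i) - F t (\<tau> i) \<le> F i a - F t a"
    and indep: "\<lbrakk>sum \<alpha> I = 0; \<And>e. e \<in> I \<Longrightarrow> (\<Sum>t\<in>I. \<alpha> t * F t e) = c; t \<in> I\<rbrakk> \<Longrightarrow> \<alpha> t = 0"
    and up: "\<lbrakk>\<And>e. e \<in> I \<Longrightarrow> \<bar>z e\<bar> \<le> 1; sum z I = 0; e \<in> I; z e \<le> 0\<rbrakk> \<Longrightarrow>
       \<exists>t\<in>J z. \<forall>m\<in>J z. \<forall>a\<in>I. 0 \<le> z a \<longrightarrow> F t a - F m a \<le> F t e - F m e"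
    and down: "\<lbrakk>\<And>e. e \<in> I \<Longrightarrow> \<bar>z e\<bar> \<le> 1; sum z I = 0; e \<in> I; 0 \<le> z e\<rbrakk> \<Longrightarrow>
       \<exists>t\<in>J z. \<forall>m\<in>J z. \<forall>a\<in>I. z a \<le> 0 \<longrightarrow> F t e - F m e \<le> F t a - F m a"
begin

text \<open>\<open>Fmax\<close> is the triangle inequality for \<open>dst\<close>; single values may
  be negative, only round trips \<open>DD\<close> are positive. \<open>G i m e\<close> says that
  \<open>m\<close> lies on a shortest way from \<open>i\<close> to \<open>e\<close>. The goal is to
  show that \<open>G\<close> is a cyclic order and that all round trips have the same
  length.\<close>

definition dst :: "'i \<Rightarrow> 'i \<Rightarrow> real" where "dst i a = F i i - F i a"
definition G :: "'i \<Rightarrow> 'i \<Rightarrow> 'i \<Rightarrow> bool" where "G i m e \<longleftrightarrow> dst i e = dst i m + dst m e"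
definition DD :: "'i \<Rightarrow> 'i \<Rightarrow> real" where "DD i u = dst i u + dst u i"
definition Btw :: "'i \<Rightarrow> 'i \<Rightarrow> 'i set" where "Btw i u = {m \<in> I. G i m u \<and> G u m i}"

lemma tau_in: "i \<in> I \<Longrightarrow> \<tau> i \<in> I"
  using tau by (auto simp: bij_betw_def)

lemma tau_inj: "i \<in> I \<Longrightarrow> u \<in> I \<Longrightarrow> \<tau> i = \<tau> u \<longleftrightarrow> i = u"
  using tau by (auto simp: bij_betw_def inj_on_def)

lemma tri: "\<lbrakk>i \<in> I; m \<in> I; e \<in> I\<rbrakk> \<Longrightarrow> dst i e \<le> dst i m + dst m e"
  using Fmax[of m i e] by (simp add: dst_def)

lemma G_iff: "G i m e \<longleftrightarrow> F m e - F i e = F m m - F i m"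
  by (auto simp: G_def dst_def)

lemma G_iff_le: "\<lbrakk>i \<in> I; m \<in> I; e \<in> I\<rbrakk> \<Longrightarrow> G i m e \<longleftrightarrow> F m m - F i m \<le> F m e - F i e"
  using Fmax[of m i e] by (auto simp: G_iff)

lemma dst_self [simp]: "dst i i = 0" by (simp add: dst_def)
lemma G_triv [simp]: "G i i e" "G i e e" by (auto simp: G_def)

text \<open>The two instances of \<open>Fmax\<close> enclose \<open>F i e - F u e\<close> between
  bounds that coincide if the round trip is not positive. Rows \<open>i\<close> and \<open>u\<close>
  would then differ by a constant, which \<open>indep\<close> forbids.\<close>

lemma DD_pos: assumes "i \<in> I" "u \<in> I" "i \<noteq> u" shows "0 < DD i u"
proof (rule ccontr)
  assume "\<not> 0 < DD i u"
  hence le: "DD i u \<le> 0" by simp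
  have const: "F i e - F u e = F i i - F u i" if "e \<in> I" for e
    using Fmax[of i u e] Fmax[of u i e] assms that le by (auto simp: DD_def dst_def)
  define \<alpha> where "\<alpha> t = (of_bool (t = i) - of_bool (t = u) :: real)" for t
  have s: "sum \<alpha> I = 0"
    using assms fin by (simp add: \<alpha>_def sum_subtractf of_bool_def)
  have "(\<Sum>t\<in>I. \<alpha> t * F t e) = F i e - F u e" for e
    using assms fin by (simp add: \<alpha>_def sum_subtractf left_diff_distrib of_bool_def if_distrib[of "\<lambda>x. x * _"] cong: if_cong)
  hence "\<alpha> i = 0" using indep[OF s _ assms(1)] const by metis
  thus False using assms by (simp add: \<alpha>_def)
qed

lemma G_antisym: "\<lbrakk>i \<in> I; t \<in> I; u \<in> I; G i t u; G i u t\<rbrakk> \<Longrightarrow> t = u"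
  using DD_pos[of t u] by (auto simp: G_def DD_def)

lemma G_antisym': "\<lbrakk>i \<in> I; t \<in> I; u \<in> I; G t u i; G u t i\<rbrakk> \<Longrightarrow> t = u"
  using DD_pos[of t u] by (auto simp: G_def DD_def)

lemma G_back: "\<lbrakk>i \<in> I; t \<in> I; G i t i\<rbrakk> \<Longrightarrow> t = i"
  using DD_pos[of t i] by (auto simp: G_def DD_def)

lemma G_trans:
  assumes "i \<in> I" "w \<in> I" "u \<in> I" "y \<in> I" "G i u y" "G i w u"
  shows "G i w y" "G w u y"
  using assms(5,6) tri[of i w y] tri[of w u y] assms(1-4) by (auto simp: G_def)

lemma G_trans':
  assumes "i \<in> I" "w \<in> I" "u \<in> I" "y \<in> I" "G i w y" "G w u y"
  shows "G i u y" "G i w u"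
  using assms(5,6) tri[of i u y] tri[of i w u] assms(1-4) by (auto simp: G_def)

text \<open>\<open>Fmin\<close> taken at \<open>m\<close> itself: every index is on a shortest way
  from \<open>i\<close> to \<open>\<tau> i\<close>, so \<open>\<tau> i\<close> is the last index met
  from \<open>i\<close>.\<close>

lemma G_tau: assumes "i \<in> I" "m \<in> I" shows "G i m (\<tau> i)"
  using Fmin[OF assms assms(2)] assms tau_in by (auto simp: G_iff_le)

lemma J_sub: "J z \<subseteq> I" by (auto simp: J_def)

text \<open>\<open>up\<close> is tested at the very index \<open>t\<close> that it provides. There
  \<open>Fmax\<close> gives the reverse inequality, so \<open>t\<close> is on shortest ways to
  \<open>e\<close> from all of \<open>J z\<close>.\<close>

lemma up_good:
  assumes "\<And>e. e \<in> I \<Longrightarrow> \<bar>z e\<bar> \<le> 1" "sum z I = 0" "e \<in> I" "z e \<le> 0" "\<And>t. t \<in> J z \<Longrightarrow> 0 \<le> z t"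
  shows "\<exists>t\<in>J z. \<forall>m\<in>J z. G m t e"
proof -
  obtain t where t: "t \<in> J z" "\<And>m a. \<lbrakk>m \<in> J z; a \<in> I; 0 \<le> z a\<rbrakk> \<Longrightarrow> F t a - F m a \<le> F t e - F m e"
    using up[OF assms(1-4)] by blast
  have "G m t e" if "m \<in> J z" for m
    using t(2)[OF that, of t] t(1) that assms(3,5) J_sub by (subst G_iff_le) auto
  thus ?thesis using t(1) by blast
qed

text \<open>Dual to \<open>up_good\<close>: \<open>down\<close> is tested at
  \<open>\<tau> t\<close>, the last index met from \<open>t\<close>.\<close>

lemma down_good:
  assumes "\<And>e. e \<in> I \<Longrightarrow> \<bar>z e\<bar> \<le> 1" "sum z I = 0" "e \<in> I" "0 \<le> z e" "\<And>t. t \<in> J z \<Longrightarrow> z (\<tau> t) \<le> 0"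
  shows "\<exists>t\<in>J z. \<forall>m\<in>J z. G t m e"
proof -
  obtain t where t: "t \<in> J z" "\<And>m a. \<lbrakk>m \<in> J z; a \<in> I; z a \<le> 0\<rbrakk> \<Longrightarrow> F t e - F m e \<le> F t a - F m a"
    using down[OF assms(1-4)] by blast
  have "G t m e" if "m \<in> J z" for m
  proof -
    have "G t m (\<tau> t)" using G_tau t(1) that J_sub by blast
    moreover have "F t e - F m e \<le> F t (\<tau> t) - F m (\<tau> t)"
      using t(2)[OF that, of "\<tau> t"] t(1) assms(5) tau_in J_sub by auto
    ultimately show ?thesis using t(1) that assms(3) J_sub by (subst G_iff_le) (auto simp: G_iff)
  qed
  thus ?thesis using t(1) by blast
qed

text \<open>Chosen so that row \<open>t\<close> takes on it a constant minus
  \<open>DD i t + DD u t\<close>. The optimal rows are therefore exactly the indices between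
  \<open>i\<close> and \<open>u\<close>.\<close>

definition zz :: "'i \<Rightarrow> 'i \<Rightarrow> 'i \<Rightarrow> int" where
  "zz i u e = of_bool (e = i) + of_bool (e = u) - of_bool (e = \<tau> i) - of_bool (e = \<tau> u)"

lemma sum_root:
  assumes "x \<in> I" "y \<in> I"
  shows "(\<Sum>e\<in>I. of_int (of_bool (e = x) - of_bool (e = y)) * F t e) = F t x - F t y"
proof -
  have "of_int (of_bool (e = x) - of_bool (e = y)) * F t e
      = (if e = x then F t x else 0) - (if e = y then F t y else 0)" for e
    by auto
  thus ?thesis using assms fin by (simp add: sum_subtractf)
qed

lemma sum_zz:
  assumes "i \<in> I" "u \<in> I"
  shows "(\<Sum>e\<in>I. of_int (zz i u e) * F t e) = (F t i - F t (\<tau> i)) + (F t u - F t (\<tau> u))"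
proof -
  have "of_int (zz i u e) * F t e = of_int (of_bool (e = i) - of_bool (e = \<tau> i)) * F t e
     + of_int (of_bool (e = u) - of_bool (e = \<tau> u)) * F t e" for e
    by (simp add: zz_def algebra_simps)
  thus ?thesis using sum_root tau_in assms by (simp add: sum.distrib)
qed

lemma sum_root0: "x \<in> I \<Longrightarrow> y \<in> I \<Longrightarrow> (\<Sum>e\<in>I. of_bool (e = x) - of_bool (e = y)) = (0::int)"
  using fin by (simp add: sum_subtractf of_bool_def)

lemma sum_zz0: assumes "i \<in> I" "u \<in> I" shows "sum (zz i u) I = 0"
proof -
  have "zz i u e = (of_bool (e = i) - of_bool (e = \<tau> i)) + (of_bool (e = u) - of_bool (e = \<tau> u))" for e
    by (simp add: zz_def)
  thus ?thesis using sum_root0 tau_in assms by (simp add: sum.distrib)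
qed

lemma root_val:
  assumes "x \<in> I" "y \<in> I" "t \<in> I"
  shows "F t x - F t (\<tau> y) = dst y (\<tau> y) - (dst y t + dst t x)"
  using G_tau[OF assms(2,3)] by (simp add: G_def dst_def)

lemma J_zz:
  assumes "i \<in> I" "u \<in> I"
  shows "J (zz i u) = Btw i u"
proof -
  have v: "(\<Sum>e\<in>I. of_int (zz i u e) * F t e) = dst i (\<tau> i) + dst u (\<tau> u) - (DD i t + DD u t)" if "t \<in> I" for t
    using sum_zz[OF assms] root_val[OF assms(1,1) that] root_val[OF assms(2,2) that] by (simp add: DD_def)
  have ge: "DD i u \<le> DD i t + DD u t" if "t \<in> I" for t
    using tri[of i t u] tri[of u t i] that assms by (simp add: DD_def)
  have eq: "DD i u = DD i t + DD u t \<longleftrightarrow> G i t u \<and> G u t i" if "t \<in> I" for t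
    using tri[of i t u] tri[of u t i] that assms by (auto simp: DD_def G_def)
  have ii: "DD i i + DD u i = DD i u" by (simp add: DD_def)
  show ?thesis
  proof (intro set_eqI iffI)
    fix t assume "t \<in> J (zz i u)"
    hence "t \<in> I" and "DD i t + DD u t \<le> DD i i + DD u i" using v assms by (auto simp: J_def)
    thus "t \<in> Btw i u" using ge[of t] eq[of t] ii by (auto simp: Btw_def)
  next
    fix t assume "t \<in> Btw i u"
    hence t: "t \<in> I" "DD i u = DD i t + DD u t" using eq by (auto simp: Btw_def)
    have "(\<Sum>e\<in>I. of_int (zz i u e) * F m e) \<le> (\<Sum>e\<in>I. of_int (zz i u e) * F t e)" if "m \<in> I" for m
      using v[OF that] v[OF t(1)] ge[OF that] t(2) by linarith
    thus "t \<in> J (zz i u)" using t(1) by (simp add: J_def)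
  qed
qed

lemma zz_bound: assumes "i \<in> I" "u \<in> I" "i \<noteq> u" shows "\<bar>zz i u e\<bar> \<le> 1"
  using assms tau_inj[of i u] by (auto simp: zz_def of_bool_def)

lemma Btw_tau:
  assumes "i \<in> I" "u \<in> I" "\<tau> i \<in> Btw i u" shows "\<tau> i = u"
proof -
  have "G i (\<tau> i) u" "G i u (\<tau> i)" using assms G_tau by (auto simp: Btw_def)
  thus ?thesis using G_antisym assms tau_in by blast
qed

lemma Btw_commute: "Btw i u = Btw u i" by (auto simp: Btw_def)

text \<open>By \<open>Btw_tau\<close> the last index \<open>\<tau> i\<close> can be between
  \<open>i\<close> and \<open>u\<close> only if it is \<open>u\<close>, and symmetrically for
  \<open>\<tau> u\<close>. This yields the sign conditions that \<open>up_good\<close> and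
  \<open>down_good\<close> ask for.\<close>

lemma zz_Btw:
  assumes "i \<in> I" "u \<in> I" "i \<noteq> u" "t \<in> Btw i u"
  shows "0 \<le> zz i u t" "zz i u (\<tau> t) \<le> 0" "t \<noteq> i \<Longrightarrow> t \<noteq> u \<Longrightarrow> zz i u t = 0"
proof -
  have a: "t \<noteq> \<tau> i \<or> t = u" "t \<noteq> \<tau> u \<or> t = i"
    using Btw_tau[of i u] Btw_tau[of u i] Btw_commute[of i u] assms by auto
  have inj: "\<tau> i \<noteq> \<tau> u" using tau_inj assms by blast
  show "0 \<le> zz i u t" using a inj assms(3)
    by (cases "t = \<tau> i"; cases "t = \<tau> u"; cases "t = i"; cases "t = u") (simp_all add: zz_def)
  show "zz i u t = 0" if "t \<noteq> i" "t \<noteq> u" using a that by (simp add: zz_def)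
  have tI: "t \<in> I" using assms by (auto simp: Btw_def)
  have "t = u" if "\<tau> t = i" "t \<noteq> i"
  proof -
    have "G t u i" "G u t i" using G_tau[OF tI assms(2)] that assms by (auto simp: Btw_def)
    thus ?thesis using G_antisym' tI assms by blast
  qed
  moreover have "t = i" if "\<tau> t = u" "t \<noteq> u"
  proof -
    have "G t i u" "G i t u" using G_tau[OF tI assms(1)] that assms by (auto simp: Btw_def)
    thus ?thesis using G_antisym' tI assms by blast
  qed
  ultimately have c: "\<tau> t = i \<longrightarrow> t = i \<or> t = u" "\<tau> t = u \<longrightarrow> t = i \<or> t = u" by blast+
  have gen: "(of_bool p + of_bool q - of_bool r - of_bool s :: int) \<le> 0"
    if "p \<longrightarrow> r \<or> s" "q \<longrightarrow> r \<or> s" "\<not> (p \<and> q)" for p q r s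
    using that by auto
  have "zz i u (\<tau> t) = of_bool (\<tau> t = i) + of_bool (\<tau> t = u) - of_bool (t = i) - of_bool (t = u)"
    using tau_inj[OF tI assms(1)] tau_inj[OF tI assms(2)] by (simp only: zz_def)
  moreover have "\<not> (\<tau> t = i \<and> \<tau> t = u)" using assms(3) by blast
  ultimately show "zz i u (\<tau> t) \<le> 0" using gen[OF c] by metis
qed

lemma zz_nonpos: "e \<noteq> i \<Longrightarrow> e \<noteq> u \<Longrightarrow> zz i u e \<le> 0" by (simp add: zz_def)

text \<open>The index found is a gate of \<open>e\<close>: from every member of the interval some
  shortest way to \<open>e\<close> passes through it.\<close>

lemma up_Btw:
  assumes "i \<in> I" "u \<in> I" "i \<noteq> u" "e \<in> I" "e \<noteq> i" "e \<noteq> u"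
  shows "\<exists>t\<in>Btw i u. \<forall>m\<in>Btw i u. G m t e"
  using up_good[of "zz i u" e] J_zz[of i u] zz_bound[of i u] sum_zz0[of i u] zz_nonpos[of e i u] zz_Btw(1)[of i u] assms
  by auto

lemma down_Btw:
  assumes "i \<in> I" "u \<in> I" "i \<noteq> u" "e \<in> Btw i u" "e \<noteq> i" "e \<noteq> u"
  shows "\<exists>t\<in>Btw i u. \<forall>m\<in>Btw i u. G t m e"
  using down_good[of "zz i u" e] J_zz[of i u] zz_bound[of i u] sum_zz0[of i u] zz_Btw[of i u] assms
  by (auto simp: Btw_def)

lemma edge_split:
  assumes "i \<in> I" "u \<in> I" "i \<noteq> u" "Btw i u = {i,u}" "e \<in> I" "e \<noteq> i" "e \<noteq> u"
  shows "G i u e \<or> G u i e"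
  using up_Btw[OF assms(1-3,5-7)] assms(4) by auto

lemma Btw_sub:
  assumes "i \<in> I" "u \<in> I" "t \<in> Btw i u" "t \<noteq> u"
  shows "Btw i t \<subset> Btw i u"
proof -
  have tI: "t \<in> I" "G i t u" "G u t i" using assms by (auto simp: Btw_def)
  have "m \<in> Btw i u" if "m \<in> Btw i t" for m
  proof -
    have m: "m \<in> I" "G i m t" "G t m i" using that by (auto simp: Btw_def)
    have "G i m u" using G_trans(1)[of i m t u] m tI assms by auto
    moreover have "G u m i" using G_trans'(1)[of u t m i] m tI assms by auto
    ultimately show ?thesis using m by (simp add: Btw_def)
  qed
  moreover have "u \<in> Btw i u" using assms by (auto simp: Btw_def)
  moreover have "u \<notin> Btw i t"
  proof
    assume "u \<in> Btw i t"
    hence "G i u t" by (auto simp: Btw_def)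
    thus False using G_antisym tI assms by blast
  qed
  ultimately show ?thesis by blast
qed

lemma G_swap: "\<lbrakk>i \<in> I; t \<in> I; G i t e; G t i e\<rbrakk> \<Longrightarrow> i = t"
  using DD_pos[of i t] by (auto simp: G_def DD_def)

text \<open>
  A pair with something strictly between (for the symmetrised distance) and with as few such indices
  as possible would carry a permutation of the indices in between. Following it leads either to four
  affinely dependent rows or to a sign vector violating \<open>up\<close>.
\<close>

lemma no_between:
  assumes "i0 \<in> I" "u0 \<in> I" "i0 \<noteq> u0"
  shows "Btw i0 u0 = {i0, u0}"
proof (rule ccontr)
  assume neg: "Btw i0 u0 \<noteq> {i0, u0}"
  define P where "P \<equiv> \<lambda>(i,u). i \<in> I \<and> u \<in> I \<and> i \<noteq> u \<and> Btw i u \<noteq> {i,u}"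
  have "P (i0,u0)" using assms neg by (simp add: P_def)
  then obtain iu where iu: "P iu" "\<And>q. P q \<Longrightarrow> card (case_prod Btw iu) \<le> card (case_prod Btw q)"
    using ex_has_least_nat[of P "(i0,u0)" "\<lambda>q. card (case_prod Btw q)"] by metis
  obtain i u where iu_eq: "iu = (i,u)" by fastforce
  have I: "i \<in> I" "u \<in> I" "i \<noteq> u" and ne: "Btw i u \<noteq> {i,u}"
    using iu(1) by (auto simp: P_def iu_eq)
  have least: "Btw i' u' = {i',u'}" if "i' \<in> I" "u' \<in> I" "i' \<noteq> u'" "card (Btw i' u') < card (Btw i u)" for i' u'
    using iu(2)[of "(i',u')"] that by (auto simp: P_def iu_eq)
  define L where "L = Btw i u"
  define M where "M = L - {i,u}"
  have LI: "L \<subseteq> I" by (auto simp: L_def Btw_def)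
  have finL: "finite L" using LI fin finite_subset by blast
  have iuL: "i \<in> L" "u \<in> L" using I by (auto simp: L_def Btw_def)
  have M: "M \<noteq> {}" "finite M" "M \<subseteq> L" "M \<subseteq> I" using ne iuL finL LI by (auto simp: M_def L_def)
  have MD: "v \<in> I" "v \<noteq> i" "v \<noteq> u" "v \<in> L" "G i v u" "G u v i" if "v \<in> M" for v
    using that LI by (auto simp: M_def L_def Btw_def)
  \<comment> \<open>The pair \<open>i\<close>, \<open>t\<close> has a smaller interval, so by
    minimality nothing lies strictly between them and \<open>edge_split\<close> applies.\<close>
  have e1: "G i t e \<or> G t i e" if "t \<in> M" "e \<in> I" "e \<noteq> i" "e \<noteq> t" for t e
  proof -
    have "Btw i t \<subset> Btw i u" using Btw_sub[of i u t] I MD[OF that(1)] by (simp add: L_def)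
    hence "card (Btw i t) < card (Btw i u)" using finL psubset_card_mono by (simp add: L_def)
    hence "Btw i t = {i,t}" using least[of i t] I MD[OF that(1)] by auto
    thus ?thesis using edge_split[of i t e] I MD[OF that(1)] that by auto
  qed
  have e2: "G u t e \<or> G t u e" if "t \<in> M" "e \<in> I" "e \<noteq> u" "e \<noteq> t" for t e
  proof -
    have "Btw u t \<subset> Btw u i" using Btw_sub[of u i t] I MD[OF that(1)] Btw_commute by (auto simp: L_def)
    hence "card (Btw u t) < card (Btw i u)"
      using finL psubset_card_mono Btw_commute by (metis L_def)
    hence "Btw u t = {u,t}" using least[of u t] I MD[OF that(1)] by auto
    thus ?thesis using edge_split[of u t e] I MD[OF that(1)] that by auto
  qed
  \<comment> \<open>\<open>s e\<close> is a member of the interval from which \<open>e\<close> is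
    the last one met. Last ones are unique, so \<open>s\<close> is injective and hence a permutation
    of \<open>M\<close>.\<close>
  have "\<forall>e\<in>M. \<exists>t\<in>L. \<forall>m\<in>L. G t m e"
    using down_Btw[OF I] by (auto simp: M_def L_def)
  then obtain s where s: "\<And>e. e \<in> M \<Longrightarrow> s e \<in> L" "\<And>e m. e \<in> M \<Longrightarrow> m \<in> L \<Longrightarrow> G (s e) m e"
    by metis
  have sM: "s e \<in> M" if "e \<in> M" for e
  proof -
    have "s e \<noteq> i" using s(2)[OF that iuL(2)] MD[OF that] I G_antisym[of i u e] by auto
    moreover have "s e \<noteq> u" using s(2)[OF that iuL(1)] MD[OF that] I G_antisym[of u i e] by auto
    ultimately show ?thesis using s(1)[OF that] by (simp add: M_def)
  qed
  have "inj_on s M"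
  proof
    fix e1 e2 assume e: "e1 \<in> M" "e2 \<in> M" "s e1 = s e2"
    hence "G (s e1) e1 e2" "G (s e1) e2 e1" using s(2) M by (metis subsetD)+
    moreover have "s e1 \<in> I" "e1 \<in> I" "e2 \<in> I" using sM[OF e(1)] e M by auto
    ultimately show "e1 = e2" using G_antisym by metis
  qed
  hence sbij: "s ` M = M" using endo_inj_surj[of M s] M sM by blast
  have star: "\<exists>t2\<in>M. \<forall>m\<in>L. G t m t2" if "t \<in> M" for t
    using sbij that s(2) by (metis imageE)
  \<comment> \<open>\<open>y\<close> is a first member of \<open>M\<close> seen from
    \<open>i\<close>: no other member lies on a shortest way from \<open>i\<close> to it.\<close>
  define below where "below v = {w \<in> M. G i w v}" for v
  obtain y where y0: "is_arg_min (\<lambda>v. card (below v)) (\<lambda>v. v \<in> M) y"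
    using ex_is_arg_min_if_finite[of M "\<lambda>v. card (below v)"] M by blast
  have y: "y \<in> M" and ymin0: "\<And>v. v \<in> M \<Longrightarrow> \<not> card (below v) < card (below y)"
    using y0 by (auto simp: is_arg_min_def)
  have ymin: "\<not> G i w y" if w: "w \<in> M" "w \<noteq> y" for w
  proof
    assume g: "G i w y"
    have "below w \<subseteq> below y" using G_trans(1)[OF I(1) _ _ _ g] MD w y by (auto simp: below_def)
    moreover have "y \<in> below y" using y by (simp add: below_def)
    moreover have "y \<notin> below w"
      using G_antisym[OF I(1) MD(1)[OF w(1)] MD(1)[OF y] g] w by (auto simp: below_def)
    moreover have "finite (below y)" using M by (simp add: below_def)
    ultimately have "card (below w) < card (below y)" by (metis psubsetI psubset_card_mono)
    thus False using ymin0 w by blast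
  qed
  define x where "x = s y"
  have x: "x \<in> M" "\<And>m. m \<in> L \<Longrightarrow> G x m y" using sM s(2) y by (auto simp: x_def)
  have xy: "x \<noteq> y" using x(2)[OF iuL(1)] G_back[of y i] MD[OF y] I by auto
  have vy: "G v i y" if "v \<in> M" "v \<noteq> y" for v
    using e1[OF that(1), of y] MD[OF y] that ymin by blast
  have c1: "\<not> G x i v" "G i x v" if v: "v \<in> M" "v \<noteq> x" "v \<noteq> y" for v
  proof -
    show n: "\<not> G x i v"
    proof
      assume "G x i v"
      hence "G i v y"
        using G_trans(2)[of x i v y] x(2)[of v] MD x(1) I y v by auto
      thus False using ymin v by blast
    qed
    show "G i x v" using e1[OF x(1), of v] MD[OF v(1)] v n by blast
  qed
  obtain y2 where y2: "y2 \<in> M" "\<And>m. m \<in> L \<Longrightarrow> G y m y2" using star[OF y] by blast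
  have y2y: "y2 \<noteq> y" using y2(2)[OF iuL(1)] G_back[of y i] MD[OF y] I by auto
  \<comment> \<open>Otherwise \<open>y\<close> would be on the way from \<open>i\<close> to
    \<open>y2\<close>, while \<open>i\<close> is on the way from \<open>y\<close> to
    \<open>y2\<close>; \<open>G_swap\<close> then identifies \<open>i\<close> with
    \<open>y\<close>.\<close>
  have c2: "G y i x"
  proof (rule ccontr)
    assume "\<not> G y i x"
    hence g: "G i y x" using e1[OF y, of x] MD[OF x(1)] xy by blast
    have "G i y y2"
    proof (cases "y2 = x")
      case False
      show ?thesis using G_trans(1)[OF I(1) MD(1)[OF y] MD(1)[OF x(1)] MD(1)[OF y2(1)]] g c1(2)[OF y2(1)] False y2y by blast
    qed (use g in simp)
    thus False using y2(2)[OF iuL(1)] G_swap[of i y y2] I MD[OF y] by auto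
  qed
  show False
  proof (cases "M = {x,y}")
    case True
    have y2x: "y2 = x" using True y2 y2y by blast
    have gs: "G x i y" "G x u y" "G y i x" "G y u x" "G i x u" "G i y u" "G u x i" "G u y i"
      using x(2) iuL y2 y2x MD[OF x(1)] MD[OF y] by auto
    \<comment> \<open>If exactly \<open>x\<close> and \<open>y\<close> are in between, the gates of
      all columns show that \<open>F x + F y - F i - F u\<close> is constant, a forbidden relation
      of four rows.\<close>
    define \<alpha> where "\<alpha> t = (of_bool (t = x) + of_bool (t = y) - of_bool (t = i) - of_bool (t = u) :: real)" for t
    have sumform: "(\<Sum>t\<in>I. \<alpha> t * h t) = h x + h y - h i - h u" for h :: "'i \<Rightarrow> real"
    proof -
      have "\<alpha> t * h t = (if t = x then h x else 0) + (if t = y then h y else 0)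
          - (if t = i then h i else 0) - (if t = u then h u else 0)" for t
        by (auto simp: \<alpha>_def)
      thus ?thesis using fin MD[OF x(1)] MD[OF y] I by (simp add: sum.distrib sum_subtractf)
    qed
    have s0: "sum \<alpha> I = 0" using sumform[of "\<lambda>_. 1"] by simp
    define K where "K = F x i + F y i - F i i - F u i"
    have K: "F x c + F y c - F i c - F u c = K" if "c \<in> {i,u,x,y}" for c
      using gs that unfolding K_def G_def dst_def by auto
    have Leq: "L = {i,u,x,y}" using True iuL by (auto simp: M_def)
    have "F x e + F y e - F i e - F u e = K" if e: "e \<in> I" for e
    proof -
      obtain c where c: "c \<in> L" "\<And>m. m \<in> L \<Longrightarrow> G m c e"
      proof (cases "e \<in> L")
        case True
        thus ?thesis using that[of e] by simp
      next
        case False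
        thus ?thesis using up_Btw[OF I e] iuL that by (auto simp: L_def)
      qed
      have "F c e - F m e = F c c - F m c" if "m \<in> L" for m using c(2)[OF that] by (simp add: G_iff)
      from this[of i] this[of u] this[of x] this[of y] K[of c] c(1) Leq
      show ?thesis by auto
    qed
    hence "\<alpha> x = 0" using indep[OF s0, of K x] sumform MD[OF x(1)] by auto
    thus False using xy MD[OF x(1)] by (simp add: \<alpha>_def)
  next
    case False
    then obtain t0 where t0: "t0 \<in> M" "t0 \<noteq> x" "t0 \<noteq> y" using x(1) y by blast
    \<comment> \<open>If \<open>i\<close> were on the way from \<open>y\<close> to every other
      member, the last member seen from \<open>t0\<close> would have to be \<open>y\<close>, and
      \<open>t0\<close> and \<open>x\<close> would each lie on the way from the other to
      \<open>y\<close>.\<close>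
    have "\<exists>t\<in>M. t \<noteq> x \<and> t \<noteq> y \<and> \<not> G y i t"
    proof (rule ccontr)
      assume neg: "\<not> ?thesis"
      obtain t2 where t2: "t2 \<in> M" "\<And>m. m \<in> L \<Longrightarrow> G t0 m t2" using star[OF t0(1)] by blast
      have "G i y t2"
        using G_trans(2)[of t0 i y t2] vy[OF t0(1,3)] t2(2)[of y] MD[OF y] MD[OF t0(1)] MD[OF t2(1)] I by blast
      moreover have "G y i t2" if "t2 \<noteq> y" using neg t2(1) c2 that by (cases "t2 = x") auto
      ultimately have "t2 = y" using G_swap[of i y t2] I MD[OF y] by blast
      hence "G t0 x y" "G x t0 y" using t2(2)[of x] x MD t0 by auto
      thus False using G_swap[of t0 x y] MD[OF t0(1)] MD[OF x(1)] t0 by auto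
    qed
    then obtain t where t: "t \<in> M" "t \<noteq> x" "t \<noteq> y" "\<not> G y i t" by blast
    have ixt: "G i x t" using c1(2) t by blast
    define y' where "y' = s t"
    have y': "y' \<in> M" "\<And>m. m \<in> L \<Longrightarrow> G y' m t" using sM s(2) t by (auto simp: y'_def)
    note xI = MD[OF x(1)] and yI = MD[OF y] and tI = MD[OF t(1)] and y'I = MD[OF y'(1)]
    have ty': "\<tau> y' \<noteq> \<tau> i" "\<tau> y' \<noteq> \<tau> u" using tau_inj[of y' i] tau_inj[of y' u] y'I I by auto
    \<comment> \<open>Adding \<open>x\<close> and removing \<open>\<tau> y'\<close> subtracts
      \<open>dst y' m + dst m x\<close> from the value of row \<open>m\<close>, up to a constant.
      The optimal rows become the members of the interval on a shortest way from \<open>y'\<close>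
      to \<open>x\<close>. They include \<open>i\<close> and \<open>u\<close> but not
      \<open>y\<close>, so the gate of \<open>y\<close> among them contradicts the choice of
      \<open>y\<close>.\<close>
    define z where "z e = zz i u e + (of_bool (e = x) - of_bool (e = \<tau> y'))" for e
    have zx: "zz i u v = 0" if "v \<in> M" for v using zz_Btw(3)[OF I, of v] MD[OF that] by (simp add: L_def)
    have zty: "0 \<le> zz i u (\<tau> y')" using ty' by (simp add: zz_def)
    have sumz: "sum z I = 0"
      using sum_zz0[OF I(1,2)] sum_root0[OF xI(1) tau_in[OF y'I(1)]] by (simp add: z_def sum.distrib)
    have zb: "\<bar>z e\<bar> \<le> 1" for e
      using zz_bound[OF I, of e] zx[OF x(1)] zty
      by (cases "e = x"; cases "e = \<tau> y'") (simp_all add: z_def abs_le_iff)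
    have val: "(\<Sum>e\<in>I. of_int (z e) * F m e)
        = dst i (\<tau> i) + dst u (\<tau> u) + dst y' (\<tau> y') - (DD i m + DD u m) - (dst y' m + dst m x)" if m: "m \<in> I" for m
    proof -
      have "of_int (z e) * F m e = of_int (zz i u e) * F m e + of_int (of_bool (e = x) - of_bool (e = \<tau> y')) * F m e" for e
        by (simp add: z_def algebra_simps)
      hence "(\<Sum>e\<in>I. of_int (z e) * F m e) = (\<Sum>e\<in>I. of_int (zz i u e) * F m e) + (F m x - F m (\<tau> y'))"
        using sum_root[OF xI(1) tau_in[OF y'I(1)], of m] by (simp add: sum.distrib)
      thus ?thesis
        using sum_zz[OF I(1,2), of m] root_val[OF I(1,1) m] root_val[OF I(2,2) m] root_val[OF xI(1) y'I(1) m]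
        by (simp add: DD_def)
    qed
    have le1: "DD i x + DD u x \<le> DD i m + DD u m" if "m \<in> I" for m
      using tri[OF I(1) that I(2)] tri[OF I(2) that I(1)] xI by (simp add: DD_def G_def)
    have le2: "dst y' x \<le> dst y' m + dst m x" if "m \<in> I" for m
      using tri[OF y'I(1) that xI(1)] .
    have Jz: "J z = {m \<in> L. G y' m x}"
    proof (intro set_eqI iffI)
      fix m assume "m \<in> J z"
      hence m: "m \<in> I" and "(\<Sum>e\<in>I. of_int (z e) * F x e) \<le> (\<Sum>e\<in>I. of_int (z e) * F m e)"
        using xI by (auto simp: J_def)
      hence "DD i m + DD u m + (dst y' m + dst m x) \<le> DD i x + DD u x + dst y' x"
        using val[OF m] val[OF xI(1)] by simp
      hence "DD i m + DD u m \<le> DD i x + DD u x" "dst y' x = dst y' m + dst m x"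
        using le1[OF m] le2[OF m] by linarith+
      thus "m \<in> {m \<in> L. G y' m x}"
        using tri[OF I(1) m I(2)] tri[OF I(2) m I(1)] xI m by (auto simp: DD_def G_def L_def Btw_def)
    next
      fix m assume "m \<in> {m \<in> L. G y' m x}"
      hence m: "m \<in> I" "DD i m + DD u m = DD i x + DD u x" "dst y' x = dst y' m + dst m x"
        using xI LI by (auto simp: DD_def G_def L_def Btw_def)
      have "(\<Sum>e\<in>I. of_int (z e) * F w e) \<le> (\<Sum>e\<in>I. of_int (z e) * F m e)" if "w \<in> I" for w
        using val[OF that] val[OF m(1)] le1[OF that] le2[OF that] m by linarith
      thus "m \<in> J z" using m by (simp add: J_def)
    qed
    have iJ: "i \<in> J z"
      using y'(2)[OF iuL(1)] y'(2)[OF xI(4)] ixt iuL by (auto simp: Jz G_def)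
    have "G u x t"
    proof (rule ccontr)
      assume "\<not> G u x t"
      hence "G x u t" using e2[OF x(1), of t] tI t by blast
      hence "G i u t" using G_trans'(1)[of i x u t] ixt I xI tI by blast
      thus False using G_antisym[of i u t] I tI by blast
    qed
    hence uJ: "u \<in> J z"
      using y'(2)[OF iuL(2)] y'(2)[OF xI(4)] iuL by (auto simp: Jz G_def)
    have yJ: "y \<notin> J z"
    proof
      assume "y \<in> J z"
      hence "G y' y x" by (simp add: Jz)
      hence "G y x t" using G_trans(2)[of y' y x t] y'(2)[OF xI(4)] y'I yI xI tI by blast
      hence "G y i t" using G_trans(1)[of y i x t] c2 I yI xI tI by blast
      thus False using t by blast
    qed
    have zy: "z y \<le> 0" using zx[OF y] xy by (simp add: z_def)
    have znn: "0 \<le> z m" if m: "m \<in> J z" for m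
    proof (cases "m = \<tau> y'")
      case True
      have "G y' (\<tau> y') x" "G y' x (\<tau> y')" using m True G_tau[OF y'I(1) xI(1)] by (auto simp: Jz)
      hence "\<tau> y' = x" using G_antisym[of y' "\<tau> y'" x] y'I xI tau_in by blast
      thus ?thesis using True zx[OF x(1)] by (simp add: z_def)
    next
      case False
      have "0 \<le> zz i u m" using zz_Btw(1)[OF I, of m] m by (simp add: Jz L_def)
      thus ?thesis using False by (simp add: z_def)
    qed
    obtain c where c: "c \<in> J z" "\<And>m. m \<in> J z \<Longrightarrow> G m c y"
      using up_good[OF zb sumz yI(1) zy znn] by blast
    have cL: "c \<in> L" using c by (simp add: Jz)
    have "c \<noteq> i" using c(2)[OF uJ] G_antisym[of u i y] I yI by auto
    moreover have "c \<noteq> u" using c(2)[OF iJ] G_antisym[of i u y] I yI by auto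
    ultimately have "c \<in> M" using cL by (simp add: M_def)
    thus False using c(2)[OF iJ] ymin[of c] yJ c(1) by blast
  qed
qed

lemma trich: assumes "i \<in> I" "u \<in> I" "e \<in> I" "i \<noteq> u" "e \<noteq> i" "e \<noteq> u"
  shows "G i u e \<or> G u i e"
  using edge_split assms no_between by blast

text \<open>Otherwise \<open>trich\<close> gives \<open>G e u i\<close>, and \<open>u\<close> would
  be strictly between \<open>i\<close> and \<open>e\<close>.\<close>

lemma cyc: assumes "i \<in> I" "u \<in> I" "e \<in> I" "i \<noteq> u" "e \<noteq> i" "e \<noteq> u" "G i u e"
  shows "G u e i"
proof (rule ccontr)
  assume "\<not> G u e i"
  hence "G e u i" using trich[of u e i] assms by auto
  hence "u \<in> Btw i e" using assms by (simp add: Btw_def)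
  thus False using no_between[of i e] assms by auto
qed

lemma DD_const: assumes "i \<in> I" "u \<in> I" "e \<in> I" "i \<noteq> u" "e \<noteq> i" "e \<noteq> u"
  shows "DD i u = DD i e"
proof (cases "G i u e")
  case True
  hence "G u e i" using cyc assms by blast
  thus ?thesis using True by (simp add: DD_def G_def)
next
  case False
  hence g: "G u i e" using trich assms by blast
  hence "G i e u" using cyc[of u i e] assms by auto
  hence "G e u i" using cyc[of i e u] assms by auto
  with g \<open>G i e u\<close> show ?thesis by (simp add: DD_def G_def)
qed

text \<open>The cyclic order is cut at \<open>e0\<close>, and the position of an index counts the
  indices from it onwards. Rows \<open>t\<close> and \<open>e0\<close> differ by one constant from
  \<open>t\<close> onwards and by another before \<open>t\<close>; the jump is the round trip
  \<open>DD e0 t\<close>, which does not depend on \<open>t\<close>.\<close>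

theorem cyclic_order:
  assumes e0: "e0 \<in> I" and card2: "2 \<le> card I"
  obtains \<delta> p where "0 < \<delta>" "bij_betw p I {1..card I}" "p e0 = card I"
    "\<And>t u. \<lbrakk>t \<in> I; u \<in> I\<rbrakk> \<Longrightarrow> \<exists>c. \<forall>e\<in>I. F t e - F u e = \<delta> * (of_bool (p e \<le> p t) - of_bool (p e \<le> p u)) + c"
proof -
  define N where "N = I - {e0}"
  have finN: "finite N" and cardN: "card N = card I - 1" using fin e0 by (auto simp: N_def)
  have "N \<noteq> {}" using cardN card2 by auto
  then obtain u0 where u0: "u0 \<in> N" by blast
  define \<delta> where "\<delta> = DD e0 u0"
  have \<delta>0: "0 < \<delta>" using DD_pos[of e0 u0] u0 e0 by (auto simp: N_def \<delta>_def)
  have \<delta>: "DD e0 t = \<delta>" if "t \<in> N" for t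
    using DD_const[of e0 u0 t] that u0 e0 by (cases "t = u0") (auto simp: N_def \<delta>_def)
  define p where "p e = (if e = e0 then card I else card {u \<in> N. G e0 e u})" for e
  have tot: "G e0 e t" if "t \<in> N" "e \<in> N" "\<not> G e0 t e" for t e
    using trich[of e0 t e] cyc[of t e0 e] that e0 by (cases "e = t") (auto simp: N_def)
  have mono: "card {u \<in> N. G e0 e u} \<le> card {u \<in> N. G e0 t u}" if "t \<in> N" "e \<in> N" "G e0 t e" for t e
    using G_trans(1)[of e0 t e] that e0 finN by (intro card_mono) (auto simp: N_def)
  have smono: "card {u \<in> N. G e0 e u} < card {u \<in> N. G e0 t u}" if "t \<in> N" "e \<in> N" "G e0 t e" "t \<noteq> e" for t e
  proof (rule psubset_card_mono)
    have "{u \<in> N. G e0 e u} \<subseteq> {u \<in> N. G e0 t u}"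
      using G_trans(1)[of e0 t e] that e0 by (auto simp: N_def)
    moreover have "t \<notin> {u \<in> N. G e0 e u}" using G_antisym[of e0 t e] that e0 by (auto simp: N_def)
    moreover have "t \<in> {u \<in> N. G e0 t u}" using that by simp
    ultimately show "{u \<in> N. G e0 e u} \<subset> {u \<in> N. G e0 t u}" by blast
  qed (use finN in simp)
  have ple: "p e \<le> p t \<longleftrightarrow> G e0 t e" if "t \<in> N" "e \<in> N" for t e
    using mono[of t e] smono[of e t] tot[of t e] that by (cases "G e0 t e"; cases "t = e") (fastforce simp: p_def N_def)+
  have pN: "1 \<le> p e" "p e < card I" if "e \<in> N" for e
  proof -
    have "e \<in> {u \<in> N. G e0 e u}" using that by simp
    hence "0 < card {u \<in> N. G e0 e u}" using finN card_gt_0_iff by fastforce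
    moreover have "card {u \<in> N. G e0 e u} \<le> card N" by (intro card_mono finN) auto
    ultimately show "1 \<le> p e" "p e < card I" using that cardN card2 by (auto simp: p_def N_def)
  qed
  have inj: "inj_on p I"
  proof
    fix e t assume et: "e \<in> I" "t \<in> I" "p e = p t"
    show "e = t"
    proof (cases "e = e0 \<or> t = e0")
      case True
      thus ?thesis using et pN[of e] pN[of t] by (auto simp: N_def p_def split: if_splits)
    next
      case False
      hence "G e0 t e" "G e0 e t" using ple[of t e] ple[of e t] et by (auto simp: N_def)
      thus ?thesis using G_antisym[of e0 t e] et e0 by auto
    qed
  qed
  have sub: "p ` I \<subseteq> {1..card I}"
  proof
    fix v assume "v \<in> p ` I"
    then obtain e where "e \<in> I" "v = p e" by blast
    thus "v \<in> {1..card I}" using pN[of e] card2 by (cases "e = e0") (auto simp: p_def N_def)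
  qed
  have bij: "bij_betw p I {1..card I}"
    unfolding bij_betw_def using inj card_subset_eq[OF _ sub] card_image[OF inj] by simp
  have key: "\<exists>c. \<forall>e\<in>I. F t e - F e0 e = \<delta> * of_bool (p e \<le> p t) + c" if t: "t \<in> I" for t
  proof (cases "t = e0")
    case True
    have "p e \<le> p t" if "e \<in> I" for e using pN[of e] that True by (cases "e = e0") (auto simp: p_def N_def)
    thus ?thesis using True by (intro exI[of _ "-\<delta>"]) simp
  next
    case False
    hence tN: "t \<in> N" using t by (simp add: N_def)
    have "F t e - F e0 e = \<delta> * of_bool (p e \<le> p t) + (F t e0 - F e0 e0)" if e: "e \<in> I" for e
    proof (cases "e = e0")
      case True
      thus ?thesis using pN[OF tN] by (simp add: p_def)
    next
      case False
      hence eN: "e \<in> N" using e by (simp add: N_def)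
      show ?thesis
      proof (cases "G e0 t e")
        case True
        have "F t e - F e0 e = F t t - F e0 t" using True by (simp add: G_iff)
        thus ?thesis using True ple[OF tN eN] \<delta>[OF tN] by (simp add: DD_def dst_def)
      next
        case n: False
        have "G t e0 e" using trich[of e0 t e] n e0 t e tN eN by (cases "t = e") (auto simp: N_def)
        hence "F e0 e - F t e = F e0 e0 - F t e0" by (simp add: G_iff)
        thus ?thesis using n ple[OF tN eN] by simp
      qed
    qed
    thus ?thesis by blast
  qed
  have "\<exists>c. \<forall>e\<in>I. F t e - F u e = \<delta> * (of_bool (p e \<le> p t) - of_bool (p e \<le> p u)) + c" if tu: "t \<in> I" "u \<in> I" for t u
  proof -
    obtain c where c: "\<And>e. e \<in> I \<Longrightarrow> F t e - F e0 e = \<delta> * of_bool (p e \<le> p t) + c" using key[OF tu(1)] by blast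
    obtain c' where c': "\<And>e. e \<in> I \<Longrightarrow> F u e - F e0 e = \<delta> * of_bool (p e \<le> p u) + c'" using key[OF tu(2)] by blast
    show ?thesis
    proof (intro exI[of _ "c - c'"] ballI)
      fix e assume "e \<in> I"
      thus "F t e - F u e = \<delta> * (of_bool (p e \<le> p t) - of_bool (p e \<le> p u)) + (c - c')"
        using c[of e] c'[of e] by (simp add: right_diff_distrib)
    qed
  qed
  thus thesis using that[of \<delta> p] \<delta>0 bij by (auto simp: p_def)
qed

end

section \<open>Counting coordinate vectors\<close>

text \<open>Elements of \<open>V\<close> stand for classes of coordinates, those of \<open>I\<close>
  for regions. \<open>pair0\<close> is what an exchange symmetry leaves behind: the reflection
  swapping \<open>a\<close> and \<open>b\<close> interchanges the facets \<open>x\<close> and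
  \<open>y\<close> of the cone of \<open>j\<close>, and \<open>r\<close>, \<open>s\<close> are the
  coefficients of the root in their normals.\<close>

locale column_count =
  fixes I :: "'i set" and V :: "'v set" and f :: "'i \<Rightarrow> 'v \<Rightarrow> real"
  assumes finI: "finite I" and finV: "finite V"
    and cover: "a \<in> V \<Longrightarrow> \<exists>j\<in>I. \<forall>t\<in>I. f t a \<le> f j a"
    and pair0: "\<lbrakk>j \<in> I; a \<in> V; b \<in> V; a \<noteq> b; \<And>t. t \<in> I \<Longrightarrow> f t a \<le> f j a; \<And>t. t \<in> I \<Longrightarrow> f t b \<le> f j b\<rbrakk> \<Longrightarrow>
      \<exists>x y r s. x \<in> I \<and> y \<in> I \<and> x \<noteq> j \<and> y \<noteq> j \<and> r * s < 0
       \<and> (\<forall>c\<in>V. r * (f j c - f x c) + s * (f j c - f y c) = of_bool (c = a) - of_bool (c = b))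
       \<and> (\<forall>t\<in>I. t \<noteq> x \<longrightarrow> t \<noteq> y \<longrightarrow> f j a - f t a = f j b - f t b)
       \<and> (f j a - f x a) - (f j b - f x b) = 1 / r \<and> (f j a - f y a) - (f j b - f y b) = 1 / s"
begin

definition N :: "'i \<Rightarrow> 'v set" where "N j = {a \<in> V. \<forall>t\<in>I. f t a \<le> f j a}"

definition rel :: "'i \<Rightarrow> 'v \<Rightarrow> 'v \<Rightarrow> 'i \<Rightarrow> 'i \<Rightarrow> real \<Rightarrow> real \<Rightarrow> bool" where
  "rel j a b x y r s \<longleftrightarrow> x \<in> I \<and> y \<in> I \<and> x \<noteq> j \<and> y \<noteq> j \<and> r * s < 0
       \<and> (\<forall>c\<in>V. r * (f j c - f x c) + s * (f j c - f y c) = of_bool (c = a) - of_bool (c = b))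
       \<and> (\<forall>t\<in>I. t \<noteq> x \<longrightarrow> t \<noteq> y \<longrightarrow> f j a - f t a = f j b - f t b)
       \<and> (f j a - f x a) - (f j b - f x b) = 1 / r \<and> (f j a - f y a) - (f j b - f y b) = 1 / s"

definition supp :: "'i \<Rightarrow> 'v \<Rightarrow> 'v \<Rightarrow> 'i set" where
  "supp j a b = {t \<in> I. f j a - f t a \<noteq> f j b - f t b}"

lemma relE: assumes "j \<in> I" "a \<in> N j" "b \<in> N j" "a \<noteq> b"
  obtains x y r s where "rel j a b x y r s"
  using pair0[of j a b] assms by (auto simp: N_def rel_def)

lemma rel_swap: "rel j a b x y r s \<Longrightarrow> rel j a b y x s r"
  by (auto simp: rel_def mult.commute add.commute)

lemma rel_facts:
  assumes "rel j a b x y r s"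
  shows "r \<noteq> 0" "s \<noteq> 0" "x \<noteq> y" "supp j a b = {x,y}" "x \<in> I" "y \<in> I" "x \<noteq> j" "y \<noteq> j" "r * s < 0"
proof -
  show rs: "r \<noteq> 0" "s \<noteq> 0" "r * s < 0" "x \<in> I" "y \<in> I" "x \<noteq> j" "y \<noteq> j" using assms by (auto simp: rel_def)
  have "1 / r \<noteq> 1 / s" using rs by (auto simp: mult_less_0_iff)
  thus "x \<noteq> y" using assms by (auto simp: rel_def)
  show "supp j a b = {x,y}" using assms rs by (auto simp: rel_def supp_def)
qed

lemma rel_exists: assumes "j \<in> I" "a \<in> N j" "b \<in> N j" "a \<noteq> b" "supp j a b = {x,y}" "x \<noteq> y"
  obtains r s where "rel j a b x y r s"
proof -
  obtain x' y' r s where r: "rel j a b x' y' r s" using relE assms by metis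
  hence "{x',y'} = {x,y}" using rel_facts(4) assms by metis
  hence "x' = x \<and> y' = y \<or> x' = y \<and> y' = x" by (auto simp: doubleton_eq_iff)
  thus thesis using r rel_swap[OF r] that by auto
qed

lemma rel_eval:
  assumes "rel j a b x y r s" "c \<in> V"
  shows "r * (f j c - f x c) + s * (f j c - f y c) = of_bool (c = a) - of_bool (c = b)"
  using assms by (auto simp: rel_def)

lemma NV: "a \<in> N j \<Longrightarrow> a \<in> V" by (simp add: N_def)

lemma supp_commute: "supp j a b = supp j b a" by (auto simp: supp_def)

text \<open>If two of the three exchanges involved the same two rows, so would the third. Comparing
  coefficients gives \<open>u * u + v * v + u * v = 0\<close> for nonzero real ratios
  \<open>u\<close>, \<open>v\<close>.\<close>

lemma triple_not_same:
  assumes j: "j \<in> I" and N: "a \<in> N j" "b \<in> N j" "c \<in> N j" and d: "a \<noteq> b" "a \<noteq> c" "b \<noteq> c"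
  shows "supp j a b \<noteq> supp j a c"
proof
  assume eq: "supp j a b = supp j a c"
  obtain x y r s where ab: "rel j a b x y r s" using relE j N d by metis
  note F = rel_facts[OF ab]
  obtain r' s' where ac: "rel j a c x y r' s'" using rel_exists[OF j N(1,3) d(2), of x y] eq F by metis
  note F' = rel_facts[OF ac]
  have "supp j b c \<subseteq> supp j a b \<union> supp j a c" by (auto simp: supp_def)
  hence sub: "supp j b c \<subseteq> {x,y}" using eq F(4) by auto
  obtain x2 y2 r2 s2 where bc0: "rel j b c x2 y2 r2 s2" using relE j N d by metis
  have "supp j b c = {x,y}" using sub rel_facts(3,4)[OF bc0] by auto
  then obtain r'' s'' where bc: "rel j b c x y r'' s''" using rel_exists[OF j N(2,3) d(3), of x y] F by metis
  note F'' = rel_facts[OF bc]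
  have e1: "(f j a - f x a) - (f j b - f x b) = 1 / r" "(f j a - f y a) - (f j b - f y b) = 1 / s"
    "(f j a - f x a) - (f j c - f x c) = 1 / r'" "(f j a - f y a) - (f j c - f y c) = 1 / s'"
    "(f j b - f x b) - (f j c - f x c) = 1 / r''" "(f j b - f y b) - (f j c - f y c) = 1 / s''"
    using ab ac bc by (auto simp: rel_def)
  have i: "1 / r'' = 1 / r' - 1 / r" "1 / s'' = 1 / s' - 1 / s" using e1 by linarith+
  have "r' * ((f j a - f x a) - (f j b - f x b)) + s' * ((f j a - f y a) - (f j b - f y b)) = 1"
    using rel_eval[OF ac NV[OF N(1)]] rel_eval[OF ac NV[OF N(2)]] d by (simp add: algebra_simps)
  hence uv: "r' / r + s' / s = 1" using e1 by simp
  have "r'' * ((f j a - f x a) - (f j b - f x b)) + s'' * ((f j a - f y a) - (f j b - f y b)) = -1"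
    using rel_eval[OF bc NV[OF N(1)]] rel_eval[OF bc NV[OF N(2)]] d by (simp add: algebra_simps)
  hence uv2: "r'' / r + s'' / s = -1" using e1 by simp
  define u where "u = r' / r"
  define v where "v = s' / s"
  have uvs: "u + v = 1" "u \<noteq> 0" "v \<noteq> 0" using uv F(1,2) F'(1,2) by (auto simp: u_def v_def)
  have "r'' * (r - r') = r' * r" using i(1) F(1) F'(1) F''(1) by (simp add: field_simps)
  moreover have "v = (r - r') / r" using uvs(1) F(1) by (simp add: u_def field_simps)
  ultimately have 1: "(r'' / r) * v = u" using F(1) by (simp add: u_def)
  have "s'' * (s - s') = s' * s" using i(2) F(2) F'(2) F''(2) by (simp add: field_simps)
  moreover have "u = (s - s') / s" using uvs(1) F(2) by (simp add: v_def field_simps)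
  ultimately have 2: "(s'' / s) * u = v" using F(2) by (simp add: v_def)
  have "u * u + v * v = (r'' / r) * v * u + (s'' / s) * u * v" using 1 2 by simp
  also have "\<dots> = (r'' / r + s'' / s) * (u * v)" by (simp add: distrib_right distrib_left mult_ac)
  also have "\<dots> = - (u * v)" using uv2 by simp
  finally have "u * u + v * v + u * v = 0" by simp
  moreover have "u * u + v * v + u * v = (u + v/2)\<^sup>2 + 3/4 * v\<^sup>2" by (simp add: power2_eq_square algebra_simps)
  moreover have "0 \<le> (u + v/2)\<^sup>2" "0 \<le> v\<^sup>2" by simp_all
  ultimately have "v\<^sup>2 = 0" by linarith
  thus False using uvs by simp
qed

text \<open>A row in exactly one of two supports belongs to the third. Two-element supports that are
  not equal are therefore the three sides of a triangle.\<close>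

lemma triple:
  assumes j: "j \<in> I" and N: "a \<in> N j" "b \<in> N j" "c \<in> N j" and d: "a \<noteq> b" "a \<noteq> c" "b \<noteq> c"
  obtains x y z where "supp j a b = {x,y}" "supp j a c = {x,z}" "supp j b c = {y,z}" "x \<noteq> y" "x \<noteq> z" "y \<noteq> z"
proof -
  obtain x y r s where ab: "rel j a b x y r s" using relE j N d by metis
  obtain x' z r' s' where ac: "rel j a c x' z r' s'" using relE j N d by metis
  obtain x2 y2 r2 s2 where bc: "rel j b c x2 y2 r2 s2" using relE j N d by metis
  note F = rel_facts[OF ab] and F' = rel_facts[OF ac] and F2 = rel_facts[OF bc]
  have sd: "supp j a b - supp j a c \<subseteq> supp j b c" "supp j a c - supp j a b \<subseteq> supp j b c" by (auto simp: supp_def)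
  have ne: "supp j a b \<noteq> supp j a c" using triple_not_same assms by blast
  have "supp j a b \<inter> supp j a c \<noteq> {}"
  proof
    assume "supp j a b \<inter> supp j a c = {}"
    hence "{x,y,x',z} \<subseteq> {x2,y2}" "card {x,y,x',z} = 4" using sd F F' F2 by auto
    thus False using card_mono[of "{x2,y2}" "{x,y,x',z}"] card_insert_le_m1[of 2 "{y2}" x2] by auto
  qed
  then obtain p where p: "p \<in> {x,y}" "p \<in> {x',z}" using F F' by auto
  obtain q where q: "{x,y} = {p,q}" "p \<noteq> q" using p F(3) by auto
  obtain q' where q': "{x',z} = {p,q'}" "p \<noteq> q'" using p F'(3) by auto
  have qq: "q \<noteq> q'" using ne F(4) F'(4) q q' by auto
  have "{q,q'} \<subseteq> supp j b c" using sd F(4) F'(4) q q' qq by auto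
  hence "supp j b c = {q,q'}" using F2(4) qq by auto
  thus thesis using that[of p q q'] F(4) F'(4) q q' qq by auto
qed

text \<open>Each relation is evaluated on the other pair of columns. With equal supports the signs
  of \<open>r * s\<close> and \<open>r' * s'\<close> clash. With exactly one common row the regions
  are forced to be \<open>j = y'\<close> and \<open>i = y\<close>, and the two equations then give
  \<open>r * r' = 0\<close>.\<close>

lemma disjoint_pairs:
  assumes j: "j \<in> I" "a \<in> N j" "b \<in> N j" "a \<noteq> b" and i: "i \<in> I" "c \<in> N i" "e \<in> N i" "c \<noteq> e"
    and dis: "{a,b} \<inter> {c,e} = {}"
  shows "supp j a b \<inter> supp i c e = {}"
proof (rule ccontr)
  assume "\<not> ?thesis"
  then obtain x where x: "x \<in> supp j a b" "x \<in> supp i c e" by blast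
  obtain y where y: "supp j a b = {x,y}" "x \<noteq> y"
    using x(1) relE[OF j] rel_facts(3,4) by (metis doubleton_eq_iff insertE singletonD)
  obtain y' where y': "supp i c e = {x,y'}" "x \<noteq> y'"
    using x(2) relE[OF i] rel_facts(3,4) by (metis doubleton_eq_iff insertE singletonD)
  obtain r s where R: "rel j a b x y r s" using rel_exists[OF j y] by blast
  obtain r' s' where R': "rel i c e x y' r' s'" using rel_exists[OF i y'] by blast
  note F = rel_facts[OF R] and F' = rel_facts[OF R']
  define D' where "D' t = (f i c - f t c) - (f i e - f t e)" for t
  define D where "D t = (f j a - f t a) - (f j b - f t b)" for t
  have D': "D' x = 1 / r'" "D' y' = 1 / s'" "\<And>t. t \<in> I \<Longrightarrow> t \<noteq> x \<Longrightarrow> t \<noteq> y' \<Longrightarrow> D' t = 0"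
    using R' by (auto simp: D'_def rel_def)
  have D: "D x = 1 / r" "D y = 1 / s" "\<And>t. t \<in> I \<Longrightarrow> t \<noteq> x \<Longrightarrow> t \<noteq> y \<Longrightarrow> D t = 0"
    using R by (auto simp: D_def rel_def)
  have nd: "c \<noteq> a" "c \<noteq> b" "e \<noteq> a" "e \<noteq> b" "a \<noteq> c" "b \<noteq> c" "a \<noteq> e" "b \<noteq> e" using dis by auto
  have E1: "r * (D' x - D' j) + s * (D' y - D' j) = 0"
    using rel_eval[OF R NV[OF i(2)]] rel_eval[OF R NV[OF i(3)]] nd by (simp add: D'_def algebra_simps)
  have E2: "r' * (D x - D i) + s' * (D y' - D i) = 0"
    using rel_eval[OF R' NV[OF j(2)]] rel_eval[OF R' NV[OF j(3)]] nd by (simp add: D_def algebra_simps)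
  show False
  proof (cases "y = y'")
    case True
    have "D' j = 0" using D'(3)[OF j(1)] F True by auto
    hence "r / r' + s / s' = 0" using E1 D' True by simp
    hence "r * s' = - (s * r')" using F' by (simp add: field_simps)
    moreover have "(r * s) * (r' * s') = (r * s') * (s * r')" by (simp add: mult_ac)
    ultimately have "(r * s) * (r' * s') = - (s * r')\<^sup>2" by (simp add: power2_eq_square)
    moreover have "(r * s) * (r' * s') > 0" using F(9) F'(9) by (simp add: mult_neg_neg)
    moreover have "0 \<le> (s * r')\<^sup>2" by simp
    ultimately show False by linarith
  next
    case False
    have dy: "D' y = 0" "D y' = 0" using D'(3)[of y] D(3)[of y'] F F' y y' False by auto
    have jy: "j = y'"
    proof (rule ccontr)
      assume "j \<noteq> y'"
      hence "D' j = 0" using D'(3)[OF j(1)] F by auto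
      thus False using E1 dy D' F F' by simp
    qed
    have iy: "i = y"
    proof (rule ccontr)
      assume "i \<noteq> y"
      hence "D i = 0" using D(3)[OF i(1)] F' by auto
      thus False using E2 dy D F F' by simp
    qed
    have "r * (1 / r' - 1 / s') - s * (1 / s') = 0" using E1 dy D' jy by simp
    hence "r / r' = (r + s) / s'" by (simp add: right_diff_distrib add_divide_distrib)
    hence "r * s' = (r + s) * r'" using F'(1,2) by (simp add: frac_eq_eq)
    hence A: "r * s' = r * r' + r' * s" by (simp add: algebra_simps)
    have "r' * (1 / r - 1 / s) - s' * (1 / s) = 0" using E2 dy D iy by simp
    hence "r' / r = (r' + s') / s" by (simp add: right_diff_distrib add_divide_distrib)
    hence "r' * s = (r' + s') * r" using F(1,2) by (simp add: frac_eq_eq)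
    hence B: "r' * s = r * r' + r * s'" by (simp add: algebra_simps)
    from A B have "r * r' = 0" by linarith
    thus False using F F' by simp
  qed
qed

text \<open>\<open>l a\<close> is the row common to the supports of all pairs containing
  \<open>a\<close>, much as a vertex of a complete graph is recovered from its edges. Triangles
  determine it for three columns, and \<open>disjoint_pairs\<close> shows that a fourth column
  yields the same row.\<close>

lemma star_labels:
  assumes j: "j \<in> I" and A: "A \<subseteq> N j" "2 \<le> card A"
  obtains l where "inj_on l A" "\<And>a b. \<lbrakk>a \<in> A; b \<in> A; a \<noteq> b\<rbrakk> \<Longrightarrow> supp j a b = {l a, l b}"
proof (cases "card A = 2")
  case True
  then obtain a b where ab: "A = {a,b}" "a \<noteq> b" by (auto simp: card_2_iff)
  have "a \<in> N j" "b \<in> N j" using A ab by auto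
  then obtain x y r s where "rel j a b x y r s" using relE[OF j _ _ ab(2)] by blast
  hence xy: "supp j a b = {x,y}" "x \<noteq> y" using rel_facts by metis+
  show thesis
    by (rule that[of "\<lambda>v. if v = a then x else y"]) (use xy ab supp_commute[of j a b] in \<open>auto simp: inj_on_def\<close>)
next
  case False
  hence c3: "3 \<le> card A" using A by simp
  have finA: "finite A" using c3 by (metis card.infinite not_numeral_le_zero)
  have AN: "v \<in> N j" if "v \<in> A" for v using A that by blast
  have others: "\<exists>c\<in>A. c \<noteq> a \<and> c \<noteq> b" for a b
  proof (rule ccontr)
    assume "\<not> ?thesis"
    hence "A \<subseteq> {a,b}" by blast
    hence "card A \<le> card {a,b}" by (intro card_mono) auto
    also have "\<dots> \<le> 2" by (simp add: card_insert_if)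
    finally show False using c3 by simp
  qed
  have "\<exists>x. \<forall>e\<in>A. e \<noteq> a \<longrightarrow> x \<in> supp j a e" if a: "a \<in> A" for a
  proof -
    obtain b where b: "b \<in> A" "b \<noteq> a" using others[of a a] by blast
    obtain c where c: "c \<in> A" "c \<noteq> a" "c \<noteq> b" using others[of a b] by blast
    obtain x y z where x: "supp j a b = {x,y}" "supp j a c = {x,z}" "supp j b c = {y,z}" "x \<noteq> y" "x \<noteq> z" "y \<noteq> z"
      using triple[OF j AN[OF a] AN[OF b(1)] AN[OF c(1)] b(2)[symmetric] c(2)[symmetric] c(3)[symmetric]] by blast
    have "x \<in> supp j a e" if e: "e \<in> A" "e \<noteq> a" for e
    proof (cases "e = b \<or> e = c")
      case False
      show ?thesis
      proof (rule ccontr)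
        assume n: "x \<notin> supp j a e"
        obtain x1 y1 z1 where 1: "supp j a b = {x1,y1}" "supp j a e = {x1,z1}"
        proof -
          have "b \<noteq> e" using False by blast
          thus ?thesis using that by (rule triple[OF j AN[OF a] AN[OF b(1)] AN[OF e(1)] b(2)[symmetric] e(2)[symmetric]])
        qed
        have "x1 = y" using n 1 x(1) by auto
        hence "y \<in> supp j a e" using 1 by simp
        hence "supp j a e \<inter> supp j b c \<noteq> {}" using x by auto
        moreover have "{a,e} \<inter> {b,c} = {}" using b c e False by auto
        ultimately show False
          using disjoint_pairs[OF j AN[OF a] AN[OF e(1)] e(2)[symmetric] j AN[OF b(1)] AN[OF c(1)] c(3)[symmetric]] by blast
      qed
    qed (use x in auto)
    thus ?thesis by blast
  qed
  then obtain l where l: "\<And>a e. a \<in> A \<Longrightarrow> e \<in> A \<Longrightarrow> e \<noteq> a \<Longrightarrow> l a \<in> supp j a e" by metis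
  have lne: "l a \<noteq> l b" if ab: "a \<in> A" "b \<in> A" "a \<noteq> b" for a b
  proof
    assume eq: "l a = l b"
    obtain c where c: "c \<in> A" "c \<noteq> a" "c \<noteq> b" using others[of a b] by blast
    obtain x y z where x: "supp j a b = {x,y}" "supp j a c = {x,z}" "supp j b c = {y,z}" "x \<noteq> y" "x \<noteq> z" "y \<noteq> z"
      using triple[OF j AN[OF ab(1)] AN[OF ab(2)] AN[OF c(1)] ab(3) c(2)[symmetric] c(3)[symmetric]] by blast
    have "l a \<in> {x,y}" "l a \<in> {x,z}" "l b \<in> {y,z}"
      using l[OF ab(1,2)] l[OF ab(1) c(1)] l[OF ab(2) c(1)] ab c x by auto
    thus False using eq x by auto
  qed
  have "supp j a b = {l a, l b}" if ab: "a \<in> A" "b \<in> A" "a \<noteq> b" for a b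
  proof -
    obtain x y r s where "rel j a b x y r s" using relE[OF j AN[OF ab(1)] AN[OF ab(2)] ab(3)] by blast
    hence "supp j a b = {x,y}" using rel_facts by metis
    moreover have "l a \<in> supp j a b" "l b \<in> supp j a b"
      using l[OF ab(1,2)] l[OF ab(2,1)] ab supp_commute[of j a b] by auto
    ultimately show ?thesis using lne[OF ab] by auto
  qed
  moreover have "inj_on l A" using lne by (meson inj_onI)
  ultimately show thesis using that[of l] by blast
qed

definition Q :: "'v set \<Rightarrow> 'i \<Rightarrow> real" where "Q S t = (\<Sum>c\<in>S. f t c)"
definition JQ :: "'v set \<Rightarrow> 'i set" where "JQ S = {t \<in> I. \<forall>u\<in>I. Q S u \<le> Q S t}"

lemma JQ_nonempty: assumes "I \<noteq> {}" shows "JQ S \<noteq> {}"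
proof -
  have "Max (Q S ` I) \<in> Q S ` I" using assms finI by (intro Max_in) auto
  then obtain t where t: "t \<in> I" "Q S t = Max (Q S ` I)" by auto
  have "Q S u \<le> Q S t" if "u \<in> I" for u using that finI t by simp
  hence "t \<in> JQ S" using t by (simp add: JQ_def)
  thus ?thesis by blast
qed

lemma rel_sum:
  assumes "rel j a b x y r s" "S \<subseteq> V" "a \<in> S \<longleftrightarrow> b \<in> S"
  shows "r * (Q S j - Q S x) + s * (Q S j - Q S y) = 0"
proof -
  have finS: "finite S" using assms finV finite_subset by blast
  have "r * (Q S j - Q S x) + s * (Q S j - Q S y)
      = (\<Sum>c\<in>S. r * (f j c - f x c) + s * (f j c - f y c))"
    by (simp add: Q_def sum_subtractf sum.distrib sum_distrib_left[symmetric])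
  also have "\<dots> = (\<Sum>c\<in>S. of_bool (c = a) - of_bool (c = b))"
    using rel_eval[OF assms(1)] assms(2) by (intro sum.cong) auto
  also have "\<dots> = 0" using assms(3) finS by (simp add: sum_subtractf of_bool_def)
  finally show ?thesis .
qed

text \<open>For sums over sets that contain \<open>A\<close> or miss it, the gaps
  \<open>Q S j - Q S (l a)\<close> are positive multiples of one of them, with factors that do not
  depend on the set. If a label is optimal, its gap is not positive, and the label with the largest
  factor has the smallest gap.\<close>

lemma dominating_label:
  assumes j: "j \<in> I" and A: "A \<subseteq> N j" "A \<noteq> {}"
  obtains l b where "inj_on l A" "\<And>a c. \<lbrakk>a \<in> A; c \<in> A; a \<noteq> c\<rbrakk> \<Longrightarrow> supp j a c = {l a, l c}" "b \<in> A"
    "\<And>S a. \<lbrakk>S \<subseteq> V; A \<subseteq> S \<or> A \<inter> S = {}; a \<in> A - {b}; l a \<in> JQ S\<rbrakk> \<Longrightarrow> l b \<in> JQ S"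
proof -
  have "A \<subseteq> V" using A by (auto simp: N_def)
  hence finA: "finite A" using finV finite_subset by blast
  show thesis
  proof (cases "2 \<le> card A")
    case False
    moreover have "0 < card A" using A finA by (simp add: card_gt_0_iff)
    ultimately have "card A = 1" by linarith
    then obtain b where "A = {b}" by (auto simp: card_1_singleton_iff)
    thus thesis by (intro that[of "\<lambda>_. undefined" b]) auto
  next
    case True
    obtain l where l: "inj_on l A" "\<And>a b. \<lbrakk>a \<in> A; b \<in> A; a \<noteq> b\<rbrakk> \<Longrightarrow> supp j a b = {l a, l b}"
      using star_labels[OF j A(1) True] by blast
    obtain a1 where a1: "a1 \<in> A" using A by blast
    define good where "good S \<longleftrightarrow> S \<subseteq> V \<and> (A \<subseteq> S \<or> A \<inter> S = {})" for S
    have "\<exists>\<theta>>0. \<forall>S. good S \<longrightarrow> Q S j - Q S (l a) = \<theta> * (Q S j - Q S (l a1))" if a: "a \<in> A" for a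
    proof (cases "a = a1")
      case True thus ?thesis by (intro exI[of _ 1]) auto
    next
      case False
      obtain r s where R: "rel j a1 a (l a1) (l a) r s"
        using rel_exists[OF j subsetD[OF A(1) a1] subsetD[OF A(1) a] not_sym[OF False] l(2)[OF a1 a not_sym[OF False]]]
          inj_onD[OF l(1) _ a1 a] False by metis
      have rs: "r * s < 0" "s \<noteq> 0" using rel_facts[OF R] by auto
      have "0 < - r / s" using rs by (auto simp: mult_less_0_iff divide_less_0_iff)
      moreover have "Q S j - Q S (l a) = (- r / s) * (Q S j - Q S (l a1))" if "good S" for S
      proof -
        have "r * (Q S j - Q S (l a1)) + s * (Q S j - Q S (l a)) = 0"
          using rel_sum[OF R, of S] that a a1 by (auto simp: good_def)
        thus ?thesis using rs by (simp add: field_simps)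
      qed
      ultimately show ?thesis by blast
    qed
    then obtain \<theta> where \<theta>: "\<And>a. a \<in> A \<Longrightarrow> 0 < \<theta> a"
        "\<And>a S. a \<in> A \<Longrightarrow> good S \<Longrightarrow> Q S j - Q S (l a) = \<theta> a * (Q S j - Q S (l a1))" by metis
    have "Max (\<theta> ` A) \<in> \<theta> ` A" using A finA by (intro Max_in) auto
    then obtain b where b: "b \<in> A" "\<theta> b = Max (\<theta> ` A)" by auto
    hence bmax: "\<theta> a \<le> \<theta> b" if "a \<in> A" for a using that finA by simp
    have "l b \<in> JQ S" if S: "S \<subseteq> V" "A \<subseteq> S \<or> A \<inter> S = {}" and a: "a \<in> A - {b}" "l a \<in> JQ S" for S a
    proof -
      have g: "good S" using S by (simp add: good_def)
      have "Q S j \<le> Q S (l a)" using a j by (simp add: JQ_def)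
      hence "\<theta> a * (Q S j - Q S (l a1)) \<le> 0" using \<theta>(2)[of a S] a g by auto
      hence le: "Q S j - Q S (l a1) \<le> 0" using \<theta>(1)[of a] a by (simp add: mult_le_0_iff)
      have "Q S j - Q S (l b) \<le> Q S j - Q S (l a)"
        using \<theta>(2)[of a S] \<theta>(2)[of b S] a b g bmax[of a] le by (auto intro: mult_right_mono_neg)
      moreover have "l b \<in> I"
      proof -
        have "l b \<in> supp j a b" using l(2)[of a b] a b by auto
        thus ?thesis by (simp add: supp_def)
      qed
      ultimately show ?thesis using a(2) by (force simp: JQ_def)
    qed
    thus thesis using that[of l b] l b by blast
  qed
qed

text \<open>
  Regions are assigned to columns so that as few regions as possible are used. Every column sharing
  its region with others then costs one region that is dominated by another one on the sums of
  all groups, and the sums of different groups have disjoint sets of optimal regions.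
\<close>

theorem card_columns: "card V \<le> card I"
proof (cases "V = {}")
  case False
  define good where "good \<phi> \<longleftrightarrow> (\<forall>v\<in>V. \<phi> v \<in> I \<and> v \<in> N (\<phi> v))" for \<phi>
  have "\<forall>v\<in>V. \<exists>j. j \<in> I \<and> v \<in> N j" using cover by (auto simp: N_def)
  then obtain \<phi>0 where "good \<phi>0" unfolding good_def by metis
  then obtain \<phi> where \<phi>: "good \<phi>" and least: "\<And>\<psi>. good \<psi> \<Longrightarrow> card (\<phi> ` V) \<le> card (\<psi> ` V)"
    using ex_has_least_nat[of good \<phi>0 "\<lambda>\<psi>. card (\<psi> ` V)"] by metis
  define K where "K = \<phi> ` V"
  define Gr where "Gr i = {v \<in> V. \<phi> v = i}" for i
  have K: "K \<subseteq> I" "finite K" using \<phi> finV by (auto simp: K_def good_def)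
  have Gr: "Gr i \<subseteq> N i" "Gr i \<subseteq> V" for i using \<phi> by (auto simp: Gr_def good_def)
  have Grne: "Gr i \<noteq> {}" if "i \<in> K" for i using that by (auto simp: K_def Gr_def)
  have finGr: "finite (Gr i)" for i using finV by (simp add: Gr_def)
  have Ine: "I \<noteq> {}" using K False by (auto simp: K_def)
  \<comment> \<open>Region \<open>i\<close> is optimal on every column of its group, so a region
    that matches the sum matches every summand.\<close>
  have JQ_N: "v \<in> N t" if t: "t \<in> JQ (Gr i)" and v: "v \<in> Gr i" and i: "i \<in> K" for t v i
  proof -
    have le: "f t c \<le> f i c" if "c \<in> Gr i" for c using Gr(1)[of i] that t by (auto simp: N_def JQ_def)
    have "Q (Gr i) i \<le> Q (Gr i) t" using t i K by (auto simp: JQ_def)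
    hence "f i v \<le> f t v"
    proof (rule contrapos_pp)
      assume "\<not> f i v \<le> f t v"
      hence "(\<Sum>c\<in>Gr i. f t c) < (\<Sum>c\<in>Gr i. f i c)" using le v by (intro sum_strict_mono_ex1 finGr) force+
      thus "\<not> Q (Gr i) i \<le> Q (Gr i) t" by (simp add: Q_def)
    qed
    thus ?thesis using Gr(1)[of i] v by (force simp: N_def)
  qed
  \<comment> \<open>A region optimal on the sums of two groups could serve both, and one region
    fewer would be used.\<close>
  have disj: "JQ (Gr i) \<inter> JQ (Gr i') = {}" if i: "i \<in> K" "i' \<in> K" "i \<noteq> i'" for i i'
  proof (rule ccontr)
    assume "\<not> ?thesis"
    then obtain t where t: "t \<in> JQ (Gr i)" "t \<in> JQ (Gr i')" by blast
    define \<psi> where "\<psi> v = (if v \<in> Gr i \<union> Gr i' then t else \<phi> v)" for v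
    have "good \<psi>" using \<phi> JQ_N t i by (auto simp: good_def \<psi>_def JQ_def)
    have sub: "\<psi> ` V \<subseteq> insert t (K - {i,i'})" by (auto simp: \<psi>_def K_def Gr_def)
    have "card (\<psi> ` V) \<le> card (insert t (K - {i,i'}))" using K sub by (intro card_mono) auto
    also have "\<dots> \<le> Suc (card (K - {i,i'}))" by (simp add: card_insert_if K)
    also have "card (K - {i,i'}) = card K - 2" using i K by (simp add: card_Diff_subset)
    finally have "card (\<psi> ` V) \<le> Suc (card K - 2)" .
    moreover have "2 \<le> card K" using card_mono[of K "{i,i'}"] i K by simp
    ultimately show False using least[OF \<open>good \<psi>\<close>] by (simp add: K_def)
  qed
  have "\<forall>j\<in>K. \<exists>l b. inj_on l (Gr j) \<and> (\<forall>a\<in>Gr j. \<forall>c\<in>Gr j. a \<noteq> c \<longrightarrow> supp j a c = {l a, l c}) \<and> b \<in> Gr j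
     \<and> (\<forall>S a. S \<subseteq> V \<longrightarrow> Gr j \<subseteq> S \<or> Gr j \<inter> S = {} \<longrightarrow> a \<in> Gr j - {b} \<longrightarrow> l a \<in> JQ S \<longrightarrow> l b \<in> JQ S)"
    (is "\<forall>j\<in>K. \<exists>l b. ?P j l b")
  proof
    fix j assume "j \<in> K"
    obtain l b where "inj_on l (Gr j)" "\<And>a c. \<lbrakk>a \<in> Gr j; c \<in> Gr j; a \<noteq> c\<rbrakk> \<Longrightarrow> supp j a c = {l a, l c}" "b \<in> Gr j"
      "\<And>S a. \<lbrakk>S \<subseteq> V; Gr j \<subseteq> S \<or> Gr j \<inter> S = {}; a \<in> Gr j - {b}; l a \<in> JQ S\<rbrakk> \<Longrightarrow> l b \<in> JQ S"
      by (rule dominating_label[OF subsetD[OF K(1) \<open>j \<in> K\<close>] Gr(1) Grne[OF \<open>j \<in> K\<close>]]) blast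
    thus "\<exists>l b. ?P j l b" by blast
  qed
  then obtain l b where lb: "\<And>j. j \<in> K \<Longrightarrow> ?P j (l j) (b j)" by metis
  have linj: "inj_on (l j) (Gr j)" and lsupp: "\<And>a c. \<lbrakk>a \<in> Gr j; c \<in> Gr j; a \<noteq> c\<rbrakk> \<Longrightarrow> supp j a c = {l j a, l j c}"
    and bG: "b j \<in> Gr j"
    and dom: "\<And>S a. \<lbrakk>S \<subseteq> V; Gr j \<subseteq> S \<or> Gr j \<inter> S = {}; a \<in> Gr j - {b j}; l j a \<in> JQ S\<rbrakk> \<Longrightarrow> l j (b j) \<in> JQ S"
    if "j \<in> K" for j using lb[OF that] by blast+
  \<comment> \<open>The labels of a group except its dominating one. Whenever such a label is
    optimal on a group sum, a label outside \<open>Elim\<close> is optimal as well, so the optimal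
    regions can be chosen among the remaining ones.\<close>
  define El where "El j = l j ` (Gr j - {b j})" for j
  define Elim where "Elim = (\<Union>j\<in>K. El j)"
  have cardEl: "card (El j) = card (Gr j) - 1" if "j \<in> K" for j
  proof -
    have "inj_on (l j) (Gr j - {b j})" using linj[OF that] by (rule inj_on_subset) auto
    thus ?thesis using bG[OF that] by (simp add: El_def card_image card_Diff_singleton finGr)
  qed
  have labels: "l j a \<in> supp j a (b j)" "l j (b j) \<in> supp j a (b j)" if "j \<in> K" "a \<in> Gr j - {b j}" for j a
    using lsupp[OF that(1), of a "b j"] bG that by auto
  have cross: "supp j a (b j) \<inter> supp j' a' (b j') = {}"
    if "j \<in> K" "j' \<in> K" "j \<noteq> j'" "a \<in> Gr j - {b j}" "a' \<in> Gr j' - {b j'}" for j j' a a'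
  proof (rule disjoint_pairs)
    show "{a, b j} \<inter> {a', b j'} = {}" using that bG[of j] bG[of j'] by (auto simp: Gr_def)
  qed (use that bG[of j] bG[of j'] Gr K in auto)
  have disjEl: "El j \<inter> El j' = {}" if jj: "j \<in> K" "j' \<in> K" "j \<noteq> j'" for j j'
  proof (rule ccontr)
    assume "El j \<inter> El j' \<noteq> {}"
    then obtain a a' where a: "a \<in> Gr j - {b j}" "a' \<in> Gr j' - {b j'}" "l j a = l j' a'"
      unfolding El_def by blast
    thus False using cross[OF jj a(1,2)] labels(1)[OF jj(1) a(1)] labels(1)[OF jj(2) a(2)] by auto
  qed
  have ElI: "Elim \<subseteq> I" using labels by (force simp: Elim_def El_def supp_def)
  have "card Elim = (\<Sum>j\<in>K. card (El j))"
    unfolding Elim_def using K disjEl by (intro card_UN_disjoint) (auto simp: El_def finGr)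
  also have "\<dots> = (\<Sum>j\<in>K. card (Gr j) - 1)" using cardEl by simp
  finally have cE: "card Elim = (\<Sum>j\<in>K. card (Gr j) - 1)" .
  have "card V = card (\<Union>j\<in>K. Gr j)" by (rule arg_cong[of _ _ card]) (auto simp: K_def Gr_def)
  also have "\<dots> = (\<Sum>j\<in>K. card (Gr j))"
    using K by (intro card_UN_disjoint) (auto simp: Gr_def finV)
  also have "\<dots> = (\<Sum>j\<in>K. (card (Gr j) - 1) + 1)"
  proof (rule sum.cong[OF refl])
    fix j assume "j \<in> K"
    hence "0 < card (Gr j)" using Grne finGr by (simp add: card_gt_0_iff)
    thus "card (Gr j) = (card (Gr j) - 1) + 1" by simp
  qed
  also have "\<dots> = card Elim + card K" unfolding sum.distrib cE by simp
  finally have cV: "card V = card Elim + card K" .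
  have "\<exists>t. t \<in> JQ (Gr i) \<and> t \<in> I - Elim" if i: "i \<in> K" for i
  proof -
    obtain t where t: "t \<in> JQ (Gr i)" using JQ_nonempty[OF Ine] by blast
    show ?thesis
    proof (cases "t \<in> Elim")
      case False thus ?thesis using t by (auto simp: JQ_def)
    next
      case True
      then obtain j a where ja: "j \<in> K" "a \<in> Gr j - {b j}" "t = l j a" by (auto simp: Elim_def El_def)
      have "Gr j \<subseteq> Gr i \<or> Gr j \<inter> Gr i = {}" by (cases "i = j") (auto simp: Gr_def)
      hence w: "l j (b j) \<in> JQ (Gr i)" using dom[OF ja(1) Gr(2)] ja t by blast
      have "l j (b j) \<notin> Elim"
      proof
        assume "l j (b j) \<in> Elim"
        then obtain j' a' where j': "j' \<in> K" "a' \<in> Gr j' - {b j'}" "l j (b j) = l j' a'" by (auto simp: Elim_def El_def)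
        show False
        proof (cases "j = j'")
          case True
          thus False using linj[OF ja(1)] j' bG[OF ja(1)] by (auto simp: inj_on_def)
        next
          case False
          thus False using cross[OF ja(1) j'(1) False ja(2) j'(2)] labels[OF ja(1,2)] labels[OF j'(1,2)] j'(3) by auto
        qed
      qed
      thus ?thesis using w by (auto simp: JQ_def)
    qed
  qed
  then obtain \<xi> where \<xi>: "\<And>i. i \<in> K \<Longrightarrow> \<xi> i \<in> JQ (Gr i)" "\<And>i. i \<in> K \<Longrightarrow> \<xi> i \<in> I - Elim" by metis
  have "inj_on \<xi> K" using \<xi>(1) disj by (fastforce simp: inj_on_def)
  hence "card K \<le> card (I - Elim)" using \<xi>(2) finI by (intro card_inj_on_le[of \<xi>]) auto
  also have "\<dots> = card I - card Elim" using ElI finI finite_subset by (intro card_Diff_subset) auto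
  finally show ?thesis using cV card_mono[OF finI ElI] by linarith
qed simp

end

section \<open>Exchanges in simplicial fans\<close>

definition chi :: "'n set \<Rightarrow> real ^ 'n" where "chi X = (\<chi> a. of_bool (a \<in> X))"

lemma chi_nth [simp]: "chi X $ a = of_bool (a \<in> X)" by (simp add: chi_def)

lemma inner_chi: "v \<bullet> chi X = (\<Sum>a\<in>X. v $ a)" for v :: "real ^ 'n::finite"
  by (simp add: inner_vec_def of_bool_def if_distrib sum.If_cases cong: if_cong)

lemma sum_chi: "(\<Sum>a\<in>UNIV. chi X $ a) = real (card X)" for X :: "'n::finite set"
  by (simp add: of_bool_def sum.If_cases)

lemma chi_hypersimplex: "chi X \<in> hypersimplex d \<longleftrightarrow> card X = d" for X :: "'n::finite set"
  using sum_chi[of X] by (auto simp: hypersimplex_def)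

lemma zero_one_chi: assumes "\<And>a. v $ a \<in> {0,1}" shows "v = chi {a. v $ a = 1}"
  using assms by (auto simp: vec_eq_iff)

lemma convex_hypersimplex: "convex (hypersimplex d :: (real ^ 'n::finite) set)"
proof (rule convexI)
  fix x y :: "real ^ 'n" and u v :: real
  assume *: "x \<in> hypersimplex d" "y \<in> hypersimplex d" "0 \<le> u" "0 \<le> v" "u + v = 1"
  have "u * x $ i + v * y $ i \<le> u * 1 + v * 1" for i
    using * by (intro add_mono mult_left_mono) (auto simp: hypersimplex_def)
  moreover have "(\<Sum>i\<in>UNIV. u * x $ i + v * y $ i) = u * real d + v * real d"
    using * by (simp add: sum.distrib sum_distrib_left[symmetric] hypersimplex_def)
  ultimately show "u *\<^sub>R x + v *\<^sub>R y \<in> hypersimplex d"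
    using * by (simp add: hypersimplex_def distrib_right[symmetric])
qed

lemma hypersimplex_near:
  fixes c z :: "real ^ 'n::finite"
  assumes c: "c \<in> hypersimplex d" "\<And>a. 0 < c $ a" "\<And>a. c $ a < 1" and z: "(\<Sum>a\<in>UNIV. z $ a) = 0"
  obtains \<epsilon> where "0 < \<epsilon>" "\<And>\<eta>. \<lbrakk>0 < \<eta>; \<eta> \<le> \<epsilon>\<rbrakk> \<Longrightarrow> c + \<eta> *\<^sub>R z \<in> hypersimplex d"
    "\<And>\<eta> a. \<lbrakk>0 < \<eta>; \<eta> \<le> \<epsilon>\<rbrakk> \<Longrightarrow> 0 < (c + \<eta> *\<^sub>R z) $ a \<and> (c + \<eta> *\<^sub>R z) $ a < 1"
proof -
  define m0 where "m0 = Min (range (\<lambda>a. min (c $ a) (1 - c $ a)))"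
  have "m0 \<in> range (\<lambda>a. min (c $ a) (1 - c $ a))" unfolding m0_def by (intro Min_in) auto
  hence m00: "0 < m0" using c by (auto simp: min_def)
  have m0: "m0 \<le> c $ a" "m0 \<le> 1 - c $ a" for a
    using Min_le[of "range (\<lambda>a. min (c $ a) (1 - c $ a))" "min (c $ a) (1 - c $ a)"] by (auto simp: m0_def)
  define \<epsilon> where "\<epsilon> = m0 / (1 + norm z)"
  have n: "0 < 1 + norm z" by (smt (verit) norm_ge_zero)
  have \<epsilon>0: "0 < \<epsilon>" using m00 n by (simp add: \<epsilon>_def)
  have in01: "0 < (c + \<eta> *\<^sub>R z) $ a \<and> (c + \<eta> *\<^sub>R z) $ a < 1" if "0 < \<eta>" "\<eta> \<le> \<epsilon>" for \<eta> a
  proof -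
    have "\<bar>\<eta> * z $ a\<bar> \<le> \<eta> * norm z" using that component_le_norm_cart[of z a] by (simp add: abs_mult)
    also have "\<dots> < \<eta> * (1 + norm z)" using that by simp
    also have "\<dots> \<le> \<epsilon> * (1 + norm z)" using that n by (intro mult_right_mono) auto
    also have "\<dots> = m0" using n by (simp add: \<epsilon>_def)
    finally show ?thesis using m0[of a] by (simp add: abs_less_iff)
  qed
  moreover have "c + \<eta> *\<^sub>R z \<in> hypersimplex d" if "0 < \<eta>" "\<eta> \<le> \<epsilon>" for \<eta>
  proof -
    have "(\<Sum>a\<in>UNIV. (c + \<eta> *\<^sub>R z) $ a) = real d"
      using c z by (simp add: sum.distrib sum_distrib_left[symmetric] hypersimplex_def)
    thus ?thesis using in01[OF that] by (simp add: hypersimplex_def less_imp_le)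
  qed
  ultimately show thesis using that \<epsilon>0 by blast
qed

lemma span_image_sum: assumes "finite T" "x \<in> span (v ` T)"
  shows "\<exists>\<alpha>. x = (\<Sum>t\<in>T. \<alpha> t *\<^sub>R v t)"
proof -
  let ?S = "{x. \<exists>\<alpha>. x = (\<Sum>t\<in>T. \<alpha> t *\<^sub>R v t)}"
  have "subspace ?S"
  proof (rule subspaceI)
    show "0 \<in> ?S" by (auto intro: exI[of _ "\<lambda>_. 0"])
    fix x y assume "x \<in> ?S" "y \<in> ?S"
    then obtain \<alpha> \<gamma> where "x = (\<Sum>t\<in>T. \<alpha> t *\<^sub>R v t)" "y = (\<Sum>t\<in>T. \<gamma> t *\<^sub>R v t)" by blast
    hence "x + y = (\<Sum>t\<in>T. (\<alpha> t + \<gamma> t) *\<^sub>R v t)" by (simp add: scaleR_left_distrib sum.distrib)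
    thus "x + y \<in> ?S" by (intro CollectI exI[where x = "\<lambda>t. \<alpha> t + \<gamma> t"])
  next
    fix c x assume "x \<in> ?S"
    then obtain \<alpha> where "x = (\<Sum>t\<in>T. \<alpha> t *\<^sub>R v t)" by blast
    hence "c *\<^sub>R x = (\<Sum>t\<in>T. (c * \<alpha> t) *\<^sub>R v t)" by (simp add: scaleR_sum_right)
    thus "c *\<^sub>R x \<in> ?S" by (intro CollectI exI[where x = "\<lambda>t. c * \<alpha> t"])
  qed
  moreover have "v ` T \<subseteq> ?S"
  proof (clarify)
    fix t assume "t \<in> T"
    hence "v t = (\<Sum>u\<in>T. of_bool (u = t) *\<^sub>R v u)"
      using assms(1) by (simp add: of_bool_def if_distrib[of "\<lambda>x. x *\<^sub>R _"] cong: if_cong)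
    thus "\<exists>\<alpha>. v t = (\<Sum>t\<in>T. \<alpha> t *\<^sub>R v t)" by (rule exI[where x = "\<lambda>u. of_bool (u = t)"])
  qed
  ultimately show ?thesis using assms(2) span_minimal by blast
qed

text \<open>The component of \<open>v s\<close> orthogonal to the other vectors, rescaled;
  independence makes it nonzero.\<close>

lemma dual_vector:
  fixes v :: "'i \<Rightarrow> 'a::euclidean_space"
  assumes T: "finite T" "s \<in> T" and ind: "\<And>\<alpha> t. \<lbrakk>(\<Sum>t\<in>T. \<alpha> t *\<^sub>R v t) = 0; t \<in> T\<rbrakk> \<Longrightarrow> \<alpha> t = 0"
  obtains r where "r \<in> span (v ` T)" "v s \<bullet> r = 1" "\<And>t. \<lbrakk>t \<in> T; t \<noteq> s\<rbrakk> \<Longrightarrow> v t \<bullet> r = 0"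
proof -
  obtain y z where yz: "y \<in> span (v ` (T - {s}))" "\<And>w. w \<in> span (v ` (T - {s})) \<Longrightarrow> orthogonal z w" "v s = y + z"
    using orthogonal_subspace_decomp_exists by blast
  have "z \<noteq> 0"
  proof
    assume "z = 0"
    hence "v s \<in> span (v ` (T - {s}))" using yz by simp
    then obtain \<alpha> where \<alpha>: "v s = (\<Sum>t\<in>T - {s}. \<alpha> t *\<^sub>R v t)" using span_image_sum T by blast
    have "(\<Sum>t\<in>T. (if t = s then 1 else - \<alpha> t) *\<^sub>R v t) = v s + (\<Sum>t\<in>T - {s}. - (\<alpha> t *\<^sub>R v t))"
      using T by (subst sum.remove[of T s]) (auto intro!: sum.cong)
    also have "\<dots> = 0" using \<alpha> by (simp add: sum_negf)
    finally show False using ind[of "\<lambda>t. if t = s then 1 else - \<alpha> t" s] T by simp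
  qed
  have "v s \<bullet> z = z \<bullet> z" using yz by (metis add_0 inner_add_left inner_commute orthogonal_def)
  hence "v s \<bullet> (inverse (z \<bullet> z) *\<^sub>R z) = 1" using \<open>z \<noteq> 0\<close> by simp
  moreover have "v t \<bullet> (inverse (z \<bullet> z) *\<^sub>R z) = 0" if "t \<in> T" "t \<noteq> s" for t
    using yz(2)[of "v t"] that by (auto simp: orthogonal_def inner_commute intro: span_base)
  moreover have "inverse (z \<bullet> z) *\<^sub>R z \<in> span (v ` T)"
  proof -
    have "y \<in> span (v ` T)" using yz(1) span_mono[of "v ` (T - {s})" "v ` T"] by blast
    moreover have "v s \<in> span (v ` T)" using T by (intro span_base) auto
    moreover have "z = v s - y" using yz(3) by simp
    ultimately show ?thesis by (metis span_diff span_scale)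
  qed
  ultimately show thesis using that by blast
qed

text \<open>Only differences of forms matter, which allows \<open>f e0 = 0\<close>.
  \<open>integral\<close> is what remains of the condition that no new vertices appear, and
  \<open>ind\<close> is what remains of the codimension of the common cell.\<close>

locale simplicial_fan =
  fixes d :: nat and I :: "'i set" and f :: "'i \<Rightarrow> real ^ 'n::finite" and e0 :: 'i
    and M :: "'i \<Rightarrow> (real ^ 'n) set" and c0 :: "real ^ 'n"
  assumes M_def: "M i = {x \<in> hypersimplex d. \<forall>t\<in>I. f t \<bullet> x \<le> f i \<bullet> x}"
    and fin: "finite I" and e0: "e0 \<in> I" and fe0: "f e0 = 0"
    and d: "0 < d" "d < CARD('n)"
    and integral: "\<lbrakk>i \<in> I; x \<in> M i\<rbrakk> \<Longrightarrow> x \<in> convex hull (M i \<inter> {v. \<forall>a. v $ a \<in> {0,1}})"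
    and c0: "c0 \<in> hypersimplex d" "\<And>a. 0 < c0 $ a" "\<And>a. c0 $ a < 1" "\<And>i. i \<in> I \<Longrightarrow> f i \<bullet> c0 = 0"
    and ind: "\<And>\<alpha> i. \<lbrakk>(\<Sum>i\<in>I. \<alpha> i) = 0; (\<Sum>i\<in>I. \<alpha> i *\<^sub>R f i) = 0; i \<in> I\<rbrakk> \<Longrightarrow> \<alpha> i = 0"
begin

lemma M_chi: "chi X \<in> M i \<longleftrightarrow> card X = d \<and> (\<forall>t\<in>I. f t \<bullet> chi X \<le> f i \<bullet> chi X)"
  by (simp add: M_def chi_hypersimplex)

lemma convex_M: "convex (M i)"
proof -
  have "M i = hypersimplex d \<inter> (\<Inter>t\<in>I. {x. (f t - f i) \<bullet> x \<le> 0})"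
    by (auto simp: M_def inner_diff_left)
  thus ?thesis by (simp only:) (intro convex_Int convex_hypersimplex convex_INT ballI convex_halfspace_le)
qed

lemma M_cover: assumes "x \<in> hypersimplex d" shows "\<exists>i\<in>I. x \<in> M i"
proof -
  have "Max ((\<lambda>t. f t \<bullet> x) ` I) \<in> (\<lambda>t. f t \<bullet> x) ` I" using fin e0 by (intro Max_in) auto
  then obtain i where i: "i \<in> I" "f i \<bullet> x = Max ((\<lambda>t. f t \<bullet> x) ` I)" by auto
  have "f t \<bullet> x \<le> f i \<bullet> x" if "t \<in> I" for t using i that fin by simp
  thus ?thesis using i(1) assms unfolding M_def by blast
qed

text \<open>In a convex combination of 0/1 points equal to \<open>x\<close>, every point with
  positive weight inherits the coordinates 0 and 1 of \<open>x\<close> and the ties between forms.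
  Not all of them can have the value \<open>w0\<close> at \<open>a\<close>.\<close>

lemma vertex_below:
  assumes l: "l \<in> I" "x \<in> M l" and a: "x $ a \<noteq> w0" "w0 \<in> {0,1}"
  obtains X where "chi X \<in> M l" "chi X $ a \<noteq> w0" "\<And>b. x $ b = 0 \<Longrightarrow> b \<notin> X" "\<And>b. x $ b = 1 \<Longrightarrow> b \<in> X"
    "\<And>t. \<lbrakk>t \<in> I; f t \<bullet> x = f l \<bullet> x\<rbrakk> \<Longrightarrow> f t \<bullet> chi X = f l \<bullet> chi X"
proof -
  define W where "W = M l \<inter> {v. \<forall>a. v $ a \<in> {0,1}}"
  have "W \<subseteq> range chi" using zero_one_chi by (auto simp: W_def)
  hence finW: "finite W" by (rule finite_subset) simp
  have "x \<in> convex hull W" using integral[OF l] by (simp add: W_def)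
  then obtain u where u: "\<And>v. v \<in> W \<Longrightarrow> 0 \<le> u v" "sum u W = 1" "(\<Sum>v\<in>W. u v *\<^sub>R v) = x"
    unfolding convex_hull_finite[OF finW] by blast
  have xn: "x $ b = (\<Sum>v\<in>W. u v * v $ b)" for b using u(3) by (auto simp: sum_component)
  have xi: "h \<bullet> x = (\<Sum>v\<in>W. u v * (h \<bullet> v))" for h using u(3) by (auto simp: inner_sum_right)
  have "\<exists>v\<in>W. 0 < u v \<and> v $ a \<noteq> w0"
  proof (rule ccontr)
    assume "\<not> ?thesis"
    hence "u v * v $ a = u v * w0" if "v \<in> W" for v using u(1)[OF that] that by (cases "u v = 0") force+
    hence "x $ a = (\<Sum>v\<in>W. u v * w0)" unfolding xn by (rule sum.cong[OF refl])
    also have "\<dots> = w0" using u(2) by (simp add: sum_distrib_right[symmetric])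
    finally show False using a by simp
  qed
  then obtain v where v: "v \<in> W" "0 < u v" "v $ a \<noteq> w0" by blast
  have key: "h v = 0" if h: "\<And>w. w \<in> W \<Longrightarrow> 0 \<le> h w" "(\<Sum>w\<in>W. u w * h w) = 0" for h :: "real ^ 'n \<Rightarrow> real"
  proof -
    have "\<forall>w\<in>W. u w * h w = 0" using h u(1) finW by (subst sum_nonneg_eq_0_iff[symmetric]) auto
    thus ?thesis using v by fastforce
  qed
  have W01: "0 \<le> w $ b \<and> w $ b \<le> 1" if "w \<in> W" for w b
    using that unfolding W_def by (auto dest!: spec[of _ b])
  have vX: "v = chi {a. v $ a = 1}" using v zero_one_chi by (auto simp: W_def)
  show thesis
  proof (rule that[of "{a. v $ a = 1}"])
    show "chi {a. v $ a = 1} \<in> M l" using v vX by (simp add: W_def)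
    show "chi {a. v $ a = 1} $ a \<noteq> w0" using v vX by simp
    fix b
    show "b \<notin> {a. v $ a = 1}" if "x $ b = 0"
    proof -
      have "v $ b = 0" by (rule key) (use W01 that xn in auto)
      thus ?thesis by simp
    qed
    show "b \<in> {a. v $ a = 1}" if "x $ b = 1"
    proof -
      have "(\<Sum>w\<in>W. u w * (1 - w $ b)) = sum u W - x $ b"
        by (simp add: xn right_diff_distrib sum_subtractf)
      hence "(\<Sum>w\<in>W. u w * (1 - w $ b)) = 0" using that u(2) by simp
      hence "1 - v $ b = 0" by (rule key[rotated]) (use W01 in auto)
      thus ?thesis by simp
    qed
  next
    fix t assume t: "t \<in> I" "f t \<bullet> x = f l \<bullet> x"
    have "(\<Sum>w\<in>W. u w * (f l \<bullet> w - f t \<bullet> w)) = f l \<bullet> x - f t \<bullet> x"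
      by (simp add: xi right_diff_distrib sum_subtractf)
    hence "(\<Sum>w\<in>W. u w * (f l \<bullet> w - f t \<bullet> w)) = 0" using t by simp
    hence "f l \<bullet> v - f t \<bullet> v = 0" by (rule key[rotated]) (use t in \<open>auto simp: W_def M_def\<close>)
    thus "f t \<bullet> chi {a. v $ a = 1} = f l \<bullet> chi {a. v $ a = 1}" using vX by simp
  qed
qed

text \<open>The 0/1 points that can occur in the barycentre \<open>x\<close> have \<open>d\<close>
  elements and lie inside \<open>Y\<close>, so they are vertices of the simplex. Each one must
  occur, because otherwise \<open>x $ a\<close> would be 1.\<close>

lemma upper_simplex:
  assumes Y: "card Y = Suc d"
  shows "\<exists>l\<in>I. \<forall>a\<in>Y. chi (Y - {a}) \<in> M l"
proof -
  define x where "x = (d / Suc d) *\<^sub>R chi Y"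
  have "(\<Sum>a\<in>UNIV. x $ a) = (d / Suc d) * real (card Y)"
    unfolding x_def sum_chi[symmetric] by (simp add: sum_distrib_left del: chi_nth)
  hence "x \<in> hypersimplex d" using Y by (auto simp: x_def hypersimplex_def)
  then obtain l where l: "l \<in> I" "x \<in> M l" using M_cover by blast
  have "chi (Y - {a}) \<in> M l" if a: "a \<in> Y" for a
  proof -
    have "x $ a \<noteq> 1" by (auto simp: x_def field_simps)
    then obtain X where X: "chi X \<in> M l" "chi X $ a \<noteq> 1" "\<And>b. x $ b = 0 \<Longrightarrow> b \<notin> X"
      using vertex_below[OF l] by (metis insertI1 insertI2)
    have "X \<subseteq> Y - {a}" using X(2,3) by (auto simp: x_def)
    moreover have "card X = card (Y - {a})" using X(1) Y a by (simp add: M_chi)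
    ultimately have "X = Y - {a}" by (intro card_subset_eq) auto
    thus ?thesis using X by simp
  qed
  thus ?thesis using l by blast
qed

text \<open>Dual to \<open>upper_simplex\<close>: the barycentre is 1 on \<open>Z\<close>, so every
  0/1 point occurring in it contains \<open>Z\<close>.\<close>

lemma lower_simplex:
  assumes Z: "Suc (card Z) = d"
  shows "\<exists>l\<in>I. \<forall>b\<in>-Z. chi (insert b Z) \<in> M l"
proof -
  define q where "q = card (- Z)"
  have q: "real q = CARD('n) - real d + 1" "2 \<le> q"
  proof -
    have "q = CARD('n) - card Z" unfolding q_def Compl_eq_Diff_UNIV by (intro card_Diff_subset) auto
    thus "real q = CARD('n) - real d + 1" "2 \<le> q" using Z d by linarith+
  qed
  define x where "x = chi Z + (1 / q) *\<^sub>R chi (- Z)"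
  have "(\<Sum>a\<in>UNIV. x $ a) = (\<Sum>a\<in>UNIV. chi Z $ a) + (1 / q) * (\<Sum>a\<in>UNIV. chi (- Z) $ a)"
    by (simp only: x_def vector_add_component vector_scaleR_component sum.distrib sum_distrib_left real_scaleR_def)
  also have "\<dots> = real (card Z) + (1 / q) * real q" unfolding sum_chi q_def ..
  finally have "(\<Sum>a\<in>UNIV. x $ a) = real (card Z) + (1 / q) * real q" .
  hence "x \<in> hypersimplex d" using Z q by (auto simp: x_def hypersimplex_def)
  then obtain l where l: "l \<in> I" "x \<in> M l" using M_cover by blast
  have "chi (insert b Z) \<in> M l" if b: "b \<notin> Z" for b
  proof -
    have "x $ b \<noteq> 0" using b q by (auto simp: x_def)
    then obtain X where X: "chi X \<in> M l" "chi X $ b \<noteq> 0" "\<And>b. x $ b = 1 \<Longrightarrow> b \<in> X"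
      using vertex_below[OF l] by (metis insertI1)
    have "insert b Z \<subseteq> X" using X(2,3) by (auto simp: x_def)
    moreover have "card X = card (insert b Z)" using X(1) Z b by (simp add: M_chi)
    ultimately have "insert b Z = X" by (intro card_subset_eq) auto
    thus ?thesis using X by simp
  qed
  thus ?thesis using l by auto
qed

text \<open>The simplex lies in one cell \<open>l\<close>, so \<open>f l - f j\<close> is
  nonnegative at its vertices. The sum of these values is \<open>d\<close> times the sum of the
  values at \<open>X\<close> and at \<open>b\<close>, both of which are at most 0. Hence all
  vertices are ties.\<close>

lemma add_element:
  assumes j: "j \<in> I" and X: "chi X \<in> M j" and b: "b \<notin> X" "\<And>t. t \<in> I \<Longrightarrow> f t $ b \<le> f j $ b"
    and a: "a \<in> insert b X"
  shows "chi (insert b X - {a}) \<in> M j"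
proof -
  let ?Y = "insert b X"
  have cX: "card X = d" using X by (simp add: M_chi)
  hence cY: "card ?Y = Suc d" using b by simp
  then obtain l where l: "l \<in> I" "\<And>a. a \<in> ?Y \<Longrightarrow> chi (?Y - {a}) \<in> M l" using upper_simplex by blast
  have sm: "(\<Sum>a\<in>?Y. h \<bullet> chi (?Y - {a})) = d * (h \<bullet> chi X + h $ b)" for h :: "real ^ 'n"
  proof -
    have "h \<bullet> chi (?Y - {a}) = h \<bullet> chi ?Y - h $ a" if "a \<in> ?Y" for a
      using that by (simp add: inner_chi sum_diff1)
    hence "(\<Sum>a\<in>?Y. h \<bullet> chi (?Y - {a})) = Suc d * (h \<bullet> chi ?Y) - h \<bullet> chi ?Y"
      using cY by (simp add: sum_subtractf inner_chi[of h ?Y, symmetric] del: sum.insert_if)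
    thus ?thesis using b by (simp add: inner_chi algebra_simps)
  qed
  have "(f l - f j) \<bullet> chi X \<le> 0" using X l(1) by (simp add: inner_diff_left M_chi)
  hence "d * ((f l - f j) \<bullet> chi X + (f l - f j) $ b) \<le> 0" using b(2)[OF l(1)]
    by (intro mult_nonneg_nonpos) simp_all
  hence le: "(\<Sum>a\<in>?Y. (f l - f j) \<bullet> chi (?Y - {a})) \<le> 0" by (simp only: sm)
  have nn: "0 \<le> (f l - f j) \<bullet> chi (?Y - {a})" if "a \<in> ?Y" for a
    using l(2)[OF that] j by (simp add: inner_diff_left M_chi)
  have "(\<Sum>a\<in>?Y. (f l - f j) \<bullet> chi (?Y - {a})) = 0" using sum_nonneg[of "?Y" "\<lambda>a. (f l - f j) \<bullet> chi (?Y - {a})", OF nn] le by linarith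
  hence "(f l - f j) \<bullet> chi (?Y - {a}) = 0" using sum_nonneg_eq_0_iff[of "?Y" "\<lambda>a. (f l - f j) \<bullet> chi (?Y - {a})", OF finite nn] a by blast
  hence "f l \<bullet> chi (?Y - {a}) = f j \<bullet> chi (?Y - {a})" by (simp add: inner_diff_left)
  thus ?thesis using l(2)[OF a] unfolding M_chi by simp
qed

text \<open>The amount by which the sum of \<open>f t\<close> over a lower simplex exceeds
  \<open>CARD('n) - d\<close> times the value at \<open>X\<close>. Its maximality permits removing
  \<open>a\<close> just as maximality of \<open>f t $ b\<close> permits adding
  \<open>b\<close>.\<close>

definition drop_val :: "'i \<Rightarrow> 'n \<Rightarrow> real" where
  "drop_val t a = (\<Sum>b\<in>UNIV. f t $ b) - (real CARD('n) - real d) * f t $ a"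

lemma remove_element:
  assumes j: "j \<in> I" and X: "chi X \<in> M j" and a: "a \<in> X" "\<And>t. t \<in> I \<Longrightarrow> drop_val t a \<le> drop_val j a"
    and b: "b \<notin> X - {a}"
  shows "chi (insert b (X - {a})) \<in> M j"
proof -
  let ?Z = "X - {a}"
  have cX: "card X = d" using X by (simp add: M_chi)
  hence cZ: "Suc (card ?Z) = d" using a d by simp
  then obtain l where l: "l \<in> I" "\<And>b. b \<in> - ?Z \<Longrightarrow> chi (insert b ?Z) \<in> M l" using lower_simplex by blast
  have sm: "(\<Sum>b\<in>- ?Z. h \<bullet> chi (insert b ?Z)) = (real CARD('n) - real d) * (h \<bullet> chi X - h $ a) + (\<Sum>b\<in>UNIV. h $ b)"
    for h :: "real ^ 'n"
  proof -
    have "h \<bullet> chi (insert b ?Z) = h \<bullet> chi ?Z + h $ b" if "b \<in> - ?Z" for b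
      using that unfolding inner_chi by (subst sum.insert) auto
    hence "(\<Sum>b\<in>- ?Z. h \<bullet> chi (insert b ?Z)) = real (card (- ?Z)) * (h \<bullet> chi ?Z) + (\<Sum>b\<in>- ?Z. h $ b)"
      by (simp add: sum.distrib)
    moreover have "(\<Sum>b\<in>- ?Z. h $ b) = (\<Sum>b\<in>UNIV. h $ b) - h \<bullet> chi ?Z"
      unfolding inner_chi Compl_eq_Diff_UNIV by (intro sum_diff) auto
    moreover have "real (card (- ?Z)) = real CARD('n) - real d + 1"
      using cZ d by (simp add: Compl_eq_Diff_UNIV card_Diff_subset card_mono of_nat_diff)
    moreover have "h \<bullet> chi ?Z = h \<bullet> chi X - h $ a" using a by (simp add: inner_chi sum_diff1)
    ultimately show ?thesis by (simp only:) (simp add: algebra_simps)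
  qed
  have smf: "(\<Sum>b\<in>- ?Z. f t \<bullet> chi (insert b ?Z)) = (real CARD('n) - real d) * (f t \<bullet> chi X) + drop_val t a" for t
    unfolding sm drop_val_def by (simp add: algebra_simps)
  have "(real CARD('n) - real d) * (f l \<bullet> chi X) \<le> (real CARD('n) - real d) * (f j \<bullet> chi X)"
    using X l(1) d by (intro mult_left_mono) (auto simp: M_chi)
  hence le: "(\<Sum>b\<in>- ?Z. (f l - f j) \<bullet> chi (insert b ?Z)) \<le> 0"
    using smf[of l] smf[of j] a(2)[OF l(1)] unfolding inner_diff_left sum_subtractf by linarith
  have nn: "0 \<le> (f l - f j) \<bullet> chi (insert b ?Z)" if "b \<in> - ?Z" for b
    using l(2)[OF that] j by (simp add: inner_diff_left M_chi)
  have "(\<Sum>b\<in>- ?Z. (f l - f j) \<bullet> chi (insert b ?Z)) = 0" using sum_nonneg[of "- ?Z" "\<lambda>b. (f l - f j) \<bullet> chi (insert b ?Z)", OF nn] le by linarith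
  hence "(f l - f j) \<bullet> chi (insert b ?Z) = 0" using sum_nonneg_eq_0_iff[of "- ?Z" "\<lambda>b. (f l - f j) \<bullet> chi (insert b ?Z)", OF finite nn] b by blast
  hence "f l \<bullet> chi (insert b ?Z) = f j \<bullet> chi (insert b ?Z)" by (simp add: inner_diff_left)
  moreover have "chi (insert b ?Z) \<in> M l" by (rule l(2)) (use b in auto)
  ultimately show ?thesis unfolding M_chi by simp
qed

end

text \<open>The numbers \<open>of_bool (t = s) - \<rho> s * D t\<close> are the entries of a
  reflection in the basis of rays of a cone. They are nonnegative because the cone is preserved, and
  the trace 2 of the subtracted part is that of a reflection. Two diagonal terms are positive with
  opposite signs, and these signs annihilate everything else.\<close>

lemma two_signs:
  fixes \<rho> D :: "'i \<Rightarrow> real"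
  assumes T: "finite T" and le: "\<And>s t. \<lbrakk>s \<in> T; t \<in> T\<rbrakk> \<Longrightarrow> \<rho> s * D t \<le> of_bool (t = s)"
    and two: "(\<Sum>t\<in>T. \<rho> t * D t) = 2"
  shows "\<exists>x\<in>T. \<exists>y\<in>T. x \<noteq> y \<and> \<rho> x * D x = 1 \<and> \<rho> y * D y = 1 \<and> \<rho> x * \<rho> y < 0
    \<and> (\<forall>t\<in>T. t \<noteq> x \<longrightarrow> t \<noteq> y \<longrightarrow> D t = 0 \<and> \<rho> t = 0)"
proof -
  have le1: "\<rho> t * D t \<le> 1" if "t \<in> T" for t using le[OF that that] by simp
  have le0: "\<rho> s * D t \<le> 0" if "s \<in> T" "t \<in> T" "s \<noteq> t" for s t using le[OF that(1,2)] that(3) by simp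
  have "\<exists>x\<in>T. 0 < \<rho> x * D x"
  proof (rule ccontr)
    assume "\<not> ?thesis"
    hence "(\<Sum>t\<in>T. \<rho> t * D t) \<le> 0" by (intro sum_nonpos) (simp add: not_less)
    thus False using two by simp
  qed
  then obtain x where x: "x \<in> T" "0 < \<rho> x * D x" by blast
  have sx: "(\<Sum>t\<in>T. \<rho> t * D t) = \<rho> x * D x + (\<Sum>t\<in>T - {x}. \<rho> t * D t)"
    using T x by (intro sum.remove) auto
  have "\<exists>y\<in>T - {x}. 0 < \<rho> y * D y"
  proof (rule ccontr)
    assume "\<not> ?thesis"
    hence "(\<Sum>t\<in>T - {x}. \<rho> t * D t) \<le> 0" by (intro sum_nonpos) (simp add: not_less)
    thus False using two sx le1[OF x(1)] by linarith
  qed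
  then obtain y where y: "y \<in> T" "y \<noteq> x" "0 < \<rho> y * D y" by blast
  have sy: "(\<Sum>t\<in>T - {x}. \<rho> t * D t) = \<rho> y * D y + (\<Sum>t\<in>T - {x} - {y}. \<rho> t * D t)"
    using T y by (intro sum.remove) auto
  have opp: "\<rho> x * \<rho> y < 0"
    using x y le0[OF x(1) y(1)] le0[OF y(1) x(1)] by (auto simp: zero_less_mult_iff mult_less_0_iff mult_le_0_iff)
  have zero: "D t = 0 \<and> \<rho> t = 0" if t: "t \<in> T" "t \<noteq> x" "t \<noteq> y" for t
  proof
    show "D t = 0" using opp le0[OF x(1) t(1)] le0[OF y(1) t(1)] t by (auto simp: mult_less_0_iff mult_le_0_iff)
    have "D x * D y < 0" using opp x(2) y(3) by (auto simp: mult_less_0_iff zero_less_mult_iff)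
    thus "\<rho> t = 0" using le0[OF t(1) x(1)] le0[OF t(1) y(1)] t by (auto simp: mult_less_0_iff mult_le_0_iff)
  qed
  have "(\<Sum>t\<in>T - {x} - {y}. \<rho> t * D t) = 0" using zero by (intro sum.neutral) auto
  hence "\<rho> x * D x = 1" "\<rho> y * D y = 1" using sx sy two le1[OF x(1)] le1[OF y(1)] by linarith+
  thus ?thesis using x(1) y(1,2) opp zero by (intro bexI[of _ x] bexI[of _ y]) auto
qed

section \<open>Transpositions of coordinates as symmetries of a cone\<close>

definition coord_diff :: "'n \<Rightarrow> 'n \<Rightarrow> real ^ 'n::finite" where "coord_diff b b' = axis b 1 - axis b' 1"

lemma coord_diff_sum: "(\<Sum>a\<in>UNIV. coord_diff b b' $ a) = 0"
  by (simp add: coord_diff_def axis_def sum_subtractf)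

lemma coord_diff_inner: "v \<bullet> coord_diff b b' = v $ b - v $ b'" for v :: "real ^ 'n::finite"
  by (simp add: coord_diff_def inner_diff_right inner_axis)

lemma coord_diff_nth: "b \<noteq> b' \<Longrightarrow> coord_diff b b' $ b = 1" "b \<noteq> b' \<Longrightarrow> coord_diff b b' $ b' = -1" "a \<noteq> b \<Longrightarrow> a \<noteq> b' \<Longrightarrow> coord_diff b b' $ a = 0"
  by (auto simp: coord_diff_def axis_def)

text \<open>The transposition of two coordinates, written as a reflection so that its effect on
  forms is explicit.\<close>

definition coord_swap :: "'n \<Rightarrow> 'n \<Rightarrow> real ^ 'n::finite \<Rightarrow> real ^ 'n" where
  "coord_swap b b' x = x - (x $ b - x $ b') *\<^sub>R coord_diff b b'"

lemma linear_coord_swap: "linear (coord_swap b b')"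
  by (rule linearI) (simp_all add: coord_swap_def algebra_simps)

lemma coord_swap_chi: assumes "b \<noteq> b'"
  shows "coord_swap b b' (chi X) = chi (if b \<in> X \<and> b' \<notin> X then insert b' (X - {b}) else if b' \<in> X \<and> b \<notin> X then insert b (X - {b'}) else X)"
proof (rule vec_eq_iff[THEN iffD2], rule allI)
  fix a show "coord_swap b b' (chi X) $ a = chi (if b \<in> X \<and> b' \<notin> X then insert b' (X - {b}) else if b' \<in> X \<and> b \<notin> X then insert b (X - {b'}) else X) $ a"
    using assms by (cases "a = b"; cases "a = b'") (auto simp: coord_swap_def coord_diff_nth)
qed

context simplicial_fan
begin

lemma hyp_sum: "x \<in> hypersimplex d \<Longrightarrow> (\<Sum>a\<in>UNIV. x $ a) = real d"
  by (simp add: hypersimplex_def)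

lemma coord_swap_cell:
  assumes j: "j \<in> I" and b: "b \<noteq> b'"
    and s1: "\<And>X. \<lbrakk>chi X \<in> M j; b \<in> X; b' \<notin> X\<rbrakk> \<Longrightarrow> chi (insert b' (X - {b})) \<in> M j"
    and s2: "\<And>X. \<lbrakk>chi X \<in> M j; b' \<in> X; b \<notin> X\<rbrakk> \<Longrightarrow> chi (insert b (X - {b'})) \<in> M j"
    and x: "x \<in> M j"
  shows "coord_swap b b' x \<in> M j"
proof -
  let ?W = "M j \<inter> {v. \<forall>a. v $ a \<in> {0,1}}"
  have "coord_swap b b' x \<in> coord_swap b b' ` (convex hull ?W)" using integral[OF j x] by (rule imageI)
  also have "\<dots> = convex hull (coord_swap b b' ` ?W)" by (rule convex_hull_linear_image[OF linear_coord_swap])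
  also have "\<dots> \<subseteq> M j"
  proof (rule hull_minimal[where S = convex, OF _ convex_M], clarify)
    fix v assume v: "v \<in> M j" "\<forall>a. v $ a \<in> {0,1}"
    then obtain X where X: "v = chi X" using zero_one_chi by blast
    show "coord_swap b b' v \<in> M j" using s1[of X] s2[of X] v(1) unfolding X coord_swap_chi[OF b] by simp
  qed
  finally show ?thesis .
qed

definition inner_pt :: "real ^ 'n \<Rightarrow> bool" where
  "inner_pt c \<longleftrightarrow> c \<in> hypersimplex d \<and> (\<forall>a. 0 < c $ a \<and> c $ a < 1) \<and> (\<forall>i\<in>I. f i \<bullet> c = 0)"

lemma inner_pt_c0: "inner_pt c0" using c0 by (auto simp: inner_pt_def)

text \<open>If \<open>c\<close> were moved, a point slightly beyond its image would be sent to a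
  point on the opposite side of \<open>c\<close>. Both are in the cell and all forms vanish at
  \<open>c\<close>, so the cone of \<open>j\<close> contains the line through the root, against
  \<open>diff\<close>.\<close>

lemma inner_pt_swap:
  assumes j: "j \<in> I" and b: "b \<noteq> b'" and diff: "\<exists>t\<in>I. f j $ b - f t $ b \<noteq> f j $ b' - f t $ b'"
    and sw: "\<And>x. x \<in> M j \<Longrightarrow> coord_swap b b' x \<in> M j" and c: "inner_pt c"
  shows "c $ b = c $ b'"
proof (rule ccontr)
  assume ne: "c $ b \<noteq> c $ b'"
  define \<delta> where "\<delta> = c $ b' - c $ b"
  let ?w = "coord_diff b b'"
  have ev: "f i \<bullet> (c + s *\<^sub>R ?w) = s * (f i $ b - f i $ b')" if "i \<in> I" for i s
    using c that by (simp add: inner_pt_def inner_add_right coord_diff_inner)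
  have sum\<delta>: "(\<Sum>a\<in>UNIV. (\<delta> *\<^sub>R ?w) $ a) = 0" using coord_diff_sum[of b b'] by (simp add: sum_distrib_left[symmetric])
  have co: "0 < (c + \<delta> *\<^sub>R ?w) $ a \<and> (c + \<delta> *\<^sub>R ?w) $ a < 1" for a
    using c b by (cases "a = b"; cases "a = b'") (auto simp: coord_diff_nth \<delta>_def inner_pt_def)
  have cP: "c + \<delta> *\<^sub>R ?w \<in> hypersimplex d"
    using co sum\<delta> hyp_sum c by (auto simp: hypersimplex_def inner_pt_def sum.distrib less_imp_le)
  obtain \<epsilon> where \<epsilon>: "0 < \<epsilon>" "\<And>\<eta>. \<lbrakk>0 < \<eta>; \<eta> \<le> \<epsilon>\<rbrakk> \<Longrightarrow> (c + \<delta> *\<^sub>R ?w) + \<eta> *\<^sub>R (\<delta> *\<^sub>R ?w) \<in> hypersimplex d"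
    by (rule hypersimplex_near[OF cP conjunct1[OF co] conjunct2[OF co] sum\<delta>]) blast
  have c': "c + (\<delta> * (1 + \<epsilon>)) *\<^sub>R ?w \<in> hypersimplex d" using \<epsilon>(2)[of \<epsilon>] \<epsilon>(1) by (simp add: algebra_simps)
  have "c \<in> M j" using c j by (simp add: M_def inner_pt_def)
  hence "coord_swap b b' c \<in> M j" by (rule sw)
  hence "c + \<delta> *\<^sub>R ?w \<in> M j" by (simp add: coord_swap_def \<delta>_def scaleR_diff_left algebra_simps)
  hence pos: "0 \<le> \<delta> * ((f j $ b - f j $ b') - (f t $ b - f t $ b'))" if "t \<in> I" for t
  proof -
    have "f t \<bullet> (c + \<delta> *\<^sub>R ?w) \<le> f j \<bullet> (c + \<delta> *\<^sub>R ?w)"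
      using \<open>c + \<delta> *\<^sub>R ?w \<in> M j\<close> that by (simp add: M_def)
    thus ?thesis unfolding ev[OF that] ev[OF j] by (simp add: algebra_simps)
  qed
  have "c + (\<delta> * (1 + \<epsilon>)) *\<^sub>R ?w \<in> M j"
  proof -
    have "f t \<bullet> (c + (\<delta> * (1 + \<epsilon>)) *\<^sub>R ?w) \<le> f j \<bullet> (c + (\<delta> * (1 + \<epsilon>)) *\<^sub>R ?w)" if "t \<in> I" for t
    proof -
      have "0 \<le> (1 + \<epsilon>) * (\<delta> * ((f j $ b - f j $ b') - (f t $ b - f t $ b')))"
        by (rule mult_nonneg_nonneg[OF _ pos[OF that]]) (use \<epsilon>(1) in simp)
      thus ?thesis unfolding ev[OF that] ev[OF j] by (simp add: algebra_simps)
    qed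
    thus ?thesis using c' by (simp add: M_def)
  qed
  hence "coord_swap b b' (c + (\<delta> * (1 + \<epsilon>)) *\<^sub>R ?w) \<in> M j" by (rule sw)
  moreover have "coord_swap b b' (c + (\<delta> * (1 + \<epsilon>)) *\<^sub>R ?w) = c + (- \<delta> * \<epsilon>) *\<^sub>R ?w"
  proof -
    have "(c + (\<delta> * (1 + \<epsilon>)) *\<^sub>R ?w) $ b - (c + (\<delta> * (1 + \<epsilon>)) *\<^sub>R ?w) $ b' = \<delta> * (1 + 2 * \<epsilon>)"
      using b by (simp add: coord_diff_nth \<delta>_def algebra_simps)
    hence "coord_swap b b' (c + (\<delta> * (1 + \<epsilon>)) *\<^sub>R ?w) = c + (\<delta> * (1 + \<epsilon>)) *\<^sub>R ?w - (\<delta> * (1 + 2 * \<epsilon>)) *\<^sub>R ?w"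
      unfolding coord_swap_def by (simp only:)
    thus ?thesis by (simp add: vec_eq_iff algebra_simps)
  qed
  ultimately have cM: "c + (- \<delta> * \<epsilon>) *\<^sub>R ?w \<in> M j" by simp
  have "f j $ b - f t $ b = f j $ b' - f t $ b'" if t: "t \<in> I" for t
  proof -
    have "f t \<bullet> (c + (- \<delta> * \<epsilon>) *\<^sub>R ?w) \<le> f j \<bullet> (c + (- \<delta> * \<epsilon>) *\<^sub>R ?w)" using cM t unfolding M_def by blast
    hence "0 \<le> (- \<delta> * \<epsilon>) * (f j $ b - f j $ b') - (- \<delta> * \<epsilon>) * (f t $ b - f t $ b')"
      unfolding ev[OF t] ev[OF j] by simp
    also have "\<dots> = - \<epsilon> * (\<delta> * ((f j $ b - f j $ b') - (f t $ b - f t $ b')))" by (simp add: algebra_simps)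
    finally have "\<delta> * ((f j $ b - f j $ b') - (f t $ b - f t $ b')) \<le> 0"
      using \<epsilon>(1) by (auto simp: zero_le_mult_iff mult_le_0_iff)
    hence "\<delta> * ((f j $ b - f j $ b') - (f t $ b - f t $ b')) = 0" using pos[OF t] by linarith
    thus ?thesis using ne by (simp add: \<delta>_def)
  qed
  thus False using diff by blast
qed

text \<open>A common zero of the forms is a multiple of \<open>c0\<close> plus a common zero of
  coordinate sum 0, and a small multiple of the latter leads from \<open>c0\<close> to another inner
  point.\<close>

lemma to_inner_pt:
  assumes z: "\<And>i. i \<in> I \<Longrightarrow> f i \<bullet> z = 0" and eq: "\<And>c. inner_pt c \<Longrightarrow> c $ b = c $ b'"
  shows "z $ b = z $ b'"
proof -
  define y where "y = z - ((\<Sum>a\<in>UNIV. z $ a) / d) *\<^sub>R c0"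
  have y0: "(\<Sum>a\<in>UNIV. y $ a) = 0"
    using hyp_sum[OF c0(1)] d by (simp add: y_def sum_subtractf sum_divide_distrib[symmetric] sum_distrib_left[symmetric])
  have fy: "f i \<bullet> y = 0" if "i \<in> I" for i using z c0(4) that by (simp add: y_def inner_diff_right)
  obtain \<epsilon> where \<epsilon>: "0 < \<epsilon>" "\<And>\<eta>. \<lbrakk>0 < \<eta>; \<eta> \<le> \<epsilon>\<rbrakk> \<Longrightarrow> c0 + \<eta> *\<^sub>R y \<in> hypersimplex d"
    "\<And>\<eta> a. \<lbrakk>0 < \<eta>; \<eta> \<le> \<epsilon>\<rbrakk> \<Longrightarrow> 0 < (c0 + \<eta> *\<^sub>R y) $ a \<and> (c0 + \<eta> *\<^sub>R y) $ a < 1"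
    by (rule hypersimplex_near[OF c0(1-3) y0]) blast
  have "inner_pt (c0 + \<epsilon> *\<^sub>R y)"
    using \<epsilon>(2)[of \<epsilon>] \<epsilon>(3)[of \<epsilon>] \<epsilon>(1) fy c0(4) by (simp add: inner_pt_def inner_add_right)
  hence "(c0 + \<epsilon> *\<^sub>R y) $ b = (c0 + \<epsilon> *\<^sub>R y) $ b'" by (rule eq)
  hence "y $ b = y $ b'" using eq[OF inner_pt_c0] \<epsilon>(1) by simp
  thus ?thesis using eq[OF inner_pt_c0] by (simp add: y_def)
qed

text \<open>Near \<open>c0\<close> the cell looks like its cone, and the swap fixes
  \<open>c0\<close>.\<close>

lemma cone_swap:
  assumes j: "j \<in> I" and b: "b \<noteq> b'" and eq: "c0 $ b = c0 $ b'"
    and sw: "\<And>x. x \<in> M j \<Longrightarrow> coord_swap b b' x \<in> M j" and z: "\<And>t. t \<in> I \<Longrightarrow> f t \<bullet> z \<le> f j \<bullet> z" and t: "t \<in> I"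
  shows "f t \<bullet> coord_swap b b' z \<le> f j \<bullet> coord_swap b b' z"
proof -
  define y where "y = z - ((\<Sum>a\<in>UNIV. z $ a) / d) *\<^sub>R c0"
  have y0: "(\<Sum>a\<in>UNIV. y $ a) = 0"
    using hyp_sum[OF c0(1)] d by (simp add: y_def sum_subtractf sum_divide_distrib[symmetric] sum_distrib_left[symmetric])
  have fy: "f i \<bullet> y = f i \<bullet> z" if "i \<in> I" for i using c0(4) that by (simp add: y_def inner_diff_right)
  obtain \<epsilon> where \<epsilon>: "0 < \<epsilon>" "\<And>\<eta>. \<lbrakk>0 < \<eta>; \<eta> \<le> \<epsilon>\<rbrakk> \<Longrightarrow> c0 + \<eta> *\<^sub>R y \<in> hypersimplex d"
    by (rule hypersimplex_near[OF c0(1-3) y0]) blast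
  have "c0 + \<epsilon> *\<^sub>R y \<in> M j"
    using \<epsilon>(2)[of \<epsilon>] \<epsilon>(1) fy c0(4) z j by (simp add: M_def inner_add_right)
  hence "coord_swap b b' (c0 + \<epsilon> *\<^sub>R y) \<in> M j" by (rule sw)
  moreover have "coord_swap b b' (c0 + \<epsilon> *\<^sub>R y) = c0 + \<epsilon> *\<^sub>R coord_swap b b' z - (\<epsilon> * ((\<Sum>a\<in>UNIV. z $ a) / d)) *\<^sub>R c0"
    by (simp add: linear_add[OF linear_coord_swap] linear_diff[OF linear_coord_swap] linear_scale[OF linear_coord_swap] y_def scaleR_diff_right)
      (simp add: coord_swap_def eq)
  ultimately have "f t \<bullet> (c0 + \<epsilon> *\<^sub>R coord_swap b b' z - (\<epsilon> * ((\<Sum>a\<in>UNIV. z $ a) / d)) *\<^sub>R c0)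
      \<le> f j \<bullet> (c0 + \<epsilon> *\<^sub>R coord_swap b b' z - (\<epsilon> * ((\<Sum>a\<in>UNIV. z $ a) / d)) *\<^sub>R c0)" using t by (simp add: M_def)
  thus ?thesis using c0(4) t j \<epsilon>(1) by (simp add: inner_add_right inner_diff_right)
qed

text \<open>The vectors \<open>R s\<close> are dual to the normals \<open>g t\<close> and span the
  rays of the cone of \<open>j\<close>. That the swap maps each ray into the cone is the inequality
  of \<open>two_signs\<close>; evaluating \<open>expand\<close> at the root itself gives the trace
  2.\<close>

lemma swap_pair:
  assumes j: "j \<in> I" and b: "b \<noteq> b'" and diff: "\<exists>t\<in>I. f j $ b - f t $ b \<noteq> f j $ b' - f t $ b'"
    and s1: "\<And>X. \<lbrakk>chi X \<in> M j; b \<in> X; b' \<notin> X\<rbrakk> \<Longrightarrow> chi (insert b' (X - {b})) \<in> M j"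
    and s2: "\<And>X. \<lbrakk>chi X \<in> M j; b' \<in> X; b \<notin> X\<rbrakk> \<Longrightarrow> chi (insert b (X - {b'})) \<in> M j"
  shows "\<exists>x y r s. x \<in> I \<and> y \<in> I \<and> x \<noteq> j \<and> y \<noteq> j \<and> r * s < 0
       \<and> (\<forall>c. r * (f j $ c - f x $ c) + s * (f j $ c - f y $ c) = of_bool (c = b) - of_bool (c = b'))
       \<and> (\<forall>t\<in>I. t \<noteq> x \<longrightarrow> t \<noteq> y \<longrightarrow> f j $ b - f t $ b = f j $ b' - f t $ b')
       \<and> (f j $ b - f x $ b) - (f j $ b' - f x $ b') = 1 / r \<and> (f j $ b - f y $ b) - (f j $ b' - f y $ b') = 1 / s"
proof -
  note sw = coord_swap_cell[OF j b s1 s2]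
  have eq: "c $ b = c $ b'" if "inner_pt c" for c using inner_pt_swap[OF j b diff sw that] by blast
  define T where "T = I - {j}"
  define g where "g t = f j - f t" for t
  define D where "D t = g t $ b - g t $ b'" for t
  have finT: "finite T" using fin by (simp add: T_def)
  have indg: "\<alpha> t = 0" if "(\<Sum>t\<in>T. \<alpha> t *\<^sub>R g t) = 0" "t \<in> T" for \<alpha> t
  proof -
    define \<gamma> where "\<gamma> i = (if i = j then sum \<alpha> T else - \<alpha> i)" for i
    have I: "sum h I = h j + sum h T" for h :: "'i \<Rightarrow> 'x::ab_group_add" unfolding T_def using fin j by (intro sum.remove)
    have sT: "(\<Sum>i\<in>T. \<gamma> i) = - sum \<alpha> T" unfolding sum_negf[symmetric] by (intro sum.cong) (auto simp: \<gamma>_def T_def)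
    hence "(\<Sum>i\<in>I. \<gamma> i) = 0" by (simp add: I \<gamma>_def)
    moreover have "(\<Sum>i\<in>T. \<gamma> i *\<^sub>R f i) = - (\<Sum>i\<in>T. \<alpha> i *\<^sub>R f i)"
      unfolding sum_negf[symmetric] by (intro sum.cong) (auto simp: \<gamma>_def T_def)
    hence "(\<Sum>i\<in>I. \<gamma> i *\<^sub>R f i) = sum \<alpha> T *\<^sub>R f j - (\<Sum>i\<in>T. \<alpha> i *\<^sub>R f i)" by (simp add: I \<gamma>_def)
    hence "(\<Sum>i\<in>I. \<gamma> i *\<^sub>R f i) = 0"
      using that(1) by (simp add: g_def scaleR_diff_right sum_subtractf scaleR_sum_left)
    ultimately have "\<gamma> t = 0" using ind that(2) by (simp add: T_def)
    thus ?thesis using that(2) by (auto simp: \<gamma>_def T_def)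
  qed
  have "\<forall>s\<in>T. \<exists>r. \<forall>t\<in>T. g t \<bullet> r = of_bool (t = s)"
  proof
    fix s assume "s \<in> T"
    obtain r where "g s \<bullet> r = 1" "\<And>t. \<lbrakk>t \<in> T; t \<noteq> s\<rbrakk> \<Longrightarrow> g t \<bullet> r = 0"
      proof (rule dual_vector[of T s g])
      show "\<alpha> t = 0" if "(\<Sum>t\<in>T. \<alpha> t *\<^sub>R g t) = 0" "t \<in> T" for \<alpha> t using that by (rule indg)
    qed (use finT \<open>s \<in> T\<close> in auto)
    thus "\<exists>r. \<forall>t\<in>T. g t \<bullet> r = of_bool (t = s)" by (intro exI[of _ r]) auto
  qed
  then obtain R where R: "\<And>s t. \<lbrakk>s \<in> T; t \<in> T\<rbrakk> \<Longrightarrow> g t \<bullet> R s = of_bool (t = s)" by metis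
  define \<rho> where "\<rho> s = R s $ b - R s $ b'" for s
  have gj: "g j = 0" by (simp add: g_def)
  have IT: "i = j \<or> i \<in> T" if "i \<in> I" for i using that by (auto simp: T_def)
  \<comment> \<open>The functional vanishes on the common zeros of the forms, so it is a combination
    of the normals whose coefficients are its values on the dual vectors.\<close>
  have expand: "z $ b - z $ b' = (\<Sum>t\<in>T. \<rho> t * (g t \<bullet> z))" for z
  proof -
    define y where "y = z - (\<Sum>s\<in>T. (g s \<bullet> z) *\<^sub>R R s)"
    have gy: "g t \<bullet> y = 0" if "t \<in> T" for t
    proof -
      have "g t \<bullet> (\<Sum>s\<in>T. (g s \<bullet> z) *\<^sub>R R s) = (\<Sum>s\<in>T. (g s \<bullet> z) * of_bool (t = s))"
        unfolding inner_sum_right using R that by (intro sum.cong) auto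
      also have "\<dots> = g t \<bullet> z" using finT that by (simp add: of_bool_def if_distrib cong: if_cong)
      finally show ?thesis by (simp add: y_def inner_diff_right)
    qed
    have fj: "f i \<bullet> y = f j \<bullet> y" if "i \<in> I" for i
      using IT[OF that] gy[of i] by (auto simp: g_def inner_diff_left)
    hence "f i \<bullet> y = 0" if "i \<in> I" for i using that fj[OF e0] fe0 by simp
    hence "y $ b = y $ b'" using eq by (rule to_inner_pt)
    moreover have "(\<Sum>s\<in>T. (g s \<bullet> z) *\<^sub>R R s) $ b - (\<Sum>s\<in>T. (g s \<bullet> z) *\<^sub>R R s) $ b' = (\<Sum>t\<in>T. \<rho> t * (g t \<bullet> z))"
      by (simp add: sum_component sum_subtractf[symmetric] \<rho>_def algebra_simps)
    ultimately show ?thesis by (simp add: y_def)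
  qed
  have gw: "g t \<bullet> coord_diff b b' = D t" for t by (simp add: coord_diff_inner D_def)
  have "\<rho> s * D t \<le> of_bool (t = s)" if "s \<in> T" "t \<in> T" for s t
  proof -
    have "f u \<bullet> R s \<le> f j \<bullet> R s" if u: "u \<in> I" for u
    proof (cases "u = j")
      case False
      hence "0 \<le> g u \<bullet> R s" using R[of s u] IT[OF u] \<open>s \<in> T\<close> by auto
      thus ?thesis by (simp add: g_def inner_diff_left)
    qed simp
    hence "f t \<bullet> coord_swap b b' (R s) \<le> f j \<bullet> coord_swap b b' (R s)"
      using that by (intro cone_swap[OF j b eq[OF inner_pt_c0] sw]) (auto simp: T_def)
    hence "0 \<le> g t \<bullet> coord_swap b b' (R s)" by (simp add: g_def inner_diff_left)
    also have "\<dots> = of_bool (t = s) - \<rho> s * D t"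
      using R[OF that] by (simp add: coord_swap_def inner_diff_right gw \<rho>_def)
    finally show ?thesis by simp
  qed
  moreover have "(\<Sum>t\<in>T. \<rho> t * D t) = 2" using expand[of "coord_diff b b'"] b by (simp add: gw coord_diff_nth)
  ultimately have "\<exists>x\<in>T. \<exists>y\<in>T. x \<noteq> y \<and> \<rho> x * D x = 1 \<and> \<rho> y * D y = 1 \<and> \<rho> x * \<rho> y < 0
    \<and> (\<forall>t\<in>T. t \<noteq> x \<longrightarrow> t \<noteq> y \<longrightarrow> D t = 0 \<and> \<rho> t = 0)"
    by (rule two_signs[OF finT])
  then obtain x y where xy: "x \<in> T" "y \<in> T" "x \<noteq> y" "\<rho> x * D x = 1" "\<rho> y * D y = 1" "\<rho> x * \<rho> y < 0"
    and zero: "\<And>t. \<lbrakk>t \<in> T; t \<noteq> x; t \<noteq> y\<rbrakk> \<Longrightarrow> D t = 0 \<and> \<rho> t = 0"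
    by blast
  have col: "\<rho> x * (f j $ c - f x $ c) + \<rho> y * (f j $ c - f y $ c) = of_bool (c = b) - of_bool (c = b')" for c
  proof -
    have "axis c 1 $ b - axis c 1 $ b' = (\<Sum>t\<in>T. \<rho> t * g t $ c)"
      using expand[of "axis c 1"] by (simp add: inner_axis)
    also have "\<dots> = (\<Sum>t\<in>{x,y}. \<rho> t * g t $ c)"
      using xy zero finT by (intro sum.mono_neutral_right) auto
    finally show ?thesis using xy(3) by (auto simp: g_def axis_def)
  qed
  have D0: "f j $ b - f t $ b = f j $ b' - f t $ b'" if "t \<in> I" "t \<noteq> x" "t \<noteq> y" for t
    using IT[OF that(1)] zero[of t] that by (auto simp: D_def g_def)
  have "\<rho> x \<noteq> 0" "\<rho> y \<noteq> 0" using xy(6) by auto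
  hence "D x = 1 / \<rho> x" "D y = 1 / \<rho> y" using xy(4,5) by (simp_all add: eq_divide_eq mult.commute)
  thus ?thesis using xy col D0 by (intro exI[of _ x] exI[of _ y] exI[of _ "\<rho> x"] exI[of _ "\<rho> y"]) (auto simp: T_def D_def g_def)
qed

end

section \<open>Blocks of a simplicial fan\<close>

text \<open>The quantity \<open>S r\<close> of the overview; \<open>g\<close> sends a coordinate to
  the number of its block.\<close>

definition excess :: "('n \<Rightarrow> nat) \<Rightarrow> (nat \<Rightarrow> nat) \<Rightarrow> nat \<Rightarrow> real ^ 'n::finite \<Rightarrow> real" where
  "excess g dd r x = (\<Sum>a | g a \<le> r. x $ a) - (\<Sum>s=1..r. real (dd s))"

definition block_cell :: "nat \<Rightarrow> nat \<Rightarrow> ('n \<Rightarrow> nat) \<Rightarrow> (nat \<Rightarrow> nat) \<Rightarrow> nat \<Rightarrow> (real ^ 'n::finite) set" where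
  "block_cell k d g dd r = {x \<in> hypersimplex d. \<forall>s\<in>{1..k}. excess g dd s x \<le> excess g dd r x}"

definition block_data :: "nat \<Rightarrow> nat \<Rightarrow> (('n::finite \<Rightarrow> nat) \<times> (nat \<Rightarrow> nat)) set" where
  "block_data k d = {(g, dd). (\<forall>a. g a \<in> {1..k}) \<and> dd \<in> {1..k} \<rightarrow>\<^sub>E UNIV \<and>
     (\<forall>r\<in>{1..k}. 0 < dd r \<and> dd r < card {a. g a = r}) \<and> (\<Sum>r=1..k. dd r) = d}"

section \<open>Classes of equal coordinates and their number\<close>

context simplicial_fan
begin

definition same :: "'n \<Rightarrow> 'n \<Rightarrow> bool" where "same a b \<longleftrightarrow> (\<forall>t\<in>I. f t $ a = f t $ b)"

definition opt :: "'i \<Rightarrow> 'n \<Rightarrow> bool" where "opt j a \<longleftrightarrow> (\<forall>t\<in>I. f t $ a \<le> f j $ a)"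

definition dopt :: "'i \<Rightarrow> 'n \<Rightarrow> bool" where "dopt j a \<longleftrightarrow> (\<forall>t\<in>I. drop_val t a \<le> drop_val j a)"

lemma same_refl [simp]: "same a a" by (simp add: same_def)
lemma same_sym: "same a b \<Longrightarrow> same b a" by (simp add: same_def)
lemma same_trans: "same a b \<Longrightarrow> same b c \<Longrightarrow> same a c" by (simp add: same_def)

lemma finite_max: "\<exists>j\<in>I. \<forall>t\<in>I. h t \<le> (h j :: real)"
proof -
  have "Max (h ` I) \<in> h ` I" using fin e0 by (intro Max_in) auto
  then obtain i where i: "i \<in> I" "h i = Max (h ` I)" by auto
  have "h t \<le> h i" if "t \<in> I" for t using i that fin by simp
  thus ?thesis using i(1) by blast
qed

lemma opt_exists: obtains j where "j \<in> I" "opt j a"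
  using finite_max[of "\<lambda>t. f t $ a"] by (auto simp: opt_def)

lemma dopt_exists: obtains j where "j \<in> I" "dopt j a"
  using finite_max[of "\<lambda>t. drop_val t a"] by (auto simp: dopt_def)

lemma opt_swap: assumes "j \<in> I" "opt j b" "chi X \<in> M j" "a \<in> X" "b \<notin> X"
  shows "chi (insert b (X - {a})) \<in> M j"
proof -
  have "chi (insert b X - {a}) \<in> M j" using assms by (intro add_element) (auto simp: opt_def)
  moreover have "insert b X - {a} = insert b (X - {a})" using assms by auto
  ultimately show ?thesis by simp
qed

lemma dopt_swap: assumes "j \<in> I" "dopt j a" "chi X \<in> M j" "a \<in> X" "b \<notin> X"
  shows "chi (insert b (X - {a})) \<in> M j"
  using assms by (intro remove_element) (auto simp: dopt_def)

lemma not_same_diff: assumes "j \<in> I" "\<not> same a b" shows "\<exists>t\<in>I. f j $ a - f t $ a \<noteq> f j $ b - f t $ b"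
proof (rule ccontr)
  assume "\<not> ?thesis"
  hence eq: "f j $ a - f t $ a = f j $ b - f t $ b" if "t \<in> I" for t using that by blast
  have "f j $ a = f j $ b" using eq[OF e0] fe0 by simp
  hence "same a b" using eq by (simp add: same_def)
  thus False using assms by simp
qed

lemma opt_pair_eq:
  assumes "j \<in> I" "\<not> same a b" "opt j a \<and> opt j b \<or> dopt j a \<and> dopt j b" "inner_pt c"
  shows "c $ a = c $ b"
proof (rule inner_pt_swap[OF assms(1) _ not_same_diff[OF assms(1,2)] coord_swap_cell assms(4)])
  show ab: "a \<noteq> b" using assms(2) by auto
  show "a \<noteq> b" by fact
  show "chi (insert b (X - {a})) \<in> M j" if "chi X \<in> M j" "a \<in> X" "b \<notin> X" for X
    using assms(1,3) opt_swap[of j b X a] dopt_swap[of j a X b] that by blast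
  show "chi (insert a (X - {b})) \<in> M j" if "chi X \<in> M j" "b \<in> X" "a \<notin> X" for X
    using assms(1,3) opt_swap[of j a X b] dopt_swap[of j b X a] that by blast
qed (use assms in auto)

definition rep :: "'n \<Rightarrow> 'n" where "rep a = (SOME b. same a b)"

lemma same_rep: "same a (rep a)" unfolding rep_def by (rule someI[of _ a]) simp

lemma rep_eq: "rep a = rep b \<longleftrightarrow> same a b"
proof
  assume "rep a = rep b" thus "same a b" using same_rep same_sym same_trans by metis
next
  assume "same a b"
  hence "same a = same b" using same_sym same_trans by blast
  thus "rep a = rep b" by (simp add: rep_def)
qed

text \<open>Two classes with a common optimal region can be exchanged both ways in its cell by
  \<open>opt_swap\<close>, so \<open>swap_pair\<close> supplies the relation that
  \<open>column_count\<close> needs.\<close>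

lemma card_reps_le: "card (range rep) \<le> card I"
proof -
  interpret column_count I "range rep" "\<lambda>i a. f i $ a"
  proof
    fix a show "\<exists>j\<in>I. \<forall>t\<in>I. f t $ a \<le> f j $ a" using opt_exists[of a] by (auto simp: opt_def)
  next
    fix j a b assume *: "j \<in> I" "a \<in> range rep" "b \<in> range rep" "a \<noteq> b"
      "\<And>t. t \<in> I \<Longrightarrow> f t $ a \<le> f j $ a" "\<And>t. t \<in> I \<Longrightarrow> f t $ b \<le> f j $ b"
    have "\<not> same a b" using * rep_eq same_rep by (metis imageE)
    hence diff: "\<exists>t\<in>I. f j $ a - f t $ a \<noteq> f j $ b - f t $ b" by (rule not_same_diff[OF *(1)])
    have "opt j a" "opt j b" using * by (auto simp: opt_def)
    hence "\<exists>x y r s. x \<in> I \<and> y \<in> I \<and> x \<noteq> j \<and> y \<noteq> j \<and> r * s < 0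
       \<and> (\<forall>c. r * (f j $ c - f x $ c) + s * (f j $ c - f y $ c) = of_bool (c = a) - of_bool (c = b))
       \<and> (\<forall>t\<in>I. t \<noteq> x \<longrightarrow> t \<noteq> y \<longrightarrow> f j $ a - f t $ a = f j $ b - f t $ b)
       \<and> (f j $ a - f x $ a) - (f j $ b - f x $ b) = 1 / r \<and> (f j $ a - f y $ a) - (f j $ b - f y $ b) = 1 / s"
      using opt_swap[OF *(1)] by (intro swap_pair[OF *(1,4) diff]) auto
    thus "\<exists>x y r s. x \<in> I \<and> y \<in> I \<and> x \<noteq> j \<and> y \<noteq> j \<and> r * s < 0
       \<and> (\<forall>c\<in>range rep. r * (f j $ c - f x $ c) + s * (f j $ c - f y $ c) = of_bool (c = a) - of_bool (c = b))
       \<and> (\<forall>t\<in>I. t \<noteq> x \<longrightarrow> t \<noteq> y \<longrightarrow> f j $ a - f t $ a = f j $ b - f t $ b)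
       \<and> (f j $ a - f x $ a) - (f j $ b - f x $ b) = 1 / r \<and> (f j $ a - f y $ a) - (f j $ b - f y $ b) = 1 / s"
      by (elim exE) (intro exI, fast)
  qed (use fin in auto)
  show ?thesis by (rule card_columns)
qed

definition blk :: "'n \<Rightarrow> 'n set" where "blk a = {b. same a b}"

definition cspace :: "(real ^ 'n) set" where "cspace = {v. \<forall>a b. same a b \<longrightarrow> v $ a = v $ b}"

definition basis :: "(real ^ 'n) set" where "basis = insert (chi UNIV) (f ` (I - {e0}))"

lemma f_inj: assumes "i \<in> I" "j \<in> I" "f i = f j" shows "i = j"
proof (rule ccontr)
  assume ne: "i \<noteq> j"
  let ?\<alpha> = "\<lambda>t. of_bool (t = i) - of_bool (t = j) :: real"
  have "(\<Sum>t\<in>I. ?\<alpha> t) = 0" using fin assms by (simp add: sum_subtractf)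
  moreover have "(\<Sum>t\<in>I. ?\<alpha> t *\<^sub>R f t) = (\<Sum>t\<in>{i,j}. ?\<alpha> t *\<^sub>R f t)"
    using fin assms by (intro sum.mono_neutral_right) auto
  hence "(\<Sum>t\<in>I. ?\<alpha> t *\<^sub>R f t) = 0" using ne assms by simp
  ultimately have "?\<alpha> i = 0" using assms(1) by (rule ind)
  thus False using ne by simp
qed

lemma chi_UNIV_inner: "chi UNIV \<bullet> x = (\<Sum>a\<in>UNIV. x $ a)" for x :: "real ^ 'n"
  by (simp add: inner_vec_def)

lemma combo_zero:
  assumes "\<gamma> *\<^sub>R chi UNIV + (\<Sum>i\<in>I. \<alpha> i *\<^sub>R f i) = 0"
  shows "\<gamma> = 0" "(\<Sum>i\<in>I. \<alpha> i *\<^sub>R f i) = 0"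
proof -
  have "(\<gamma> *\<^sub>R chi UNIV + (\<Sum>i\<in>I. \<alpha> i *\<^sub>R f i)) \<bullet> c0 = \<gamma> * real d"
    using c0 hyp_sum[OF c0(1)] by (simp add: inner_add_left inner_sum_left chi_UNIV_inner)
  thus "\<gamma> = 0" using assms d by simp
  thus "(\<Sum>i\<in>I. \<alpha> i *\<^sub>R f i) = 0" using assms by simp
qed

text \<open>The all-ones vector is no combination of the forms, because these vanish at
  \<open>c0\<close> and it does not. This gives as many independent vectors constant on classes as
  there are regions.\<close>

lemma basis_props: "independent basis" "card basis = card I" "basis \<subseteq> cspace"
proof -
  have nin: "chi UNIV \<notin> f ` (I - {e0})"
  proof
    assume "chi UNIV \<in> f ` (I - {e0})"
    then obtain i where i: "i \<in> I" "chi UNIV = f i" by blast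
    have "f i \<bullet> c0 = 0" using c0 i by blast
    thus False unfolding i(2)[symmetric] chi_UNIV_inner hyp_sum[OF c0(1)] using d by simp
  qed
  have injf: "inj_on f (I - {e0})" using f_inj by (auto intro: inj_onI)
  have finB: "finite (f ` (I - {e0}))" using fin by simp
  have "card basis = Suc (card (f ` (I - {e0})))" unfolding basis_def using nin finB by simp
  also have "\<dots> = card I" unfolding card_image[OF injf] by (rule card_Suc_Diff1[OF fin e0])
  finally show "card basis = card I" .
  show "basis \<subseteq> cspace" by (auto simp: basis_def cspace_def same_def)
  show "independent basis"
    unfolding independent_explicit
  proof (intro conjI allI impI)
    show "finite basis" using finB by (simp add: basis_def)
    fix u assume "(\<Sum>v\<in>basis. u v *\<^sub>R v) = 0"
    hence s: "u (chi UNIV) *\<^sub>R chi UNIV + (\<Sum>i\<in>I - {e0}. u (f i) *\<^sub>R f i) = 0"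
      unfolding basis_def using nin finB by (simp add: sum.reindex[OF injf])
    define \<alpha> where "\<alpha> i = (if i = e0 then - (\<Sum>i\<in>I - {e0}. u (f i)) else u (f i))" for i
    have r: "sum h I = h e0 + sum h (I - {e0})" for h :: "'i \<Rightarrow> 'x::comm_monoid_add" using fin e0 by (intro sum.remove)
    have "(\<Sum>i\<in>I - {e0}. \<alpha> i *\<^sub>R f i) = (\<Sum>i\<in>I - {e0}. u (f i) *\<^sub>R f i)" by (intro sum.cong) (auto simp: \<alpha>_def)
    hence "(\<Sum>i\<in>I. \<alpha> i *\<^sub>R f i) = (\<Sum>i\<in>I - {e0}. u (f i) *\<^sub>R f i)" by (simp add: r fe0)
    with s have s': "u (chi UNIV) *\<^sub>R chi UNIV + (\<Sum>i\<in>I. \<alpha> i *\<^sub>R f i) = 0" by (simp only:)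
    have "(\<Sum>i\<in>I - {e0}. \<alpha> i) = (\<Sum>i\<in>I - {e0}. u (f i))" by (intro sum.cong) (auto simp: \<alpha>_def)
    hence s0: "sum \<alpha> I = 0" by (simp add: r) (simp add: \<alpha>_def)
    have a0: "\<alpha> i = 0" if "i \<in> I" for i using ind[OF s0 combo_zero(2)[OF s'] that] .
    show "\<forall>v\<in>basis. u v = 0"
    proof
      fix v assume "v \<in> basis"
      then consider "v = chi UNIV" | i where "i \<in> I" "i \<noteq> e0" "v = f i" by (auto simp: basis_def)
      thus "u v = 0"
      proof cases
        case 1 thus ?thesis using combo_zero(1)[OF s'] by simp
      next
        case 2 thus ?thesis using a0[of i] by (simp add: \<alpha>_def)
      qed
    qed
  qed
qed

lemma same_cong: "same b c \<Longrightarrow> same a b \<longleftrightarrow> same a c" "same b c \<Longrightarrow> same b a \<longleftrightarrow> same c a"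
  using same_trans same_sym by blast+

lemma chi_blk: "chi (blk a) \<in> cspace"
  using same_cong(1) by (simp add: cspace_def blk_def)

lemma dim_cspace: "dim cspace \<le> card (range rep)"
proof -
  have "cspace \<subseteq> span (chi ` blk ` range rep)"
  proof
    fix v assume v: "v \<in> cspace"
    have "v = (\<Sum>a\<in>range rep. v $ a *\<^sub>R chi (blk a))"
    proof (rule vec_eq_iff[THEN iffD2], rule allI)
      fix b
      have "(\<Sum>a\<in>range rep. v $ a *\<^sub>R chi (blk a)) $ b = (\<Sum>a\<in>range rep. v $ a * of_bool (same a b))"
        by (simp add: sum_component blk_def)
      also have "\<dots> = (\<Sum>a\<in>{rep b}. v $ a * of_bool (same a b))"
      proof (intro sum.mono_neutral_right ballI)
        fix a assume "a \<in> range rep - {rep b}"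
        then obtain c where c: "a = rep c" "rep c \<noteq> rep b" by blast
        hence "\<not> same a b" using same_rep[of c] same_trans rep_eq by blast
        thus "v $ a * of_bool (same a b) = 0" by simp
      qed auto
      also have "\<dots> = v $ b"
      proof -
        have "v $ b = v $ rep b" using v same_rep[of b] unfolding cspace_def by blast
        thus ?thesis using same_sym[OF same_rep[of b]] by simp
      qed
      finally show "v $ b = (\<Sum>a\<in>range rep. v $ a *\<^sub>R chi (blk a)) $ b" ..
    qed
    also have "\<dots> \<in> span (chi ` blk ` range rep)" by (intro span_sum span_scale span_base) auto
    finally show "v \<in> span (chi ` blk ` range rep)" .
  qed
  hence "dim cspace \<le> card (chi ` blk ` range rep)" by (rule dim_le_card) simp
  also have "\<dots> \<le> card (range rep)" by (metis card_image_le finite finite_imageI le_trans)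
  finally show ?thesis .
qed

text \<open>The upper bound comes from the exchanges, the lower bound from the independent set
  \<open>basis\<close> inside \<open>cspace\<close>.\<close>

lemma card_reps: "card (range rep) = card I"
  using card_reps_le dim_cspace independent_card_le_dim[OF basis_props(3,1)] basis_props(2) by linarith

lemma chi_blk_span: "chi (blk a) \<in> span basis"
proof -
  have "cspace \<subseteq> span basis"
    using basis_props dim_cspace card_reps by (intro card_ge_dim_independent) auto
  thus ?thesis using chi_blk by blast
qed

text \<open>By equality of dimensions the indicator of a class is a combination of the forms and the
  all-ones vector; on common zeros of the forms only the latter contributes.\<close>

lemma blk_inner:
  obtains q where "\<And>x. \<lbrakk>\<And>i. i \<in> I \<Longrightarrow> f i \<bullet> x = 0\<rbrakk> \<Longrightarrow> chi (blk a) \<bullet> x = q * (\<Sum>a\<in>UNIV. x $ a)"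
proof -
  have "\<exists>q. \<forall>x. (\<forall>i\<in>I. f i \<bullet> x = 0) \<longrightarrow> v \<bullet> x = q * (\<Sum>a\<in>UNIV. x $ a)" if "v \<in> span basis" for v
    using that
  proof (induction rule: span_induct_alt)
    case base show ?case by (rule exI[of _ 0]) simp
  next
    case (step c x y)
    then obtain q where q: "\<forall>z. (\<forall>i\<in>I. f i \<bullet> z = 0) \<longrightarrow> y \<bullet> z = q * (\<Sum>a\<in>UNIV. z $ a)" by blast
    from step(1) consider "x = chi UNIV" | i where "i \<in> I" "x = f i" by (auto simp: basis_def)
    thus ?case
    proof cases
      case 1
      thus ?thesis using q by (intro exI[of _ "c + q"]) (simp add: inner_add_left chi_UNIV_inner algebra_simps)
    next
      case 2
      thus ?thesis using q by (intro exI[of _ q]) (simp add: inner_add_left)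
    qed
  qed
  from this[OF chi_blk_span[of a]] that show thesis by blast
qed

end

lemma subset_with_counts:
  fixes cl :: "'n::finite \<Rightarrow> 'i"
  assumes q: "\<And>e. e \<in> I \<Longrightarrow> 0 \<le> q e" "\<And>e. e \<in> I \<Longrightarrow> q e \<le> int (card {a. cl a = e})"
  obtains X :: "'n set" where "\<And>e. e \<in> I \<Longrightarrow> int (card (X \<inter> {a. cl a = e})) = q e" "X \<subseteq> {a. cl a \<in> I}"
proof -
  have "\<exists>Y. Y \<subseteq> {a. cl a = e} \<and> int (card Y) = q e" if e: "e \<in> I" for e
  proof -
    have "nat (q e) \<le> card {a. cl a = e}" using q(2)[OF e] by simp
    then obtain Y where "Y \<subseteq> {a. cl a = e}" "card Y = nat (q e)" by (rule obtain_subset_with_card_n)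
    thus ?thesis using q(1)[OF e] by (intro exI[of _ Y]) simp
  qed
  then obtain Y where Y: "\<And>e. e \<in> I \<Longrightarrow> Y e \<subseteq> {a. cl a = e}" "\<And>e. e \<in> I \<Longrightarrow> int (card (Y e)) = q e"
    by metis
  have "(\<Union>e\<in>I. Y e) \<inter> {a. cl a = e} = Y e" if "e \<in> I" for e using Y(1) that by fastforce
  hence "int (card ((\<Union>e\<in>I. Y e) \<inter> {a. cl a = e})) = q e" if "e \<in> I" for e using Y(2) that by simp
  moreover have "(\<Union>e\<in>I. Y e) \<subseteq> {a. cl a \<in> I}" using Y(1) by fastforce
  ultimately show thesis by (rule that)
qed

section \<open>Integral block sums and the matrix of the forms\<close>

context simplicial_fan
begin

text \<open>All forms tie at \<open>c0\<close>, and a 0/1 point below it keeps the ties. The block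
  sums of this vertex are the integers that become \<open>dd\<close>.\<close>

lemma vertex0: "\<exists>X. card X = d \<and> (\<forall>i\<in>I. f i \<bullet> chi X = 0)"
proof -
  have "c0 \<in> M e0" using c0 e0 by (simp add: M_def)
  moreover have "c0 $ undefined \<noteq> 0" using c0(2)[of undefined] by simp
  ultimately obtain X where X: "chi X \<in> M e0" "\<And>t. \<lbrakk>t \<in> I; f t \<bullet> c0 = f e0 \<bullet> c0\<rbrakk> \<Longrightarrow> f t \<bullet> chi X = f e0 \<bullet> chi X"
    using vertex_below[OF e0, of c0 undefined 0] by (metis insertI1)
  have "f i \<bullet> chi X = 0" if "i \<in> I" for i using X(2)[OF that] c0(4) that e0 fe0 by simp
  thus ?thesis using X(1) M_chi by blast
qed

definition X0 :: "'n set" where "X0 = (SOME X. card X = d \<and> (\<forall>i\<in>I. f i \<bullet> chi X = 0))"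

lemma X0: "card X0 = d" "\<And>i. i \<in> I \<Longrightarrow> f i \<bullet> chi X0 = 0"
  using someI_ex[OF vertex0] by (auto simp: X0_def)

lemma X0_M: "i \<in> I \<Longrightarrow> chi X0 \<in> M i" using X0 by (simp add: M_chi)

lemma chi_inner: "chi Y \<bullet> x = (\<Sum>a\<in>Y. x $ a)" for x :: "real ^ 'n"
  by (subst inner_commute) (rule inner_chi)

lemma chi_inner_chi: "chi Y \<bullet> chi Z = real (card (Y \<inter> Z))" for Y Z :: "'n set"
  by (simp add: chi_inner of_bool_def sum.If_cases)

lemma blk_sum:
  assumes x: "\<And>i. i \<in> I \<Longrightarrow> f i \<bullet> x = 0" "(\<Sum>a\<in>UNIV. x $ a) = real d"
  shows "(\<Sum>b\<in>blk a. x $ b) = real (card (blk a \<inter> X0))"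
proof -
  obtain q where q: "\<And>x. \<lbrakk>\<And>i. i \<in> I \<Longrightarrow> f i \<bullet> x = 0\<rbrakk> \<Longrightarrow> chi (blk a) \<bullet> x = q * (\<Sum>a\<in>UNIV. x $ a)"
    using blk_inner by blast
  have "chi (blk a) \<bullet> x = q * d" using q[OF x(1)] x(2) by simp
  also have "\<dots> = chi (blk a) \<bullet> chi X0" using q[OF X0(2)] X0(1) sum_chi[of X0] by simp
  finally show ?thesis unfolding chi_inner_chi unfolding chi_inner .
qed

text \<open>The count is also the block sum of \<open>c0\<close>, whose coordinates are strictly
  between 0 and 1.\<close>

lemma blk_count: "0 < card (blk a \<inter> X0)" "card (blk a \<inter> X0) < card (blk a)"
proof -
  have s: "(\<Sum>b\<in>blk a. c0 $ b) = real (card (blk a \<inter> X0))" using c0 hyp_sum by (intro blk_sum) auto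
  have "a \<in> blk a" unfolding blk_def by (rule CollectI) (rule same_refl)
  hence ne: "blk a \<noteq> {}" by blast
  have "0 < (\<Sum>b\<in>blk a. c0 $ b)" using c0 ne by (intro sum_pos) auto
  thus "0 < card (blk a \<inter> X0)" using s by simp
  have "(\<Sum>b\<in>blk a. c0 $ b) < (\<Sum>b\<in>blk a. 1)" using c0 ne by (intro sum_strict_mono) auto
  thus "card (blk a \<inter> X0) < card (blk a)" using s by simp
qed

lemma blk_two: obtains a' where "same a a'" "a' \<noteq> a"
proof -
  have "blk a \<noteq> {a}" using blk_count[of a] by (metis card_1_singleton_iff One_nat_def less_Suc0 not_less_iff_gr_or_eq)
  moreover have "a \<in> blk a" unfolding blk_def by (rule CollectI) (rule same_refl)
  ultimately obtain a' where "a' \<in> blk a" "a' \<noteq> a" by blast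
  thus thesis using that by (simp add: blk_def)
qed

text \<open>Moving mass from a second member of the class of \<open>a\<close> to \<open>a\<close>
  keeps all forms at 0 and changes coordinate \<open>a\<close> but not \<open>b\<close>. This
  contradicts \<open>opt_pair_eq\<close>, by which the two coordinates agree at every inner
  point.\<close>

lemma opt_same:
  assumes "j \<in> I" "opt j a \<and> opt j b \<or> dopt j a \<and> dopt j b"
  shows "same a b"
proof (rule ccontr)
  assume ns: "\<not> same a b"
  note eq = opt_pair_eq[OF assms(1) ns assms(2)]
  obtain a' where a': "same a a'" "a' \<noteq> a" by (rule blk_two)
  have "b \<noteq> a" "b \<noteq> a'" using ns a' by auto
  obtain \<epsilon> where \<epsilon>: "0 < \<epsilon>" "\<And>\<eta>. \<lbrakk>0 < \<eta>; \<eta> \<le> \<epsilon>\<rbrakk> \<Longrightarrow> c0 + \<eta> *\<^sub>R coord_diff a a' \<in> hypersimplex d"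
    "\<And>\<eta> a''. \<lbrakk>0 < \<eta>; \<eta> \<le> \<epsilon>\<rbrakk> \<Longrightarrow> 0 < (c0 + \<eta> *\<^sub>R coord_diff a a') $ a'' \<and> (c0 + \<eta> *\<^sub>R coord_diff a a') $ a'' < 1"
    by (rule hypersimplex_near[OF c0(1-3) coord_diff_sum]) blast
  have "inner_pt (c0 + \<epsilon> *\<^sub>R coord_diff a a')"
    unfolding inner_pt_def
  proof (intro conjI allI ballI)
    fix i assume "i \<in> I"
    thus "f i \<bullet> (c0 + \<epsilon> *\<^sub>R coord_diff a a') = 0" using c0(4) a'(1) by (simp add: inner_add_right coord_diff_inner same_def)
  qed (use \<epsilon>(2)[of \<epsilon>] \<epsilon>(3)[of \<epsilon>] \<epsilon>(1) in blast)+
  from eq[OF this] have "c0 $ a + \<epsilon> = c0 $ b" using a' \<open>b \<noteq> a\<close> \<open>b \<noteq> a'\<close> by (simp add: coord_diff_nth)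
  thus False using eq[OF inner_pt_c0] \<epsilon>(1) by simp
qed

text \<open>No region labels two classes, and there are as many classes as regions, so the labelling
  is onto.\<close>

lemma label_bij:
  assumes ex: "\<And>a. \<exists>j\<in>I. L j a" and inj: "\<And>j a b. \<lbrakk>j \<in> I; L j a; L j b\<rbrakk> \<Longrightarrow> same a b"
    and cong: "\<And>j a b. \<lbrakk>j \<in> I; same a b\<rbrakk> \<Longrightarrow> L j a = L j b"
  shows "\<exists>l. (\<forall>a. l a \<in> I \<and> L (l a) a) \<and> (\<forall>a b. l a = l b \<longleftrightarrow> same a b) \<and> l ` UNIV = I"
proof -
  define l where "l a = (SOME j. j \<in> I \<and> L j (rep a))" for a
  have l: "l a \<in> I \<and> L (l a) a" for a
  proof -
    have "\<exists>j. j \<in> I \<and> L j (rep a)" using ex by blast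
    hence "l a \<in> I \<and> L (l a) (rep a)" unfolding l_def by (rule someI_ex)
    thus ?thesis using cong[OF _ same_rep] by simp
  qed
  have eq: "l a = l b \<longleftrightarrow> same a b" for a b
  proof
    assume "l a = l b" thus "same a b" using inj[of "l a" a b] l[of a] l[of b] by simp
  next
    assume "same a b" thus "l a = l b" using rep_eq[of a b] by (simp add: l_def)
  qed
  have "inj_on l (range rep)"
  proof (rule inj_onI)
    fix x y assume "x \<in> range rep" "y \<in> range rep" "l x = l y"
    moreover have "rep (rep z) = rep z" for z using same_rep same_sym rep_eq by blast
    ultimately show "x = y" using eq[of x y] rep_eq[of x y] by auto
  qed
  hence "card (l ` range rep) = card I" using card_reps by (simp add: card_image)
  moreover have "l ` range rep \<subseteq> I" using l by blast
  ultimately have "l ` range rep = I" using fin by (intro card_subset_eq) auto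
  hence "l ` UNIV = I" using l by blast
  thus ?thesis using l eq by blast
qed

lemma opt_cong: assumes "same a b" "j \<in> I" shows "opt j a = opt j b"
  using assms by (simp add: opt_def same_def)

lemma dopt_cong: assumes "same a b" "j \<in> I" shows "dopt j a = dopt j b"
  using assms by (simp add: dopt_def drop_val_def same_def)

lemma labels: "\<exists>cl. (\<forall>a. cl a \<in> I \<and> opt (cl a) a) \<and> (\<forall>a b. cl a = cl b \<longleftrightarrow> same a b) \<and> cl ` UNIV = I"
  "\<exists>cl. (\<forall>a. cl a \<in> I \<and> dopt (cl a) a) \<and> (\<forall>a b. cl a = cl b \<longleftrightarrow> same a b) \<and> cl ` UNIV = I"
proof -
  show "\<exists>l. (\<forall>a. l a \<in> I \<and> opt (l a) a) \<and> (\<forall>a b. l a = l b \<longleftrightarrow> same a b) \<and> l ` UNIV = I"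
  proof (rule label_bij)
    show "\<exists>j\<in>I. opt j a" for a by (rule opt_exists[of a]) blast
    show "same a b" if "j \<in> I" "opt j a" "opt j b" for j a b by (rule opt_same[OF that(1)]) (use that in blast)
    show "opt j a = opt j b" if "j \<in> I" "same a b" for j a b by (rule opt_cong[OF that(2,1)])
  qed
  show "\<exists>l. (\<forall>a. l a \<in> I \<and> dopt (l a) a) \<and> (\<forall>a b. l a = l b \<longleftrightarrow> same a b) \<and> l ` UNIV = I"
  proof (rule label_bij)
    show "\<exists>j\<in>I. dopt j a" for a by (rule dopt_exists[of a]) blast
    show "same a b" if "j \<in> I" "dopt j a" "dopt j b" for j a b by (rule opt_same[OF that(1)]) (use that in blast)
    show "dopt j a = dopt j b" if "j \<in> I" "same a b" for j a b by (rule dopt_cong[OF that(2,1)])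
  qed
qed

theorem fan_cells:
  assumes k: "2 \<le> card I"
  obtains g dd p where "(g, dd) \<in> block_data (card I) d" "bij_betw p I {1..card I}" "p e0 = card I"
    "\<And>i. i \<in> I \<Longrightarrow> M i = block_cell (card I) d g dd (p i)"
proof -
  obtain cl where c: "\<forall>a. cl a \<in> I \<and> opt (cl a) a" "\<forall>a b. cl a = cl b \<longleftrightarrow> same a b" "cl ` UNIV = I"
    using labels(1) by (elim exE conjE)
  have cl: "\<And>a. cl a \<in> I" "\<And>a. opt (cl a) a" "\<And>a b. cl a = cl b \<longleftrightarrow> same a b" "range cl = I"
    using c by simp_all
  obtain dl where l: "\<forall>a. dl a \<in> I \<and> dopt (dl a) a" "\<forall>a b. dl a = dl b \<longleftrightarrow> same a b" "dl ` UNIV = I"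
    using labels(2) by (elim exE conjE)
  have dl: "\<And>a. dl a \<in> I" "\<And>a. dopt (dl a) a" "\<And>a b. dl a = dl b \<longleftrightarrow> same a b" "range dl = I"
    using l by simp_all
  define r where "r e = (SOME a. cl a = e)" for e
  have r: "cl (r e) = e" if "e \<in> I" for e
  proof -
    have "\<exists>a. cl a = e" using that cl(4) by blast
    thus ?thesis unfolding r_def by (rule someI_ex)
  qed
  \<comment> \<open>Each class is named by the unique region optimal on it, which turns the forms
    into a square matrix indexed by regions.\<close>
  define F where "F t e = f t $ r e" for t e
  have F: "f t $ a = F t (cl a)" if "t \<in> I" for t a
    using that r[OF cl(1)[of a]] cl(3)[of a "r (cl a)"] by (auto simp: F_def same_def)
  \<comment> \<open>The class on which \<open>i\<close> is best for removal, named by the region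
    that is optimal on it.\<close>
  define \<tau> where "\<tau> i = cl (SOME a. dl a = i)" for i
  have tau: "dl a = i \<longleftrightarrow> cl a = \<tau> i" if "i \<in> I" for a i
  proof -
    have "\<exists>a. dl a = i" using that dl(4) by blast
    hence "dl (SOME a. dl a = i) = i" by (rule someI_ex)
    thus ?thesis unfolding \<tau>_def using dl(3) cl(3) by metis
  qed
  define J where "J z = {t \<in> I. \<forall>u\<in>I. (\<Sum>e\<in>I. of_int (z e) * F u e) \<le> (\<Sum>e\<in>I. of_int (z e) * F t e)}"
    for z :: "'i \<Rightarrow> int"
  define m where "m e = card ({a. cl a = e} \<inter> X0)" for e
  have blk: "{b. cl b = cl a} = blk a" for a using cl(3) same_sym by (auto simp: blk_def)
  have m: "0 < m e" "m e < card {a. cl a = e}" if "e \<in> I" for e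
    using blk_count[of "r e"] r[OF that] blk[of "r e"] by (simp_all add: m_def)
  have class_sum: "(\<Sum>a\<in>Y. h (cl a)) = (\<Sum>e\<in>I. real (card (Y \<inter> {a. cl a = e})) * h e)" for Y and h :: "'i \<Rightarrow> real"
  proof -
    have "(\<Sum>a\<in>Y. h (cl a)) = (\<Sum>e\<in>I. \<Sum>a\<in>{a \<in> Y. cl a = e}. h (cl a))"
      using fin cl(1) by (intro sum.group[symmetric]) auto
    also have "\<dots> = (\<Sum>e\<in>I. real (card (Y \<inter> {a. cl a = e})) * h e)"
    proof (intro sum.cong refl)
      fix e
      have "(\<Sum>a\<in>{a \<in> Y. cl a = e}. h (cl a)) = (\<Sum>a\<in>{a \<in> Y. cl a = e}. h e)" by (intro sum.cong) auto
      also have "\<dots> = real (card (Y \<inter> {a. cl a = e})) * h e" by (simp add: Collect_conj_eq)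
      finally show "(\<Sum>a\<in>{a \<in> Y. cl a = e}. h (cl a)) = real (card (Y \<inter> {a. cl a = e})) * h e" .
    qed
    finally show ?thesis .
  qed
  have fchi: "f t \<bullet> chi Y = (\<Sum>e\<in>I. real (card (Y \<inter> {a. cl a = e})) * F t e)" if "t \<in> I" for t Y
    unfolding inner_chi F[OF that] by (rule class_sum)
  have msum: "(\<Sum>e\<in>I. real (m e) * F t e) = 0" if "t \<in> I" for t
    using X0(2)[OF that] by (simp add: fchi[OF that] m_def Int_commute)
  have mtot: "(\<Sum>e\<in>I. m e) = d"
  proof -
    have "real (\<Sum>e\<in>I. m e) = real d" using class_sum[of "\<lambda>_. 1" X0] X0(1) by (simp add: m_def Int_commute)
    thus ?thesis by (simp only: of_nat_eq_iff)
  qed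
  \<comment> \<open>Every class has a member and a non-member of \<open>X0\<close>, so its count can
    be changed by one in either direction. Hence each admissible \<open>z\<close> comes from a
    vertex, and \<open>J z\<close> lists the cells at that vertex.\<close>
  have counts: "\<exists>X. card X = d \<and> (\<forall>e\<in>I. int (card (X \<inter> {a. cl a = e})) = int (m e) + z e)
      \<and> (\<forall>t\<in>I. f t \<bullet> chi X = (\<Sum>e\<in>I. of_int (z e) * F t e)) \<and> J z = {t\<in>I. chi X \<in> M t}"
    if z: "\<forall>e\<in>I. \<bar>z e\<bar> \<le> 1" "sum z I = 0" for z
  proof -
    have "0 \<le> int (m e) + z e" "int (m e) + z e \<le> int (card {a. cl a = e})" if "e \<in> I" for e
      using m[OF that] bspec[OF z(1) that] by linarith+
    then obtain X where X: "\<And>e. e \<in> I \<Longrightarrow> int (card (X \<inter> {a. cl a = e})) = int (m e) + z e"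
      using subset_with_counts[of I "\<lambda>e. int (m e) + z e" cl] by metis
    have rX: "real (card (X \<inter> {a. cl a = e})) = real (m e) + of_int (z e)" if "e \<in> I" for e
      using arg_cong[OF X[OF that], of real_of_int] by simp
    have "real (card X) = (\<Sum>e\<in>I. real (card (X \<inter> {a. cl a = e})))" using class_sum[of "\<lambda>_. 1" X] by simp
    also have "\<dots> = real (\<Sum>e\<in>I. m e) + of_int (sum z I)" by (simp add: rX sum.distrib)
    finally have cX: "card X = d" using mtot z(2) by simp
    have fX: "f t \<bullet> chi X = (\<Sum>e\<in>I. of_int (z e) * F t e)" if "t \<in> I" for t
    proof -
      have "f t \<bullet> chi X = (\<Sum>e\<in>I. real (m e) * F t e + of_int (z e) * F t e)"
        unfolding fchi[OF that] by (intro sum.cong refl) (simp add: rX distrib_right)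
      thus ?thesis using msum[OF that] by (simp add: sum.distrib)
    qed
    have "J z = {t\<in>I. chi X \<in> M t}" unfolding J_def M_chi using fX cX by auto
    thus ?thesis using X cX fX by blast
  qed
  interpret cyclic_core I F \<tau> J
  proof
    show "finite I" by (rule fin)
    show "bij_betw \<tau> I I"
    proof -
      have "inj_on \<tau> I"
      proof (rule inj_onI)
        fix x y assume xy: "x \<in> I" "y \<in> I" "\<tau> x = \<tau> y"
        obtain a where a: "dl a = x" using dl(4) xy(1) by blast
        hence "cl a = \<tau> y" using tau[OF xy(1)] xy(3) by simp
        thus "x = y" using tau[OF xy(2), of a] a by simp
      qed
      moreover have "\<tau> ` I \<subseteq> I" using cl(1) by (auto simp: \<tau>_def)
      ultimately show ?thesis using endo_inj_surj[OF fin] by (simp add: bij_betw_def)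
    qed
    show "J z = {t \<in> I. \<forall>u\<in>I. (\<Sum>e\<in>I. of_int (z e) * F u e) \<le> (\<Sum>e\<in>I. of_int (z e) * F t e)}" for z
      by (simp add: J_def)
  next
    \<comment> \<open>All forms vanish at \<open>X0\<close>. Both inequalities compare forms
      \<open>i\<close> and \<open>t\<close> at a vertex one exchange away, using an exchange that
      the cell of \<open>i\<close> permits.\<close>
    fix i t a assume it: "i \<in> I" "t \<in> I" "a \<in> I"
    show "F i a - F t a \<le> F i i - F t i"
    proof (cases "a = i")
      case False
      obtain x where x: "cl x = a" "x \<in> X0" using m(1)[OF it(3)] by (force simp: m_def card_gt_0_iff)
      have "\<not> {b. cl b = i} \<subseteq> X0" using m(2)[OF it(1)] by (auto simp: m_def dest: Int_absorb2)
      then obtain b where b: "cl b = i" "b \<notin> X0" by blast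
      have "chi (insert b (X0 - {x})) \<in> M i" using opt_swap[OF it(1) _ X0_M[OF it(1)] x(2) b(2)] cl(2)[of b] b(1) by simp
      hence "f t \<bullet> chi (insert b (X0 - {x})) \<le> f i \<bullet> chi (insert b (X0 - {x}))" using it by (simp add: M_chi)
      moreover have "f s \<bullet> chi (insert b (X0 - {x})) = F s i - F s a" if "s \<in> I" for s
        using X0(2)[OF that] x b by (simp add: inner_chi sum_diff1 F[OF that])
      ultimately show ?thesis using it by simp
    qed simp
    show "F i (\<tau> i) - F t (\<tau> i) \<le> F i a - F t a"
    proof (cases "a = \<tau> i")
      case False
      have ti: "\<tau> i \<in> I" using cl(1) by (simp add: \<tau>_def)
      obtain x where x: "cl x = \<tau> i" "x \<in> X0" using m(1)[OF ti] by (force simp: m_def card_gt_0_iff)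
      have "\<not> {b. cl b = a} \<subseteq> X0" using m(2)[OF it(3)] by (auto simp: m_def dest: Int_absorb2)
      then obtain b where b: "cl b = a" "b \<notin> X0" by blast
      have "dopt i x" using tau[OF it(1), of x] x(1) dl(2)[of x] by simp
      hence "chi (insert b (X0 - {x})) \<in> M i" using dopt_swap[OF it(1) _ X0_M[OF it(1)] x(2) b(2)] by simp
      hence "f t \<bullet> chi (insert b (X0 - {x})) \<le> f i \<bullet> chi (insert b (X0 - {x}))" using it by (simp add: M_chi)
      moreover have "f s \<bullet> chi (insert b (X0 - {x})) = F s a - F s (\<tau> i)" if "s \<in> I" for s
        using X0(2)[OF that] x b by (simp add: inner_chi sum_diff1 F[OF that])
      ultimately show ?thesis using it by simp
    qed simp
  next
    fix \<alpha> c t assume *: "sum \<alpha> I = 0" "\<And>e. e \<in> I \<Longrightarrow> (\<Sum>t\<in>I. \<alpha> t * F t e) = c" "t \<in> I"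
    have "(\<Sum>t\<in>I. \<alpha> t *\<^sub>R f t) = c *\<^sub>R chi UNIV"
      using *(2) cl(1) by (simp add: vec_eq_iff sum_component F)
    hence "(- c) *\<^sub>R chi UNIV + (\<Sum>t\<in>I. \<alpha> t *\<^sub>R f t) = 0" by simp
    from combo_zero(2)[OF this] show "\<alpha> t = 0" using ind *(1,3) by blast
  next
    \<comment> \<open>An element of class \<open>e\<close> is added to the vertex of
      \<open>z\<close>. The cell containing the whole upper simplex is the wanted one, and the other
      cells at the vertex are compared with it on the remaining vertices of the simplex.\<close>
    fix z :: "'i \<Rightarrow> int" and e
    assume z1: "\<And>e. e \<in> I \<Longrightarrow> \<bar>z e\<bar> \<le> 1" and *: "sum z I = 0" "e \<in> I" "z e \<le> 0"
    obtain X where X: "card X = d" "\<forall>e\<in>I. int (card (X \<inter> {a. cl a = e})) = int (m e) + z e"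
      "J z = {t\<in>I. chi X \<in> M t}" using counts[OF _ *(1)] z1 by blast
    have "int (card (X \<inter> {a. cl a = e})) < int (card {a. cl a = e})" using bspec[OF X(2) *(2)] m(2)[OF *(2)] *(3) by linarith
    hence "\<not> {a. cl a = e} \<subseteq> X" by (auto dest: Int_absorb1)
    then obtain b where b: "cl b = e" "b \<notin> X" by blast
    have "card (insert b X) = Suc d" using X(1) b by simp
    then obtain l where l: "l \<in> I" "\<And>a. a \<in> insert b X \<Longrightarrow> chi (insert b X - {a}) \<in> M l" using upper_simplex by blast
    have "chi X \<in> M l" using l(2)[of b] b(2) by simp
    hence lJ: "l \<in> J z" using X(3) l(1) by simp
    show "\<exists>t\<in>J z. \<forall>m\<in>J z. \<forall>a\<in>I. 0 \<le> z a \<longrightarrow> F t a - F m a \<le> F t e - F m e"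
    proof (intro bexI[OF _ lJ] ballI impI)
      fix u a assume u: "u \<in> J z" "a \<in> I" "0 \<le> z a"
      have uI: "u \<in> I" "chi X \<in> M u" using u(1) X(3) by auto
      have "0 < int (card (X \<inter> {b. cl b = a}))" using bspec[OF X(2) u(2)] m(1)[OF u(2)] u(3) by linarith
      then obtain x where x: "x \<in> X" "cl x = a" by (force simp: card_gt_0_iff)
      have "chi (insert b X - {x}) \<in> M l" using l(2)[of x] x by simp
      hence "f u \<bullet> chi (insert b X - {x}) \<le> f l \<bullet> chi (insert b X - {x})" using uI by (simp add: M_chi)
      moreover have "f s \<bullet> chi (insert b X - {x}) = f s \<bullet> chi X + F s e - F s a" if "s \<in> I" for s
        using x b by (simp add: inner_chi sum_diff1 F[OF that])
      moreover have "f u \<bullet> chi X = f l \<bullet> chi X"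
        using uI \<open>chi X \<in> M l\<close> l(1) by (intro antisym) (auto simp: M_chi)
      ultimately show "F l a - F u a \<le> F l e - F u e" using uI l(1) by simp
    qed
  next
    fix z :: "'i \<Rightarrow> int" and e
    assume z1: "\<And>e. e \<in> I \<Longrightarrow> \<bar>z e\<bar> \<le> 1" and *: "sum z I = 0" "e \<in> I" "0 \<le> z e"
    obtain X where X: "card X = d" "\<forall>e\<in>I. int (card (X \<inter> {a. cl a = e})) = int (m e) + z e"
      "J z = {t\<in>I. chi X \<in> M t}" using counts[OF _ *(1)] z1 by blast
    have "0 < int (card (X \<inter> {a. cl a = e}))" using bspec[OF X(2) *(2)] m(1)[OF *(2)] *(3) by linarith
    then obtain b where b: "b \<in> X" "cl b = e" by (force simp: card_gt_0_iff)
    have "Suc (card (X - {b})) = d" using X(1) b d by simp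
    then obtain l where l: "l \<in> I" "\<And>a. a \<in> - (X - {b}) \<Longrightarrow> chi (insert a (X - {b})) \<in> M l" using lower_simplex by blast
    have "chi X \<in> M l" using l(2)[of b] b(1) by (simp add: insert_absorb)
    hence lJ: "l \<in> J z" using X(3) l(1) by simp
    show "\<exists>t\<in>J z. \<forall>m\<in>J z. \<forall>a\<in>I. z a \<le> 0 \<longrightarrow> F t e - F m e \<le> F t a - F m a"
    proof (intro bexI[OF _ lJ] ballI impI)
      fix u a assume u: "u \<in> J z" "a \<in> I" "z a \<le> 0"
      have uI: "u \<in> I" "chi X \<in> M u" using u(1) X(3) by auto
      have "int (card (X \<inter> {b. cl b = a})) < int (card {b. cl b = a})" using bspec[OF X(2) u(2)] m(2)[OF u(2)] u(3) by linarith
      hence "\<not> {b. cl b = a} \<subseteq> X" by (auto dest: Int_absorb1)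
      then obtain x where x: "x \<notin> X" "cl x = a" by blast
      have "chi (insert x (X - {b})) \<in> M l" using l(2)[of x] x by simp
      hence "f u \<bullet> chi (insert x (X - {b})) \<le> f l \<bullet> chi (insert x (X - {b}))" using uI by (simp add: M_chi)
      moreover have "f s \<bullet> chi (insert x (X - {b})) = f s \<bullet> chi X - F s e + F s a" if "s \<in> I" for s
        using x b by (simp add: inner_chi sum_diff1 F[OF that])
      moreover have "f u \<bullet> chi X = f l \<bullet> chi X"
        using uI \<open>chi X \<in> M l\<close> l(1) by (intro antisym) (auto simp: M_chi)
      ultimately show "F l e - F u e \<le> F l a - F u a" using uI l(1) by simp
    qed
  qed
  have "\<exists>\<delta> p. 0 < \<delta> \<and> bij_betw p I {1..card I} \<and> p e0 = card I \<and> (\<forall>t\<in>I. \<forall>u\<in>I. \<exists>c. \<forall>e\<in>I.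
      F t e - F u e = \<delta> * (of_bool (p e \<le> p t) - of_bool (p e \<le> p u)) + c)"
  proof (rule cyclic_order[OF e0 k])
    fix \<delta> p assume A: "0 < \<delta>" "bij_betw p I {1..card I}" "p e0 = card I"
      "\<And>t u. \<lbrakk>t \<in> I; u \<in> I\<rbrakk> \<Longrightarrow> \<exists>c. \<forall>e\<in>I. F t e - F u e = \<delta> * (of_bool (p e \<le> p t) - of_bool (p e \<le> p u)) + c"
    have "\<forall>t\<in>I. \<forall>u\<in>I. \<exists>c. \<forall>e\<in>I. F t e - F u e = \<delta> * (of_bool (p e \<le> p t) - of_bool (p e \<le> p u)) + c"
      by (intro ballI A(4))
    with A(1-3) show ?thesis by (intro exI[of _ \<delta>] exI[of _ p] conjI)
  qed
  then obtain \<delta> p where p: "0 < \<delta>" "bij_betw p I {1..card I}" "p e0 = card I"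
    "\<forall>t\<in>I. \<forall>u\<in>I. \<exists>c. \<forall>e\<in>I. F t e - F u e = \<delta> * (of_bool (p e \<le> p t) - of_bool (p e \<le> p u)) + c"
    by (elim exE conjE)
  define g where "g a = p (cl a)" for a
  define dd where "dd = (\<lambda>s\<in>{1..card I}. m (inv_into I p s))"
  have gr: "g a \<in> {1..card I}" for a using p(2) cl(1) by (auto simp: g_def bij_betw_def)
  have pinv: "inv_into I p s \<in> I" "p (inv_into I p s) = s" if "s \<in> {1..card I}" for s
    using p(2) that bij_betw_inv_into_right[OF p(2)] bij_betwE[OF bij_betw_inv_into[OF p(2)]] by auto
  have gs: "{a. g a = s} = {a. cl a = inv_into I p s}" if "s \<in> {1..card I}" for s
    using pinv[OF that] bij_betw_inv_into_left[OF p(2)] cl(1) by (auto simp: g_def)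
  have blk_dd: "(\<Sum>a | g a = s. x $ a) = real (dd s)"
    if s: "s \<in> {1..card I}" and x: "\<And>i. i \<in> I \<Longrightarrow> f i \<bullet> x = 0" "(\<Sum>a\<in>UNIV. x $ a) = real d" for s x
  proof -
    have "{a. g a = s} = blk (r (inv_into I p s))" using gs[OF s] r[OF pinv(1)[OF s]] blk by metis
    moreover have "{a. cl a = inv_into I p s} = {a. g a = s}" using gs[OF s] by simp
    ultimately show ?thesis using blk_sum[OF x] s by (simp add: dd_def m_def)
  qed
  have good: "(g, dd) \<in> block_data (card I) d"
  proof -
    have "(\<Sum>s=1..card I. dd s) = (\<Sum>s=1..card I. m (inv_into I p s))" by (intro sum.cong) (auto simp: dd_def)
    also have "\<dots> = (\<Sum>e\<in>I. m e)" by (rule sum.reindex_bij_betw[OF bij_betw_inv_into[OF p(2)]])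
    finally have "(\<Sum>s=1..card I. dd s) = d" using mtot by simp
    moreover have "0 < dd s \<and> dd s < card {a. g a = s}" if "s \<in> {1..card I}" for s
      using m[OF pinv(1)[OF that]] gs[OF that] that by (simp add: dd_def)
    ultimately show ?thesis using gr by (auto simp: block_data_def dd_def)
  qed
  have c0x: "excess g dd s x = (\<Sum>a | g a \<le> s. x $ a - c0 $ a)" if "s \<in> {1..card I}" for s x
  proof -
    have "(\<Sum>a | g a \<le> s. c0 $ a) = (\<Sum>u=1..s. \<Sum>a\<in>{a \<in> {a. g a \<le> s}. g a = u}. c0 $ a)"
      using gr by (intro sum.group[symmetric]) auto
    also have "\<dots> = (\<Sum>u=1..s. real (dd u))"
    proof (intro sum.cong refl)
      fix u assume u: "u \<in> {1..s}"
      hence "{a \<in> {a. g a \<le> s}. g a = u} = {a. g a = u}" by auto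
      thus "(\<Sum>a\<in>{a \<in> {a. g a \<le> s}. g a = u}. c0 $ a) = real (dd u)"
        using blk_dd[OF _ c0(4) hyp_sum[OF c0(1)], of u] u that by simp
    qed
    finally show ?thesis by (simp add: excess_def sum_subtractf)
  qed
  \<comment> \<open>The undetermined constant \<open>c\<close> is multiplied by the difference of
    two coordinate sums, both equal to \<open>d\<close>, and disappears.\<close>
  have diff: "f t \<bullet> x - f u \<bullet> x = \<delta> * (excess g dd (p t) x - excess g dd (p u) x)"
    if "t \<in> I" "u \<in> I" "x \<in> hypersimplex d" for t u x
  proof -
    obtain c where c: "\<And>e. e \<in> I \<Longrightarrow> F t e - F u e = \<delta> * (of_bool (p e \<le> p t) - of_bool (p e \<le> p u)) + c"
      using p(4) \<open>t \<in> I\<close> \<open>u \<in> I\<close> by blast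
    have pt: "p t \<in> {1..card I}" "p u \<in> {1..card I}" using p(2) that by (auto simp: bij_betw_def)
    have sel: "(\<Sum>a\<in>UNIV. of_bool (g a \<le> s) * (x $ a - c0 $ a)) = (\<Sum>a | g a \<le> s. x $ a - c0 $ a)" for s
      by (simp add: of_bool_def if_distrib[of "\<lambda>y. y * _"] sum.If_cases cong: if_cong)
    have "f t \<bullet> x - f u \<bullet> x = (f t - f u) \<bullet> (x - c0)"
      using c0(4) that by (simp add: inner_diff_left inner_diff_right)
    also have "\<dots> = (\<Sum>a\<in>UNIV. (F t (cl a) - F u (cl a)) * (x $ a - c0 $ a))"
      using that by (simp add: inner_vec_def F)
    also have "\<dots> = (\<Sum>a\<in>UNIV. (\<delta> * (of_bool (g a \<le> p t) - of_bool (g a \<le> p u)) + c) * (x $ a - c0 $ a))"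
      by (intro sum.cong refl) (simp add: c cl(1) g_def)
    also have "\<dots> = (\<Sum>a\<in>UNIV. \<delta> * (of_bool (g a \<le> p t) * (x $ a - c0 $ a))
        - \<delta> * (of_bool (g a \<le> p u) * (x $ a - c0 $ a)) + c * (x $ a - c0 $ a))"
      by (intro sum.cong refl) (simp add: algebra_simps)
    also have "\<dots> = \<delta> * (\<Sum>a\<in>UNIV. of_bool (g a \<le> p t) * (x $ a - c0 $ a))
        - \<delta> * (\<Sum>a\<in>UNIV. of_bool (g a \<le> p u) * (x $ a - c0 $ a)) + c * (\<Sum>a\<in>UNIV. x $ a - c0 $ a)"
      by (simp only: sum.distrib sum_subtractf sum_distrib_left right_diff_distrib)
    also have "\<dots> = \<delta> * excess g dd (p t) x - \<delta> * excess g dd (p u) x + c * ((\<Sum>a\<in>UNIV. x $ a) - (\<Sum>a\<in>UNIV. c0 $ a))"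
      unfolding sel c0x[OF pt(1)] c0x[OF pt(2)] by (simp only: sum_subtractf)
    finally show ?thesis using hyp_sum[OF that(3)] hyp_sum[OF c0(1)] by (simp add: right_diff_distrib)
  qed
  have "M i = block_cell (card I) d g dd (p i)" if i: "i \<in> I" for i
  proof -
    have "f t \<bullet> x \<le> f i \<bullet> x \<longleftrightarrow> excess g dd (p t) x \<le> excess g dd (p i) x" if "t \<in> I" "x \<in> hypersimplex d" for t x
      using diff[OF that(1) i that(2)] p(1) by (smt (verit) mult_le_0_iff)
    moreover have "{1..card I} = p ` I" using p(2) by (simp add: bij_betw_def)
    ultimately show ?thesis by (auto simp: M_def block_cell_def)
  qed
  thus thesis using that good p(2,3) by blast
qed

end

section \<open>From splits to fans\<close>

lemma nonneg_limit: fixes a b :: real assumes "\<And>\<eta>. 0 < \<eta> \<Longrightarrow> 0 \<le> a + \<eta> * b" shows "0 \<le> a"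
proof (rule ccontr)
  assume "\<not> 0 \<le> a"
  hence a: "a < 0" by simp
  show False
  proof (cases "b \<le> 0")
    case True
    have "0 \<le> a + 1 * b" by (rule assms) simp
    thus False using a True by linarith
  next
    case False
    have "0 \<le> a + (- a / (2 * b)) * b" using a False by (intro assms divide_pos_pos) auto
    thus False using a False by simp
  qed
qed

text \<open>The normals are given only up to positive factors; the point is to choose the factors so
  that \<open>g i j\<close> becomes a difference \<open>f i - f j\<close>. The ray of a cone that is
  off the facet towards \<open>t\<close> turns out to depend on \<open>t\<close> alone, and the
  values on these rays fix the scaling.\<close>

lemma fan_normals:
  fixes g :: "'i \<Rightarrow> 'i \<Rightarrow> 'a::euclidean_space"
  assumes fin: "finite I" and e0: "e0 \<in> I"
    and anti: "\<And>i j. \<lbrakk>i \<in> I; j \<in> I\<rbrakk> \<Longrightarrow> g i j = - g j i"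
    and cover: "\<And>z. \<exists>i\<in>I. \<forall>j\<in>I. 0 \<le> g i j \<bullet> z"
    and ind: "\<And>i \<alpha> j. \<lbrakk>i \<in> I; (\<Sum>j\<in>I - {i}. \<alpha> j *\<^sub>R g i j) = 0; j \<in> I - {i}\<rbrakk> \<Longrightarrow> \<alpha> j = 0"
    and ker: "\<And>i j z. \<lbrakk>i \<in> I; j \<in> I; \<forall>l\<in>I. g i l \<bullet> z = 0\<rbrakk> \<Longrightarrow> \<forall>l\<in>I. g j l \<bullet> z = 0"
  obtains f where "f e0 = 0" "\<forall>i\<in>I. \<forall>j\<in>I. \<exists>\<theta>>0. f i - f j = \<theta> *\<^sub>R g i j"
    "\<forall>\<alpha>. sum \<alpha> I = 0 \<longrightarrow> (\<Sum>i\<in>I. \<alpha> i *\<^sub>R f i) = 0 \<longrightarrow> (\<forall>i\<in>I. \<alpha> i = 0)"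
proof (cases "I = {e0}")
  case True
  have "g e0 e0 = - g e0 e0" using anti e0 by blast
  hence g0: "g e0 e0 = 0" by (simp add: eq_neg_iff_add_eq_0 flip: scaleR_2)
  show thesis
    by (rule that[of "\<lambda>_. 0"]) (use g0 True in \<open>auto intro: exI[of _ 1]\<close>)
next
  case False
  then obtain i1 where i1: "i1 \<in> I" "i1 \<noteq> e0" using e0 by blast
  have gii: "g i i = 0" if "i \<in> I" for i
  proof -
    have "g i i = - g i i" using anti that by blast
    thus ?thesis by (simp add: eq_neg_iff_add_eq_0 flip: scaleR_2)
  qed
  have anti': "g i j \<bullet> z = - (g j i \<bullet> z)" if "i \<in> I" "j \<in> I" for i j z
    using anti[OF that] by (metis inner_minus_left)
  have "\<exists>r. g i t \<bullet> r = 1 \<and> (\<forall>j\<in>I. j \<noteq> t \<longrightarrow> g i j \<bullet> r = 0)" if it: "i \<in> I" "t \<in> I" "i \<noteq> t" for i t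
  proof (rule dual_vector[of "I - {i}" t "g i"])
    show "\<alpha> j = 0" if "(\<Sum>j\<in>I - {i}. \<alpha> j *\<^sub>R g i j) = 0" "j \<in> I - {i}" for \<alpha> j by (rule ind[OF it(1) that])
    fix r assume r: "g i t \<bullet> r = 1" "\<And>j. \<lbrakk>j \<in> I - {i}; j \<noteq> t\<rbrakk> \<Longrightarrow> g i j \<bullet> r = 0"
    have "g i j \<bullet> r = 0" if "j \<in> I" "j \<noteq> t" for j using r(2)[of j] gii[OF it(1)] that by (cases "j = i") auto
    thus ?thesis using r(1) by blast
  qed (use fin that in auto)
  then obtain R where R1: "\<And>i t. \<lbrakk>i \<in> I; t \<in> I; i \<noteq> t\<rbrakk> \<Longrightarrow> g i t \<bullet> R i t = 1"
    and R0: "\<And>i t j. \<lbrakk>i \<in> I; t \<in> I; i \<noteq> t; j \<in> I; j \<noteq> t\<rbrakk> \<Longrightarrow> g i j \<bullet> R i t = 0" by metis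
  \<comment> \<open>The ray \<open>R i t\<close> lies in every cone \<open>s\<close> other than
    \<open>t\<close>. Pushed by \<epsilon> away from the other facets of cone \<open>i\<close> and
    by \<eta> across facet \<open>s\<close>, it can lie in no cone but \<open>s\<close>; then \<eta>
    and \<epsilon> tend to 0.\<close>
  have K: "0 \<le> g s l \<bullet> R i t" if it: "i \<in> I" "t \<in> I" "i \<noteq> t" and sl: "s \<in> I" "l \<in> I" "s \<noteq> t" for i t s l
  proof (cases "s = i")
    case True
    thus ?thesis using R1[OF it] R0[OF it, of l] sl(2) by (cases "l = t") auto
  next
    case False
    define S where "S = (\<Sum>u\<in>I - {i,s}. R i u)"
    have gS: "g i j \<bullet> S = of_bool (j \<noteq> i \<and> j \<noteq> s)" if "j \<in> I" for j
    proof -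
      have "g i j \<bullet> S = (\<Sum>u\<in>I - {i,s}. of_bool (u = j))"
        unfolding S_def inner_sum_right using R1 R0 it(1) that by (intro sum.cong) auto
      thus ?thesis using fin that by (simp add: of_bool_def)
    qed
    have "0 \<le> g s l \<bullet> R i t + \<epsilon> * (g s l \<bullet> S)" if \<epsilon>: "0 < \<epsilon>" for \<epsilon>
    proof (rule nonneg_limit[where b = "- (g s l \<bullet> R i s)"])
      fix \<eta> :: real assume \<eta>: "0 < \<eta>"
      define y where "y = R i t + \<epsilon> *\<^sub>R S - \<eta> *\<^sub>R R i s"
      have gy: "g j m \<bullet> y = g j m \<bullet> R i t + \<epsilon> * (g j m \<bullet> S) - \<eta> * (g j m \<bullet> R i s)" for j m
        by (simp add: y_def inner_add_right inner_diff_right)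
      obtain j where j: "j \<in> I" "\<And>m. m \<in> I \<Longrightarrow> 0 \<le> g j m \<bullet> y" using cover[of y] by blast
      have "g i s \<bullet> y = - \<eta>" using gS[OF sl(1)] R0[OF it sl(1)] R1[OF it(1) sl(1)] False sl(3) by (simp add: gy)
      hence "j \<noteq> i" using j(2)[OF sl(1)] \<eta> by auto
      have "j = s"
      proof (rule ccontr)
        assume "j \<noteq> s"
        hence "g i j \<bullet> y = g i j \<bullet> R i t + \<epsilon>"
          using gS[OF j(1)] R0[OF it(1) sl(1), of j] False \<open>j \<noteq> i\<close> j(1) by (simp add: gy)
        moreover have "0 \<le> g i j \<bullet> R i t" using R1[OF it] R0[OF it j(1)] by (cases "j = t") auto
        ultimately have "0 < g i j \<bullet> y" using \<epsilon> by linarith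
        moreover have "0 \<le> g j i \<bullet> y" using j(2) it(1) by blast
        ultimately show False using anti'[OF it(1) j(1), of y] by linarith
      qed
      thus "0 \<le> g s l \<bullet> R i t + \<epsilon> * (g s l \<bullet> S) + \<eta> * - (g s l \<bullet> R i s)" using j(2)[OF sl(2)] gy[of s l] by simp
    qed
    thus ?thesis by (rule nonneg_limit)
  qed
  \<comment> \<open>Any cone other than \<open>t\<close> may be used to define the ray
    \<open>r t\<close>; \<open>b\<close> picks one.\<close>
  define b where "b t = (if t = e0 then i1 else e0)" for t
  define r where "r t = R (b t) t" for t
  have b: "b t \<in> I" "b t \<noteq> t" for t using e0 i1 by (auto simp: b_def)
  have F1: "0 \<le> g s l \<bullet> r t" if "s \<in> I" "l \<in> I" "t \<in> I" "s \<noteq> t" for s l t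
    unfolding r_def using K[OF b(1) _ b(2)] that by blast
  have F2: "g s l \<bullet> r t = 0" if "s \<in> I" "l \<in> I" "t \<in> I" "s \<noteq> t" "l \<noteq> t" for s l t
    using F1[of s l t] F1[of l s t] anti'[of s l "r t"] that by simp
  have F3: "0 < g s t \<bullet> r t" if st: "s \<in> I" "t \<in> I" "s \<noteq> t" for s t
  proof (rule ccontr)
    assume "\<not> ?thesis"
    hence "g s t \<bullet> r t = 0" using F1[OF st(1,2,2,3)] by simp
    hence "\<forall>l\<in>I. g s l \<bullet> r t = 0" using F2 st by metis
    hence "g (b t) t \<bullet> r t = 0" using ker[OF st(1) b(1)[of t]] st(2) by blast
    thus False using R1[OF b(1) st(2) b(2)] by (simp add: r_def)
  qed
  \<comment> \<open>All \<open>f t\<close> with \<open>t \<noteq> e0\<close> get the value 1 on the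
    ray \<open>r e0\<close>, so their differences vanish there, as the normals \<open>g i j\<close>
    do.\<close>
  define \<mu>0 where "\<mu>0 t = 1 / (g t e0 \<bullet> r e0)" for t
  define f where "f t = (if t = e0 then 0 else \<mu>0 t *\<^sub>R g t e0)" for t
  have \<mu>pos: "0 < \<mu>0 t" if "t \<in> I" "t \<noteq> e0" for t using F3[OF that(1) e0 that(2)] by (simp add: \<mu>0_def)
  \<comment> \<open>Up to scaling, the rays \<open>r t\<close> with \<open>t \<noteq> i\<close> are
    dual to the normals of cone \<open>i\<close>, so they determine every form that vanishes on the
    common kernel.\<close>
  have expand: "h \<bullet> z = (\<Sum>t\<in>I - {i}. (g i t \<bullet> z / (g i t \<bullet> r t)) * (h \<bullet> r t))"
    if i: "i \<in> I" and h: "\<And>z. \<forall>l\<in>I. g i l \<bullet> z = 0 \<Longrightarrow> h \<bullet> z = 0" for i h z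
  proof -
    define y where "y = z - (\<Sum>t\<in>I - {i}. (g i t \<bullet> z / (g i t \<bullet> r t)) *\<^sub>R r t)"
    have "g i l \<bullet> y = 0" if l: "l \<in> I" for l
    proof (cases "l = i")
      case True thus ?thesis using gii[OF i] by simp
    next
      case False
      have "(\<Sum>t\<in>I - {i}. (g i t \<bullet> z / (g i t \<bullet> r t)) * (g i l \<bullet> r t)) = (\<Sum>t\<in>I - {i}. if t = l then g i l \<bullet> z else 0)"
      proof (intro sum.cong refl)
        fix t assume "t \<in> I - {i}"
        thus "(g i t \<bullet> z / (g i t \<bullet> r t)) * (g i l \<bullet> r t) = (if t = l then g i l \<bullet> z else 0)"
          using F2[of i l t] F3[of i t] i l by auto
      qed
      thus ?thesis using False l fin by (simp add: y_def inner_diff_right inner_sum_right)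
    qed
    hence "h \<bullet> y = 0" using h by blast
    thus ?thesis by (simp add: y_def inner_diff_right inner_sum_right)
  qed
  show thesis
  proof (rule that[of f])
    show "f e0 = 0" by (simp add: f_def)
    show "\<forall>i\<in>I. \<forall>j\<in>I. \<exists>\<theta>>0. f i - f j = \<theta> *\<^sub>R g i j"
    proof (intro ballI)
      fix i j assume ij: "i \<in> I" "j \<in> I"
      consider "i = j" | "i \<noteq> j" "j = e0" | "i \<noteq> j" "i = e0" | "i \<noteq> j" "i \<noteq> e0" "j \<noteq> e0" by blast
      thus "\<exists>\<theta>>0. f i - f j = \<theta> *\<^sub>R g i j"
      proof cases
        case 1 thus ?thesis using gii ij by (intro exI[of _ 1]) simp
      next
        case 2 thus ?thesis using \<mu>pos ij by (intro exI[of _ "\<mu>0 i"]) (simp add: f_def)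
      next
        case 3
        have "f i - f j = - (\<mu>0 j *\<^sub>R g j i)" using 3 by (simp add: f_def)
        also have "\<dots> = \<mu>0 j *\<^sub>R g i j" using anti[OF ij] by simp
        finally show ?thesis using \<mu>pos[OF ij(2)] 3 by blast
      next
        case 4
        define h where "h = f i - f j"
        have hz: "h \<bullet> z = \<mu>0 i * (g i e0 \<bullet> z) - \<mu>0 j * (g j e0 \<bullet> z)" for z
          using 4 by (simp add: h_def f_def inner_diff_left)
        have hker: "h \<bullet> z = 0" if "\<forall>l\<in>I. g i l \<bullet> z = 0" for z
          using that ker[OF ij that] e0 by (simp add: hz)
        have hr: "h \<bullet> r t = 0" if t: "t \<in> I" "t \<noteq> i" "t \<noteq> j" for t
        proof (cases "t = e0")
          case True
          thus ?thesis using F3[OF ij(1) e0 4(2)] F3[OF ij(2) e0 4(3)] by (simp add: hz \<mu>0_def)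
        next
          case False
          thus ?thesis using F2[of i e0 t] F2[of j e0 t] t ij e0 by (simp add: hz)
        qed
        have hrj: "0 < h \<bullet> r j"
        proof -
          have "g i e0 \<bullet> r j = 0" using F2[of i e0 j] ij e0 4 by simp
          moreover have "0 < - (g j e0 \<bullet> r j)" using F3[of e0 j] anti'[of e0 j "r j"] ij e0 4 by simp
          hence "0 < \<mu>0 j * - (g j e0 \<bullet> r j)" using \<mu>pos[OF ij(2) 4(3)] by (intro mult_pos_pos)
          ultimately show ?thesis by (simp add: hz)
        qed
        define \<theta> where "\<theta> = (h \<bullet> r j) / (g i j \<bullet> r j)"
        have "0 < \<theta>" unfolding \<theta>_def using hrj F3[OF ij 4(1)] by (rule divide_pos_pos)
        moreover have "h = \<theta> *\<^sub>R g i j"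
        proof (rule vector_eq_rdot[THEN iffD1], rule allI)
          fix z
          have "h \<bullet> z = (\<Sum>t\<in>I - {i}. (g i t \<bullet> z / (g i t \<bullet> r t)) * (h \<bullet> r t))"
            using ij(1) hker by (rule expand)
          also have "\<dots> = (\<Sum>t\<in>{j}. (g i t \<bullet> z / (g i t \<bullet> r t)) * (h \<bullet> r t))"
            using ij 4 fin hr by (intro sum.mono_neutral_right) auto
          finally show "h \<bullet> z = (\<theta> *\<^sub>R g i j) \<bullet> z" by (simp add: \<theta>_def)
        qed
        ultimately show ?thesis unfolding h_def by blast
      qed
    qed
    show "\<forall>\<alpha>. sum \<alpha> I = 0 \<longrightarrow> (\<Sum>i\<in>I. \<alpha> i *\<^sub>R f i) = 0 \<longrightarrow> (\<forall>i\<in>I. \<alpha> i = 0)"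
    proof (intro allI impI)
      fix \<alpha> assume \<alpha>: "sum \<alpha> I = 0" "(\<Sum>i\<in>I. \<alpha> i *\<^sub>R f i) = 0"
      have split: "sum h I = h e0 + sum h (I - {e0})" for h :: "'i \<Rightarrow> 'x::comm_monoid_add" using fin e0 by (intro sum.remove)
      have "(\<Sum>i\<in>I - {e0}. - (\<alpha> i * \<mu>0 i) *\<^sub>R g e0 i) = (\<Sum>i\<in>I - {e0}. \<alpha> i *\<^sub>R f i)"
      proof (intro sum.cong refl)
        fix i assume i: "i \<in> I - {e0}"
        have "g e0 i = - g i e0" using anti e0 i by blast
        thus "- (\<alpha> i * \<mu>0 i) *\<^sub>R g e0 i = \<alpha> i *\<^sub>R f i" using i by (simp add: f_def)
      qed
      hence z: "(\<Sum>i\<in>I - {e0}. - (\<alpha> i * \<mu>0 i) *\<^sub>R g e0 i) = 0" using \<alpha>(2) by (simp add: split f_def)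
      have nz: "\<alpha> i = 0" if "i \<in> I - {e0}" for i
        using ind[of e0 "\<lambda>i. - (\<alpha> i * \<mu>0 i)" i, OF e0 z that] \<mu>pos[of i] that by auto
      hence "\<alpha> e0 = 0" using \<alpha>(1) by (simp add: split)
      thus "\<forall>i\<in>I. \<alpha> i = 0" using nz by blast
    qed
  qed
qed

section \<open>Vertices and interior points of the hypersimplex\<close>

lemma fractional_partner:
  fixes x :: "'a \<Rightarrow> real"
  assumes A: "finite A" "a \<in> A" and s: "(\<Sum>b\<in>A. x b) \<in> \<int>" and a: "0 < x a" "x a < 1"
    and x: "\<And>b. b \<in> A \<Longrightarrow> 0 \<le> x b \<and> x b \<le> 1"
  shows "\<exists>b\<in>A. b \<noteq> a \<and> 0 < x b \<and> x b < 1"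
proof (rule ccontr)
  assume n: "\<not> ?thesis"
  have "x b \<in> \<int>" if b: "b \<in> A - {a}" for b
  proof -
    have "x b = 0 \<or> x b = 1" using n x[of b] b by force
    thus ?thesis by auto
  qed
  hence "(\<Sum>b\<in>A - {a}. x b) \<in> \<int>" by (rule Ints_sum)
  moreover have "(\<Sum>b\<in>A. x b) = x a + (\<Sum>b\<in>A - {a}. x b)" using A by (rule sum.remove)
  ultimately have "x a \<in> \<int>" using s by (metis Ints_diff add_diff_cancel_right')
  then obtain z :: int where "x a = of_int z" by (elim Ints_cases)
  thus False using a by simp
qed

lemma in_open_segment_mid:
  fixes p :: "'a::real_vector"
  assumes "w \<noteq> 0" shows "p \<in> open_segment (p - w) (p + w)"
  unfolding in_segment
proof (intro conjI exI[of _ "1/2"])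
  have "w + w \<noteq> 0" using assms by (metis scaleR_2 scaleR_eq_0_iff zero_neq_numeral)
  thus "p - w \<noteq> p + w" by (metis add_diff_cancel_left' diff_diff_eq2 diff_self)
  show "p = (1 - 1 / 2) *\<^sub>R (p - w) + (1 / 2) *\<^sub>R (p + w)"
    by (simp add: algebra_simps flip: scaleR_add_left)
qed auto

lemma shift_mass:
  fixes v :: "real ^ 'n::finite"
  assumes v: "v \<in> hypersimplex d" and ab: "a \<noteq> b" "0 < v $ a" "v $ a < 1" "0 < v $ b" "v $ b < 1"
  obtains \<epsilon> where "0 < \<epsilon>" "\<And>\<eta>. \<bar>\<eta>\<bar> \<le> \<epsilon> \<Longrightarrow> v + \<eta> *\<^sub>R coord_diff a b \<in> hypersimplex d"
proof -
  define \<epsilon> where "\<epsilon> = min (min (v $ a) (1 - v $ a)) (min (v $ b) (1 - v $ b))"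
  have "0 < \<epsilon>" using ab by (simp add: \<epsilon>_def)
  moreover have "v + \<eta> *\<^sub>R coord_diff a b \<in> hypersimplex d" if \<eta>: "\<bar>\<eta>\<bar> \<le> \<epsilon>" for \<eta>
  proof -
    have "0 \<le> (v + \<eta> *\<^sub>R coord_diff a b) $ c \<and> (v + \<eta> *\<^sub>R coord_diff a b) $ c \<le> 1" for c
      using \<eta> ab v by (cases "c = a"; cases "c = b") (auto simp: coord_diff_nth \<epsilon>_def hypersimplex_def abs_le_iff)
    moreover have "(\<Sum>c\<in>UNIV. (v + \<eta> *\<^sub>R coord_diff a b) $ c) = real d"
      using v coord_diff_sum[of a b] by (simp add: hypersimplex_def sum.distrib sum_distrib_left[symmetric])
    ultimately show ?thesis by (simp add: hypersimplex_def)
  qed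
  ultimately show thesis by (rule that)
qed

lemma coord_diff_nonzero: "a \<noteq> b \<Longrightarrow> coord_diff a b \<noteq> 0"
  using coord_diff_nth(1)[of a b] by (metis one_neq_zero zero_index)

text \<open>The coordinate sum is an integer, so a fractional coordinate has a fractional partner,
  and mass can be moved between the two in both directions.\<close>

lemma hypersimplex_extreme:
  fixes v :: "real ^ 'n::finite"
  assumes v: "v extreme_point_of hypersimplex d"
  shows "v $ a \<in> {0,1}"
proof (rule ccontr)
  assume "v $ a \<notin> {0,1}"
  have vP: "v \<in> hypersimplex d" using v by (simp add: extreme_point_of_def)
  have v01: "0 \<le> v $ b \<and> v $ b \<le> 1" for b using vP by (simp add: hypersimplex_def)
  have a: "0 < v $ a" "v $ a < 1" using \<open>v $ a \<notin> {0,1}\<close> v01[of a] by auto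
  have "(\<Sum>b\<in>UNIV. v $ b) \<in> \<int>" using vP by (simp add: hypersimplex_def)
  then obtain b where b: "b \<noteq> a" "0 < v $ b" "v $ b < 1"
    using fractional_partner[of UNIV a "\<lambda>b. v $ b"] a v01 by auto
  obtain \<epsilon> where \<epsilon>: "0 < \<epsilon>" "\<And>\<eta>. \<bar>\<eta>\<bar> \<le> \<epsilon> \<Longrightarrow> v + \<eta> *\<^sub>R coord_diff a b \<in> hypersimplex d"
    using shift_mass[OF vP b(1)[symmetric] a b(2,3)] by metis
  have "v - \<epsilon> *\<^sub>R coord_diff a b \<in> hypersimplex d" "v + \<epsilon> *\<^sub>R coord_diff a b \<in> hypersimplex d"
    using \<epsilon>(2)[of "- \<epsilon>"] \<epsilon>(2)[of \<epsilon>] \<epsilon>(1) by simp_all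
  moreover have "v \<in> open_segment (v - \<epsilon> *\<^sub>R coord_diff a b) (v + \<epsilon> *\<^sub>R coord_diff a b)"
    using \<epsilon>(1) coord_diff_nonzero[OF b(1)[symmetric]] by (intro in_open_segment_mid) simp
  ultimately show False using v by (auto simp: extreme_point_of_def)
qed

text \<open>This hyperplane misses the origin for positive \<open>d\<close>, so affine dimension
  inside it is linear dimension minus one. Full dimension of a cell can then be expressed as
  \<open>dim = CARD('n)\<close>.\<close>

definition hplane :: "nat \<Rightarrow> (real ^ 'n::finite) set" where "hplane d = {x. chi UNIV \<bullet> x = real d}"

lemma ones_inner: "chi UNIV \<bullet> x = (\<Sum>a\<in>UNIV. x $ a)" for x :: "real ^ 'n::finite"
  by (simp add: inner_vec_def)

lemma ones_nonzero: "(chi UNIV :: real ^ 'n::finite) \<noteq> 0" by (simp add: vec_eq_iff)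

lemma hypersimplex_hplane: "hypersimplex d \<subseteq> hplane d"
  by (auto simp: hypersimplex_def hplane_def ones_inner)

lemma dim_in_hplane:
  fixes S :: "(real ^ 'n::finite) set"
  assumes S: "S \<subseteq> hplane d" and d: "0 < d"
  shows "int (dim S) = aff_dim S + 1"
proof -
  have "affine hull S \<subseteq> hplane d"
    using S unfolding hplane_def by (intro hull_minimal affine_hyperplane)
  hence "0 \<notin> affine hull S" using d by (auto simp: hplane_def)
  hence "aff_dim (insert 0 S) = aff_dim S + 1" by (simp add: aff_dim_insert)
  moreover have "aff_dim (insert 0 S) = int (dim (insert 0 S))" by (intro aff_dim_zero hull_inc) simp
  moreover have "dim (insert 0 S) = dim S" by (metis dim_span span_insert_0)
  ultimately show ?thesis by simp
qed

lemma affine_hull_full: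
  fixes S :: "(real ^ 'n::finite) set"
  assumes S: "S \<subseteq> hplane d" and d: "0 < d" and full: "dim S = CARD('n)"
  shows "affine hull S = hplane d"
proof (rule affine_dim_equal)
  have "S \<noteq> {}" using full by auto
  thus "affine hull S \<noteq> {}" by simp
  show "affine hull S \<subseteq> hplane d" using S unfolding hplane_def by (intro hull_minimal affine_hyperplane)
  show "affine (hplane d :: (real ^ 'n) set)" by (simp add: hplane_def affine_hyperplane)
  have "aff_dim (hplane d :: (real ^ 'n) set) = CARD('n) - 1"
    unfolding hplane_def by (subst aff_dim_hyperplane) (auto simp: ones_nonzero)
  thus "aff_dim (affine hull S) = aff_dim (hplane d :: (real ^ 'n) set)" using dim_in_hplane[OF S d] full by simp
qed simp

definition ctr :: "nat \<Rightarrow> real ^ 'n::finite" where "ctr d = (real d / real CARD('n)) *\<^sub>R chi UNIV"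

lemma ctr:
  assumes "0 < d" "d < CARD('n)"
  shows "(ctr d :: real ^ 'n::finite) \<in> hypersimplex d" "0 < (ctr d :: real ^ 'n) $ a" "(ctr d :: real ^ 'n) $ a < 1"
  using assms by (auto simp: ctr_def hypersimplex_def)

lemma proj_sum:
  fixes c z :: "real ^ 'n::finite"
  assumes "c \<in> hypersimplex d" "0 < d"
  shows "(\<Sum>a\<in>UNIV. (z - ((\<Sum>a\<in>UNIV. z $ a) / d) *\<^sub>R c) $ a) = 0"
proof -
  have "(\<Sum>a\<in>UNIV. (z - ((\<Sum>a\<in>UNIV. z $ a) / d) *\<^sub>R c) $ a) = (\<Sum>a\<in>UNIV. z $ a) - ((\<Sum>a\<in>UNIV. z $ a) / d) * (\<Sum>a\<in>UNIV. c $ a)"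
    by (simp only: vector_minus_component vector_scaleR_component sum_subtractf sum_distrib_left real_scaleR_def)
  thus ?thesis using assms by (simp add: hypersimplex_def)
qed

lemma near_exists:
  fixes c z :: "real ^ 'n::finite"
  assumes "c \<in> hypersimplex d" "\<And>a. 0 < c $ a" "\<And>a. c $ a < 1" "(\<Sum>a\<in>UNIV. z $ a) = 0"
  shows "\<exists>\<epsilon>>0. \<forall>\<eta>. \<bar>\<eta>\<bar> \<le> \<epsilon> \<longrightarrow> c + \<eta> *\<^sub>R z \<in> hypersimplex d"
proof -
  obtain \<epsilon>1 where e1: "0 < \<epsilon>1" "\<And>\<eta>. \<lbrakk>0 < \<eta>; \<eta> \<le> \<epsilon>1\<rbrakk> \<Longrightarrow> c + \<eta> *\<^sub>R z \<in> hypersimplex d"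
    by (rule hypersimplex_near[OF assms]) blast
  have "(\<Sum>a\<in>UNIV. (- z) $ a) = 0" using assms(4) by (simp add: sum_negf)
  from hypersimplex_near[OF assms(1-3) this]
  obtain \<epsilon>2 where e2: "0 < \<epsilon>2" "\<And>\<eta>. \<lbrakk>0 < \<eta>; \<eta> \<le> \<epsilon>2\<rbrakk> \<Longrightarrow> c + \<eta> *\<^sub>R - z \<in> hypersimplex d" by metis
  have "c + \<eta> *\<^sub>R z \<in> hypersimplex d" if "\<bar>\<eta>\<bar> \<le> min \<epsilon>1 \<epsilon>2" for \<eta>
  proof (cases "\<eta> = 0")
    case False
    thus ?thesis using e1(2)[of \<eta>] e2(2)[of "- \<eta>"] that by (cases "0 < \<eta>") auto
  qed (use assms in simp)
  thus ?thesis using e1(1) e2(1) by (intro exI[of _ "min \<epsilon>1 \<epsilon>2"]) simp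
qed

lemma dim_hypersimplex:
  assumes d: "0 < d" "d < CARD('n)"
  shows "dim (hypersimplex d :: (real ^ 'n::finite) set) = CARD('n)"
proof -
  let ?P = "hypersimplex d :: (real ^ 'n) set"
  let ?c = "ctr d :: real ^ 'n"
  have "z \<in> span ?P" for z :: "real ^ 'n"
  proof -
    let ?y = "z - ((\<Sum>a\<in>UNIV. z $ a) / d) *\<^sub>R ?c"
    obtain \<epsilon> where \<epsilon>: "0 < \<epsilon>" "\<forall>\<eta>. \<bar>\<eta>\<bar> \<le> \<epsilon> \<longrightarrow> ?c + \<eta> *\<^sub>R ?y \<in> ?P"
      using near_exists[OF ctr[OF d] proj_sum[OF ctr(1)[OF d] d(1)], of z] by blast
    have "?c + \<epsilon> *\<^sub>R ?y \<in> ?P" using \<epsilon> by simp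
    hence "(?c + \<epsilon> *\<^sub>R ?y) - ?c \<in> span ?P" using ctr(1)[OF d] by (intro span_diff span_base)
    hence "(1 / \<epsilon>) *\<^sub>R ((?c + \<epsilon> *\<^sub>R ?y) - ?c) \<in> span ?P" by (rule span_scale)
    hence "?y \<in> span ?P" using \<epsilon>(1) by simp
    moreover have "((\<Sum>a\<in>UNIV. z $ a) / d) *\<^sub>R ?c \<in> span ?P" using ctr(1)[OF d] by (intro span_scale span_base)
    ultimately have "?y + ((\<Sum>a\<in>UNIV. z $ a) / d) *\<^sub>R ?c \<in> span ?P" by (rule span_add)
    thus ?thesis by simp
  qed
  hence "span ?P = UNIV" by blast
  hence "dim ?P = dim (UNIV :: (real ^ 'n) set)" by (metis dim_span)
  thus ?thesis by simp
qed

lemma prolong: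
  fixes S :: "'a::euclidean_space set"
  assumes "convex S" "z \<in> rel_interior S" "x \<in> S"
  obtains e where "0 < e" "z - e *\<^sub>R (x - z) \<in> S"
proof -
  obtain e where e: "1 < e" "(1 - e) *\<^sub>R x + e *\<^sub>R z \<in> S"
    using convex_rel_interior_if2[OF assms(1,2)] hull_inc[OF assms(3)] by blast
  have "(1 - e) *\<^sub>R x + e *\<^sub>R z = z - (e - 1) *\<^sub>R (x - z)" by (simp add: algebra_simps)
  thus thesis using that[of "e - 1"] e by simp
qed

lemma rel_interior_hypersimplex:
  fixes x :: "real ^ 'n::finite"
  assumes d: "0 < d" "d < CARD('n)" and x: "x \<in> rel_interior (hypersimplex d)"
  shows "0 < x $ a" "x $ a < 1"
proof -
  obtain e where e: "0 < e" "x - e *\<^sub>R (ctr d - x) \<in> hypersimplex d"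
    using prolong[OF convex_hypersimplex x ctr(1)[OF d]] by blast
  have xP: "0 \<le> x $ a" "x $ a \<le> 1" using x rel_interior_subset by (auto simp: hypersimplex_def)
  have b: "0 \<le> x $ a - e * (ctr d $ a - x $ a)" "x $ a - e * (ctr d $ a - x $ a) \<le> 1"
    using e(2) by (auto simp: hypersimplex_def)
  show "0 < x $ a"
  proof (rule ccontr)
    assume "\<not> 0 < x $ a"
    hence "x $ a = 0" using xP by simp
    hence "e * ctr d $ a \<le> 0" using b(1) by simp
    thus False using e(1) ctr(2)[OF d, of a] by (simp add: mult_le_0_iff)
  qed
  show "x $ a < 1"
  proof (rule ccontr)
    assume "\<not> x $ a < 1"
    hence "x $ a = 1" using xP by simp
    hence "0 \<le> e * (ctr d $ a - 1)" using b(2) by simp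
    thus False using e(1) ctr(3)[OF d, of a] by (simp add: zero_le_mult_iff)
  qed
qed

lemma interior_dense:
  fixes x :: "real ^ 'n::finite"
  assumes d: "0 < d" "d < CARD('n)" and x: "x \<in> hypersimplex d" and U: "open U" "x \<in> U"
  obtains y where "y \<in> U" "y \<in> hypersimplex d" "\<And>a. 0 < y $ a" "\<And>a. y $ a < 1"
proof -
  let ?c = "ctr d :: real ^ 'n"
  obtain r where r: "0 < r" "ball x r \<subseteq> U" using U open_contains_ball by blast
  define \<eta> where "\<eta> = min 1 (r / (2 * (1 + norm (?c - x))))"
  have n: "0 < 1 + norm (?c - x)" using norm_ge_zero[of "?c - x"] by linarith
  have \<eta>: "0 < \<eta>" "\<eta> \<le> 1" "\<eta> \<le> r / (2 * (1 + norm (?c - x)))" using r n by (auto simp: \<eta>_def)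
  define y where "y = x + \<eta> *\<^sub>R (?c - x)"
  have half: "r / (2 * N) * N = r / 2" if "0 < N" for N :: real using that by simp
  have "dist x y = \<eta> * norm (?c - x)" using \<eta> by (simp add: y_def dist_norm)
  also have "\<dots> \<le> r / (2 * (1 + norm (?c - x))) * (1 + norm (?c - x))" using \<eta> n r by (intro mult_mono) auto
  also have "\<dots> = r / 2" by (rule half[OF n])
  also have "\<dots> < r" using r by simp
  finally have "y \<in> U" using r by auto
  have ya: "y $ a = (1 - \<eta>) * x $ a + \<eta> * ?c $ a" for a by (simp add: y_def algebra_simps)
  have xa: "0 \<le> x $ a" "x $ a \<le> 1" for a using x by (auto simp: hypersimplex_def)
  have y0: "0 < y $ a" for a
    unfolding ya using xa \<eta> ctr(2)[OF d, of a] by (intro add_nonneg_pos mult_nonneg_nonneg mult_pos_pos) auto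
  have y1: "y $ a < 1" for a
  proof -
    have "(1 - \<eta>) * x $ a \<le> (1 - \<eta>) * 1" using xa \<eta> by (intro mult_left_mono) auto
    moreover have "\<eta> * ?c $ a < \<eta> * 1" using \<eta> ctr(3)[OF d, of a] by (intro mult_strict_left_mono) auto
    ultimately show ?thesis using ya[of a] by simp
  qed
  have "y = (1 - \<eta>) *\<^sub>R x + \<eta> *\<^sub>R ?c" by (simp add: y_def algebra_simps)
  hence "y \<in> hypersimplex d"
    using convexD[OF convex_hypersimplex x ctr(1)[OF d], of "1 - \<eta>" \<eta>] \<eta> by simp
  thus thesis using that \<open>y \<in> U\<close> y0 y1 by blast
qed

section \<open>Maximal cells: full dimension and separation\<close>

lemma cell_below_maximal:
  assumes "finite \<Sigma>" "C \<in> \<Sigma>" obtains M where "M \<in> maximal_cells \<Sigma>" "C \<subseteq> M"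
proof -
  obtain M where "M \<in> \<Sigma>" "C \<subseteq> M" "\<forall>b\<in>\<Sigma>. M \<subseteq> b \<longrightarrow> M = b" using finite_has_maximal2[OF assms] by blast
  thus thesis by (intro that[of M]) (auto simp: maximal_cells_def)
qed

text \<open>Near a point outside all full-dimensional cells the hypersimplex would be covered by
  lower-dimensional ones. Coning from the origin turns this into a nonempty open set of the whole
  space covered by finitely many proper subspaces, which are negligible.\<close>

lemma full_cells_cover:
  fixes \<Sigma> :: "(real ^ 'n::finite) set set"
  assumes d: "0 < d" "d < CARD('n)" and sub: "subdivision (hypersimplex d) \<Sigma>" and x: "x \<in> hypersimplex d"
  shows "\<exists>D\<in>\<Sigma>. x \<in> D \<and> dim D = CARD('n)"
proof (rule ccontr)
  assume no: "\<not> ?thesis"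
  define Fl where "Fl = {D \<in> \<Sigma>. dim D = CARD('n)}"
  have fin: "finite \<Sigma>" and poly: "\<And>D. D \<in> \<Sigma> \<Longrightarrow> polytope D" and un: "\<Union>\<Sigma> = hypersimplex d"
    using sub by (auto simp: subdivision_def)
  have "closed (\<Union>Fl)" using fin poly by (intro closed_Union) (auto simp: Fl_def polytope_imp_closed)
  hence "open (- \<Union>Fl)" by (simp add: open_Compl)
  moreover have "x \<in> - \<Union>Fl" using no by (auto simp: Fl_def)
  ultimately obtain y where y: "y \<in> - \<Union>Fl" "y \<in> hypersimplex d" "\<And>a. 0 < y $ a" "\<And>a. y $ a < 1"
    using interior_dense[OF d x] by metis
  define \<sigma> where "\<sigma> z = (\<Sum>a\<in>UNIV. z $ a)" for z :: "real ^ 'n"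
  \<comment> \<open>Radial projection onto the hyperplane of coordinate sum
    \<open>d\<close>.\<close>
  define N where "N z = (real d / \<sigma> z) *\<^sub>R z" for z :: "real ^ 'n"
  define T where "T = - \<Union>Fl \<inter> (\<Inter>a. {z :: real ^ 'n. 0 < z $ a} \<inter> {z. z $ a < 1})"
  have "open (\<Inter>a. {z :: real ^ 'n. 0 < z $ a} \<inter> {z. z $ a < 1})"
    by (intro open_INT ballI open_Int open_Collect_less continuous_intros) auto
  hence "open T" using \<open>open (- \<Union>Fl)\<close> by (simp add: T_def open_Int)
  have "open {z. 0 < \<sigma> z}" unfolding \<sigma>_def by (intro open_Collect_less continuous_intros)
  moreover have "continuous_on {z. 0 < \<sigma> z} N" unfolding N_def \<sigma>_def by (intro continuous_intros) auto
  ultimately have "open ({z. 0 < \<sigma> z} \<inter> N -` T)" using \<open>open T\<close> by (intro continuous_open_preimage)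
  moreover have "y \<in> {z. 0 < \<sigma> z} \<inter> N -` T"
  proof -
    have "\<sigma> y = real d" using y(2) by (simp add: \<sigma>_def hypersimplex_def)
    thus ?thesis using y d by (auto simp: N_def T_def)
  qed
  ultimately have "\<not> negligible ({z. 0 < \<sigma> z} \<inter> N -` T)" by (intro open_not_negligible) auto
  moreover have "negligible (\<Union>(span ` {D \<in> \<Sigma>. dim D < CARD('n)}))"
    using fin by (intro negligible_Union) (auto intro!: negligible_lowdim)
  moreover have "{z. 0 < \<sigma> z} \<inter> N -` T \<subseteq> \<Union>(span ` {D \<in> \<Sigma>. dim D < CARD('n)})"
  proof
    fix z assume "z \<in> {z. 0 < \<sigma> z} \<inter> N -` T"
    hence z: "0 < \<sigma> z" "N z \<in> T" by auto
    have "(\<Sum>a\<in>UNIV. N z $ a) = (real d / \<sigma> z) * \<sigma> z" unfolding N_def \<sigma>_def by (simp add: sum_distrib_left)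
    hence "(\<Sum>a\<in>UNIV. N z $ a) = real d" using z(1) by simp
    moreover have "0 \<le> N z $ a \<and> N z $ a \<le> 1" for a using z(2) by (auto simp: T_def less_imp_le)
    ultimately have "N z \<in> hypersimplex d" by (simp add: hypersimplex_def)
    then obtain D where D: "D \<in> \<Sigma>" "N z \<in> D" using un by blast
    have "D \<notin> Fl" using z(2) D(2) by (auto simp: T_def)
    hence "dim D < CARD('n)" using D(1) dim_subset_UNIV_cart[of D] by (auto simp: Fl_def)
    moreover have "z = (\<sigma> z / d) *\<^sub>R N z" using z(1) d by (simp add: N_def)
    hence "z \<in> span D" using D(2) by (metis span_base span_scale)
    ultimately show "z \<in> \<Union>(span ` {D \<in> \<Sigma>. dim D < CARD('n)})" using D(1) by blast
  qed
  ultimately show False using negligible_subset by blast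
qed

lemma subdivision_cellD:
  assumes "subdivision P \<Sigma>" "M \<in> \<Sigma>"
  shows "M \<subseteq> P" "polytope M" "convex M" "closed M" "compact M"
  using assms by (auto simp: subdivision_def polytope_imp_convex polytope_imp_closed polytope_imp_compact)

lemma face_inter_subset:
  assumes "subdivision P \<Sigma>" "M \<in> \<Sigma>" "D \<in> \<Sigma>" "x \<in> rel_interior M" "x \<in> D"
  shows "M \<subseteq> D"
proof -
  have face: "(M \<inter> D) face_of M" using assms(1-3) by (auto simp: subdivision_def)
  have "x \<in> M" using assms(4) rel_interior_subset by blast
  hence "M \<inter> D \<inter> rel_interior M \<noteq> {}" using assms(4,5) by blast
  from subset_of_face_of[OF face subset_refl this] show ?thesis by blast
qed

text \<open>A full-dimensional cell through a relative interior point of \<open>M\<close> contains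
  \<open>M\<close>.\<close>

lemma maximal_cell_full:
  fixes \<Sigma> :: "(real ^ 'n::finite) set set"
  assumes d: "0 < d" "d < CARD('n)" and sub: "subdivision (hypersimplex d) \<Sigma>" and M: "M \<in> maximal_cells \<Sigma>"
  shows "dim M = CARD('n)"
proof -
  have MS: "M \<in> \<Sigma>" using M by (simp add: maximal_cells_def)
  have conv: "convex M" using sub MS by (auto simp: subdivision_def polytope_imp_convex)
  obtain D0 where D0: "D0 \<in> \<Sigma>" "ctr d \<in> D0"
  proof -
    have "ctr d \<in> \<Union>\<Sigma>" using sub ctr(1)[OF d] by (simp add: subdivision_def)
    thus thesis using that by blast
  qed
  have "M \<noteq> {}"
  proof
    assume "M = {}"
    hence "D0 = {}" using M D0(1) by (auto simp: maximal_cells_def)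
    thus False using D0 by blast
  qed
  then obtain x where x: "x \<in> rel_interior M" using rel_interior_eq_empty[OF conv] by blast
  have "x \<in> hypersimplex d" using x subdivision_cellD(1)[OF sub MS] rel_interior_subset by blast
  then obtain D where D: "D \<in> \<Sigma>" "x \<in> D" "dim D = CARD('n)" using full_cells_cover[OF d sub] by blast
  have "M \<subseteq> D" using face_inter_subset[OF sub MS D(1) x D(2)] .
  hence "D = M" using M D(1) by (auto simp: maximal_cells_def)
  thus ?thesis using D(3) by simp
qed

text \<open>Distinct maximal cells have disjoint relative interiors. Taking the normal in the affine
  hull of the difference set gives it coordinate sum 0, which excludes multiples of the all-ones
  vector; these would separate nothing inside the hyperplane.\<close>

lemma separate_cells:
  fixes \<Sigma> :: "(real ^ 'n::finite) set set"
  assumes d: "0 < d" "d < CARD('n)" and sub: "subdivision (hypersimplex d) \<Sigma>"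
    and M: "M \<in> maximal_cells \<Sigma>" "D \<in> maximal_cells \<Sigma>" "M \<noteq> D"
  shows "\<exists>a. a \<noteq> 0 \<and> chi UNIV \<bullet> a = 0 \<and> (\<forall>x\<in>M. \<forall>y\<in>D. a \<bullet> y \<le> a \<bullet> x)"
proof -
  have S: "M \<in> \<Sigma>" "D \<in> \<Sigma>" using M by (auto simp: maximal_cells_def)
  have cv: "convex M" "convex D" and cl: "closed M" "closed D"
    using sub S by (auto simp: subdivision_def polytope_imp_convex polytope_imp_closed)
  have ne: "M \<noteq> {}" "D \<noteq> {}" using maximal_cell_full[OF d sub M(1)] maximal_cell_full[OF d sub M(2)] by auto
  define Q where "Q = (\<Union>x\<in>rel_interior M. \<Union>y\<in>rel_interior D. {x - y})"
  have "convex Q" unfolding Q_def by (intro convex_differences convex_rel_interior cv)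
  moreover have "Q \<noteq> {}" using ne cv by (auto simp: Q_def rel_interior_eq_empty)
  moreover have "0 \<notin> Q"
  proof
    assume "0 \<in> Q"
    then obtain x where x: "x \<in> rel_interior M" "x \<in> rel_interior D" by (auto simp: Q_def)
    hence "M \<subseteq> D" using face_inter_subset[OF sub S x(1)] rel_interior_subset by blast
    thus False using M S by (auto simp: maximal_cells_def)
  qed
  ultimately have "\<exists>a. a \<in> affine hull (insert 0 Q) \<and> a \<noteq> 0 \<and> (\<forall>x\<in>Q. 0 \<le> a \<bullet> x)"
  proof (rule separating_hyperplane_set_point_inaff)
    fix a b assume *: "0 + a \<in> affine hull (insert 0 Q)" "a \<noteq> 0" "a \<bullet> 0 \<le> b" "\<And>x. x \<in> Q \<Longrightarrow> b \<le> a \<bullet> x"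
    have "0 \<le> a \<bullet> x" if "x \<in> Q" for x using *(3) *(4)[OF that] by simp
    thus ?thesis using *(1,2) by auto
  qed
  then obtain a where ab: "a \<in> affine hull (insert 0 Q)" "a \<noteq> 0" "\<forall>x\<in>Q. 0 \<le> a \<bullet> x" by blast
  have PH: "M \<subseteq> hplane d" "D \<subseteq> hplane d" using subdivision_cellD(1)[OF sub] S hypersimplex_hplane[of d] by blast+
  have "insert 0 Q \<subseteq> {x. chi UNIV \<bullet> x = 0}"
    using PH rel_interior_subset[of M] rel_interior_subset[of D] by (fastforce simp: Q_def hplane_def inner_diff_right)
  hence "affine hull (insert 0 Q) \<subseteq> {x. chi UNIV \<bullet> x = 0}" by (intro hull_minimal affine_hyperplane)
  hence a0: "chi UNIV \<bullet> a = 0" using ab(1) by auto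
  have ri: "a \<bullet> y \<le> a \<bullet> x" if "x \<in> rel_interior M" "y \<in> rel_interior D" for x y

  proof -
    have "x - y \<in> Q" using that by (auto simp: Q_def)
    thus ?thesis using ab(3) by (auto simp: inner_diff_right)
  qed
  have riM: "a \<bullet> y \<le> a \<bullet> x" if "x \<in> M" "y \<in> rel_interior D" for x y
  proof -
    have "closure (rel_interior M) \<subseteq> {x. a \<bullet> x \<ge> a \<bullet> y}"
      using ri that(2) by (intro closure_minimal closed_halfspace_ge) auto
    thus ?thesis using that(1) convex_closure_rel_interior[OF cv(1)] closure_subset[of M] by auto
  qed
  have "a \<bullet> y \<le> a \<bullet> x" if "x \<in> M" "y \<in> D" for x y
  proof -
    have "closure (rel_interior D) \<subseteq> {y. a \<bullet> y \<le> a \<bullet> x}"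
      using riM that(1) by (intro closure_minimal closed_halfspace_le) auto
    thus ?thesis using that(2) convex_closure_rel_interior[OF cv(2)] closure_subset[of D] by auto
  qed
  thus ?thesis using ab(2) a0 by blast
qed

text \<open>Equality at one relative interior point would spread to all of \<open>M\<close> and to
  its affine hull, the whole hyperplane, which contains \<open>c + a\<close>.\<close>

lemma strict_on_rel_interior:
  fixes M :: "(real ^ 'n::finite) set"
  assumes d: "0 < d" and M: "convex M" "M \<subseteq> hplane d" "dim M = CARD('n)"
    and a: "a \<noteq> 0" "chi UNIV \<bullet> a = 0" "\<And>x. x \<in> M \<Longrightarrow> a \<bullet> c \<le> a \<bullet> x" and c: "c \<in> M"
    and u: "u \<in> rel_interior M"
  shows "a \<bullet> c < a \<bullet> u"
proof (rule ccontr)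
  assume n: "\<not> ?thesis"
  have uM: "u \<in> M" using u rel_interior_subset by blast
  hence eq: "a \<bullet> u = a \<bullet> c" using a(3)[of u] n by simp
  have "M \<subseteq> {x. a \<bullet> x = a \<bullet> c}"
  proof
    fix x assume x: "x \<in> M"
    obtain e where e: "0 < e" "u - e *\<^sub>R (x - u) \<in> M" using prolong[OF M(1) u x] by blast
    have "e * (a \<bullet> x - a \<bullet> c) \<le> 0" using a(3)[OF e(2)] eq by (simp add: inner_diff_right)
    hence "a \<bullet> x \<le> a \<bullet> c" using e(1) by (simp add: mult_le_0_iff)
    thus "x \<in> {x. a \<bullet> x = a \<bullet> c}" using a(3)[OF x] by simp
  qed
  hence "affine hull M \<subseteq> {x. a \<bullet> x = a \<bullet> c}" by (intro hull_minimal affine_hyperplane)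
  moreover have "c + a \<in> affine hull M"
    using affine_hull_full[OF M(2) d M(3)] c M(2) a(2) by (auto simp: hplane_def inner_add_right)
  ultimately have "a \<bullet> a = 0" by (auto simp: inner_add_right)
  thus False using a(1) by simp
qed

lemma closed_ray_limit:
  fixes S :: "'a::real_normed_vector set"
  assumes "closed S" "\<And>\<epsilon>. \<lbrakk>0 < \<epsilon>; \<epsilon> \<le> 1\<rbrakk> \<Longrightarrow> x + \<epsilon> *\<^sub>R v \<in> S"
  shows "x \<in> S"
proof (rule closed_sequentially[OF assms(1)])
  show "x + inverse (real (Suc n)) *\<^sub>R v \<in> S" for n by (rule assms(2)) (auto simp: inverse_le_1_iff)
  have "(\<lambda>n. x + inverse (real (Suc n)) *\<^sub>R v) \<longlonglongrightarrow> x + 0 *\<^sub>R v"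
    by (intro tendsto_intros LIMSEQ_inverse_real_of_nat)
  thus "(\<lambda>n. x + inverse (real (Suc n)) *\<^sub>R v) \<longlonglongrightarrow> x" by simp
qed

text \<open>Codimension \<open>k - 1\<close> enters through the dimension of \<open>span C\<close>:
  this is the common kernel of the \<open>k - 1\<close> normals of a maximal cell, so they are
  independent. That \<open>C\<close> meets the interior makes the fan around it complete.\<close>

theorem k_split_fan:
  fixes \<Sigma> :: "(real ^ 'n::finite) set set"
  assumes d: "0 < d" "d < CARD('n)" and ks: "k_split k (hypersimplex d) \<Sigma>" and k: "2 \<le> k"
    and e0: "e0 \<in> maximal_cells \<Sigma>"
  shows "\<exists>f c. simplicial_fan d (maximal_cells \<Sigma>) f e0
      (\<lambda>i. {x \<in> hypersimplex d. \<forall>t\<in>maximal_cells \<Sigma>. f t \<bullet> x \<le> f i \<bullet> x}) c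
    \<and> (\<forall>i\<in>maximal_cells \<Sigma>. i = {x \<in> hypersimplex d. \<forall>t\<in>maximal_cells \<Sigma>. f t \<bullet> x \<le> f i \<bullet> x})"
proof -
  let ?P = "hypersimplex d :: (real ^ 'n) set"
  define I where "I = maximal_cells \<Sigma>"
  have sub: "subdivision ?P \<Sigma>" and cardI: "card I = k"
    using ks by (auto simp: k_split_def coarsest_subdivision_def I_def)
  have finS: "finite \<Sigma>" using sub by (simp add: subdivision_def)
  have IS: "i \<in> \<Sigma>" if "i \<in> I" for i using that by (simp add: I_def maximal_cells_def)
  have finI: "finite I" using finS by (auto simp: I_def maximal_cells_def)
  obtain C where C: "C \<in> \<Sigma>" "\<And>i. i \<in> I \<Longrightarrow> C \<subseteq> i" "aff_dim ?P - aff_dim C = int k - 1" "C \<inter> rel_interior ?P \<noteq> {}"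
    using ks unfolding k_split_def I_def by blast
  obtain c where c: "c \<in> C" "c \<in> rel_interior ?P" using C(4) by blast
  have cP: "c \<in> ?P" using c(2) rel_interior_subset by blast
  have c01: "0 < c $ a" "c $ a < 1" for a using rel_interior_hypersimplex[OF d c(2)] by auto
  note cell = subdivision_cellD[OF sub IS]
  have ci: "c \<in> i" if "i \<in> I" for i using C(2)[OF that] c(1) by blast
  have iH: "i \<subseteq> hplane d" if "i \<in> I" for i using cell(1)[OF that] hypersimplex_hplane[of d] by blast
  have full: "dim i = CARD('n)" if "i \<in> I" for i using maximal_cell_full[OF d sub] that by (simp add: I_def)
  have cH: "chi UNIV \<bullet> c = real d" using cP hypersimplex_hplane by (auto simp: hplane_def)

  have "\<forall>i j. i \<in> I \<and> j \<in> I \<and> i \<noteq> j \<longrightarrow> (\<exists>a. a \<noteq> 0 \<and> chi UNIV \<bullet> a = 0 \<and> (\<forall>x\<in>i. \<forall>y\<in>j. a \<bullet> y \<le> a \<bullet> x))"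
    using separate_cells[OF d sub] by (simp add: I_def)
  then obtain A where A: "\<And>i j. \<lbrakk>i \<in> I; j \<in> I; i \<noteq> j\<rbrakk> \<Longrightarrow>
      A i j \<noteq> 0 \<and> chi UNIV \<bullet> A i j = 0 \<and> (\<forall>x\<in>i. \<forall>y\<in>j. A i j \<bullet> y \<le> A i j \<bullet> x)" by metis
  \<comment> \<open>Antisymmetrising keeps the separation. The multiple of \<open>chi UNIV\<close>
    subtracted in \<open>g\<close> makes the form vanish at \<open>c\<close> and only shifts it by a
    constant on the hyperplane, so all inequalities become homogeneous.\<close>
  define v where "v i j = (if i = j then 0 else A i j - A j i)" for i j
  define g where "g i j = v i j - ((v i j \<bullet> c) / d) *\<^sub>R chi UNIV" for i j
  have v_anti: "v i j = - v j i" for i j by (simp add: v_def)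
  have anti: "g i j = - g j i" for i j
    unfolding g_def v_anti[of i j] by simp
  have gc: "g i j \<bullet> c = 0" for i j using cH d by (simp add: g_def inner_diff_left)
  have gP: "g i j \<bullet> x = v i j \<bullet> x - v i j \<bullet> c" if "x \<in> ?P" for i j x
  proof -
    have "chi UNIV \<bullet> x = real d" using that hypersimplex_hplane by (auto simp: hplane_def)
    thus ?thesis using d by (simp add: g_def inner_diff_left)
  qed
  have gpos: "0 \<le> g i j \<bullet> x" if "i \<in> I" "j \<in> I" "x \<in> i" for i j x
  proof (cases "i = j")
    case False
    have "A i j \<bullet> c \<le> A i j \<bullet> x" "A j i \<bullet> x \<le> A j i \<bullet> c"
      using A[OF that(1,2) False] A[OF that(2,1)] False ci that by auto
    thus ?thesis using gP[of x i j] cell(1)[OF that(1)] that(3) False by (auto simp: v_def inner_diff_left)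
  qed (simp add: g_def v_def)
  have gneg: "g i j \<bullet> x \<le> 0" if "i \<in> I" "j \<in> I" "x \<in> j" for i j x
    using gpos[OF that(2,1,3)] anti[of i j] by simp
  have gstrict: "0 < g i j \<bullet> u" if "i \<in> I" "j \<in> I" "i \<noteq> j" "u \<in> rel_interior i" for i j u
  proof -
    have uP: "u \<in> i" using that(4) rel_interior_subset by blast
    have "A i j \<bullet> c < A i j \<bullet> u"
      using A[OF that(1-3)] ci that
      by (intro strict_on_rel_interior[OF d(1) cell(3)[OF that(1)] iH[OF that(1)] full[OF that(1)]]) auto
    moreover have "A j i \<bullet> u \<le> A j i \<bullet> c" using A[OF that(2,1)] that ci uP by auto
    ultimately show ?thesis using gP[of u i j] cell(1)[OF that(1)] uP that(3) by (auto simp: v_def inner_diff_left)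
  qed
  have cover_cells: "\<exists>i\<in>I. x \<in> i" if x: "x \<in> ?P" for x
  proof -
    have "x \<in> \<Union>\<Sigma>" using sub x by (simp add: subdivision_def)
    then obtain D where D: "D \<in> \<Sigma>" "x \<in> D" by blast
    obtain M where "M \<in> maximal_cells \<Sigma>" "D \<subseteq> M" by (rule cell_below_maximal[OF finS D(1)])
    thus ?thesis using D(2) by (auto simp: I_def)
  qed
  \<comment> \<open>A cell is cut out by its own normals: on the way from \<open>x\<close> to a
    relative interior point \<open>u\<close> of \<open>i\<close>, every point violates the
    inequality of each other cell. So these points are in \<open>i\<close>, which is closed.\<close>
  have inI: "x \<in> i" if i: "i \<in> I" and x: "x \<in> ?P" "\<forall>j\<in>I. 0 \<le> g i j \<bullet> x" for i x
  proof -
    have "i \<noteq> {}" using ci[OF i] by blast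
    then obtain u where u: "u \<in> rel_interior i" using rel_interior_eq_empty[OF cell(3)[OF i]] by blast
    have uP: "u \<in> ?P" using u rel_interior_subset cell(1)[OF i] by blast
    show ?thesis
    proof (rule closed_ray_limit[OF cell(4)[OF i], where v = "u - x"])
      fix \<epsilon> :: real assume \<epsilon>: "0 < \<epsilon>" "\<epsilon> \<le> 1"
      have y: "x + \<epsilon> *\<^sub>R (u - x) = (1 - \<epsilon>) *\<^sub>R x + \<epsilon> *\<^sub>R u" by (simp add: algebra_simps)
      hence "x + \<epsilon> *\<^sub>R (u - x) \<in> ?P" using convexD[OF convex_hypersimplex x(1) uP, of "1 - \<epsilon>" \<epsilon>] \<epsilon> by simp
      then obtain j where j: "j \<in> I" "x + \<epsilon> *\<^sub>R (u - x) \<in> j" using cover_cells by blast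
      have "j = i"
      proof (rule ccontr)
        assume ne: "j \<noteq> i"
        have "0 < \<epsilon> * (g i j \<bullet> u)" using gstrict[OF i j(1) _ u] ne \<epsilon> by simp
        moreover have "0 \<le> (1 - \<epsilon>) * (g i j \<bullet> x)" using x(2) j(1) \<epsilon> by simp
        moreover have "g i j \<bullet> ((1 - \<epsilon>) *\<^sub>R x + \<epsilon> *\<^sub>R u) = (1 - \<epsilon>) * (g i j \<bullet> x) + \<epsilon> * (g i j \<bullet> u)"
          by (simp add: inner_add_right)
        ultimately have "0 < g i j \<bullet> (x + \<epsilon> *\<^sub>R (u - x))" unfolding y by linarith
        thus False using gneg[OF i j] by simp
      qed
      thus "x + \<epsilon> *\<^sub>R (u - x) \<in> i" using j by simp
    qed
  qed
  have small: "\<exists>\<epsilon>>0. \<forall>\<eta>. \<bar>\<eta>\<bar> \<le> \<epsilon> \<longrightarrow> c + \<eta> *\<^sub>R (z - ((\<Sum>a\<in>UNIV. z $ a) / d) *\<^sub>R c) \<in> ?P" for z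
    by (intro near_exists cP c01 proj_sum d)
  have cover: "\<exists>i\<in>I. \<forall>j\<in>I. 0 \<le> g i j \<bullet> z" for z
  proof -
    obtain \<epsilon> where \<epsilon>: "0 < \<epsilon>" "\<forall>\<eta>. \<bar>\<eta>\<bar> \<le> \<epsilon> \<longrightarrow> c + \<eta> *\<^sub>R (z - ((\<Sum>a\<in>UNIV. z $ a) / d) *\<^sub>R c) \<in> ?P"
      using small[of z] by blast
    hence "c + \<epsilon> *\<^sub>R (z - ((\<Sum>a\<in>UNIV. z $ a) / d) *\<^sub>R c) \<in> ?P" by simp
    then obtain i where i: "i \<in> I" "c + \<epsilon> *\<^sub>R (z - ((\<Sum>a\<in>UNIV. z $ a) / d) *\<^sub>R c) \<in> i" using cover_cells by blast
    have "0 \<le> g i j \<bullet> z" if j: "j \<in> I" for j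
    proof -
      have "0 \<le> \<epsilon> * (g i j \<bullet> z)" using gpos[OF i(1) j i(2)] gc[of i j] by (simp add: inner_add_right inner_diff_right)
      thus ?thesis using \<epsilon>(1) by (simp add: zero_le_mult_iff)
    qed
    thus ?thesis using i(1) by blast
  qed
  have kerC: "(\<forall>l\<in>I. g i l \<bullet> z = 0) \<longleftrightarrow> z \<in> span C" if i: "i \<in> I" for i z
  proof
    assume z: "z \<in> span C"
    show "\<forall>l\<in>I. g i l \<bullet> z = 0"
    proof
      fix l assume l: "l \<in> I"
      have "g i l \<bullet> x = 0" if "x \<in> C" for x
        using gpos[OF i l] gneg[OF i l] C(2)[OF i] C(2)[OF l] that by (meson antisym subsetD)
      hence "C \<subseteq> {x. g i l \<bullet> x = 0}" by blast
      hence "span C \<subseteq> {x. g i l \<bullet> x = 0}" by (intro span_minimal subspace_hyperplane)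
      thus "g i l \<bullet> z = 0" using z by blast
    qed
  next
    assume z: "\<forall>l\<in>I. g i l \<bullet> z = 0"
    let ?y = "z - ((\<Sum>a\<in>UNIV. z $ a) / d) *\<^sub>R c"
    have cs: "c \<in> span C" using c(1) by (rule span_base)
    obtain \<epsilon> where \<epsilon>: "0 < \<epsilon>" "\<forall>\<eta>. \<bar>\<eta>\<bar> \<le> \<epsilon> \<longrightarrow> c + \<eta> *\<^sub>R ?y \<in> ?P" using small[of z] by blast
    have mem: "c + \<eta> *\<^sub>R ?y \<in> i" if "\<bar>\<eta>\<bar> \<le> \<epsilon>" for \<eta>
      using \<epsilon>(2) that z gc by (intro inI[OF i]) (auto simp: inner_add_right inner_diff_right)
    \<comment> \<open>Along a kernel direction one can move both ways from \<open>c\<close> inside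
      \<open>i\<close>; as \<open>C\<close> is a face of \<open>i\<close> containing
      \<open>c\<close>, the movement stays in \<open>C\<close>.\<close>
    have "?y \<in> span C"
    proof (cases "?y = 0")
      case False
      have "(C \<inter> i) face_of i" using sub C(1) IS[OF i] unfolding subdivision_def by blast
      moreover have "C \<inter> i = C" using C(2)[OF i] by blast
      ultimately have face: "C face_of i" by simp
      have "c \<in> open_segment (c - \<epsilon> *\<^sub>R ?y) (c + \<epsilon> *\<^sub>R ?y)" using False \<epsilon>(1) by (intro in_open_segment_mid) simp
      moreover have "c - \<epsilon> *\<^sub>R ?y \<in> i" "c + \<epsilon> *\<^sub>R ?y \<in> i" using mem[of "- \<epsilon>"] mem[of \<epsilon>] \<epsilon>(1) by simp_all
      ultimately have "c + \<epsilon> *\<^sub>R ?y \<in> C" using face_ofD[OF face] c(1) by blast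
      hence "(c + \<epsilon> *\<^sub>R ?y) - c \<in> span C" using c(1) by (intro span_diff span_base)
      hence "(1 / \<epsilon>) *\<^sub>R ((c + \<epsilon> *\<^sub>R ?y) - c) \<in> span C" by (rule span_scale)
      thus ?thesis using \<epsilon>(1) by simp
    qed (simp add: span_zero)
    moreover have "((\<Sum>a\<in>UNIV. z $ a) / d) *\<^sub>R c \<in> span C" using cs by (rule span_scale)
    ultimately have "?y + ((\<Sum>a\<in>UNIV. z $ a) / d) *\<^sub>R c \<in> span C" by (rule span_add)
    thus "z \<in> span C" by simp
  qed
  have dimC: "dim (span C) + (k - 1) = CARD('n)"
  proof -
    have "C \<subseteq> hplane d" using subdivision_cellD(1)[OF sub C(1)] hypersimplex_hplane[of d] by blast
    hence "int (dim C) = aff_dim C + 1" using d(1) by (rule dim_in_hplane)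
    moreover have "int (dim ?P) = aff_dim ?P + 1" using hypersimplex_hplane d(1) by (rule dim_in_hplane)
    ultimately have "int (dim C) + (int k - 1) = CARD('n)" using C(3) dim_hypersimplex[OF d] by simp
    thus ?thesis using k unfolding dim_span by linarith
  qed
  have indg: "\<alpha> j = 0" if i: "i \<in> I" and s: "(\<Sum>j\<in>I - {i}. \<alpha> j *\<^sub>R g i j) = 0" and j: "j \<in> I - {i}" for i \<alpha> j
  proof -
    let ?G = "g i ` (I - {i})"
    have gii: "g i i = 0" by (simp add: g_def v_def)
    have "{y \<in> UNIV. \<forall>x\<in>span ?G. orthogonal x y} = span C"
    proof (intro set_eqI iffI)
      fix y assume "y \<in> {y \<in> UNIV. \<forall>x\<in>span ?G. orthogonal x y}"
      hence y: "x \<bullet> y = 0" if "x \<in> span ?G" for x using that by (auto simp: orthogonal_def)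
      have "g i l \<bullet> y = 0" if "l \<in> I" for l
      proof (cases "l = i")
        case False
        have "g i l \<in> span ?G" using that False by (intro span_base) auto
        thus ?thesis by (rule y)
      qed (simp add: gii)
      thus "y \<in> span C" using kerC[OF i] by blast
    next
      fix y assume "y \<in> span C"
      hence "\<forall>l\<in>I. g i l \<bullet> y = 0" using kerC[OF i] by blast
      hence "?G \<subseteq> {x. y \<bullet> x = 0}" by (auto simp: inner_commute)
      hence "span ?G \<subseteq> {x. y \<bullet> x = 0}" by (intro span_minimal subspace_hyperplane)
      thus "y \<in> {y \<in> UNIV. \<forall>x\<in>span ?G. orthogonal x y}" by (auto simp: orthogonal_def inner_commute)
    qed
    moreover have "dim {y \<in> UNIV. \<forall>x\<in>span ?G. orthogonal x y} + dim (span ?G) = dim (UNIV :: (real ^ 'n) set)"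
      by (intro dim_subspace_orthogonal_to_vectors) auto
    ultimately have "dim (span C) + dim ?G = CARD('n)" by simp
    hence dG: "dim ?G = card (I - {i})" using dimC cardI i finI by simp
    have cG: "card ?G \<le> card (I - {i})" using finI by (intro card_image_le) simp
    have fG: "finite ?G" using finI by simp
    have "dim ?G \<le> card ?G" using fG by (intro dim_le_card) (auto simp: span_superset)
    hence ceq: "card ?G = card (I - {i})" using dG cG by simp
    hence inj: "inj_on (g i) (I - {i})" using finI by (intro eq_card_imp_inj_on) auto
    have indep: "independent ?G"
      using dG ceq fG by (intro card_le_dim_spanning[of ?G "span ?G"]) (auto simp: span_superset)
    have "(\<Sum>w\<in>?G. \<alpha> (inv_into (I - {i}) (g i) w) *\<^sub>R w) = (\<Sum>j\<in>I - {i}. \<alpha> j *\<^sub>R g i j)"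
      using inj by (simp add: sum.reindex)
    hence "\<alpha> (inv_into (I - {i}) (g i) (g i j)) = 0"
      using indep s j independentD[OF indep fG subset_refl, of "\<lambda>w. \<alpha> (inv_into (I - {i}) (g i) w)"] by simp
    thus ?thesis using inj j by simp
  qed
  have ker: "\<forall>l\<in>I. g j l \<bullet> z = 0" if "i \<in> I" "j \<in> I" "\<forall>l\<in>I. g i l \<bullet> z = 0" for i j z
    using kerC that by blast
  have e0I: "e0 \<in> I" using e0 by (simp add: I_def)
  have "\<exists>f. f e0 = 0 \<and> (\<forall>i\<in>I. \<forall>j\<in>I. \<exists>\<theta>>0. f i - f j = \<theta> *\<^sub>R g i j)
    \<and> (\<forall>\<alpha>. sum \<alpha> I = 0 \<longrightarrow> (\<Sum>i\<in>I. \<alpha> i *\<^sub>R f i) = 0 \<longrightarrow> (\<forall>i\<in>I. \<alpha> i = 0))"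
  proof (rule fan_normals[of I e0 g])
    show "\<alpha> j = 0" if "i \<in> I" "(\<Sum>j\<in>I - {i}. \<alpha> j *\<^sub>R g i j) = 0" "j \<in> I - {i}" for i \<alpha> j
      using that by (rule indg)
    show "\<forall>l\<in>I. g j l \<bullet> z = 0" if "i \<in> I" "j \<in> I" "\<forall>l\<in>I. g i l \<bullet> z = 0" for i j z using that by (rule ker)
    show "g i j = - g j i" for i j by (rule anti)
  qed (use finI e0I cover in blast)+
  then obtain f where f: "f e0 = 0" "\<And>i j. \<lbrakk>i \<in> I; j \<in> I\<rbrakk> \<Longrightarrow> \<exists>\<theta>>0. f i - f j = \<theta> *\<^sub>R g i j"
    "\<And>\<alpha> i. \<lbrakk>sum \<alpha> I = 0; (\<Sum>i\<in>I. \<alpha> i *\<^sub>R f i) = 0; i \<in> I\<rbrakk> \<Longrightarrow> \<alpha> i = 0" by blast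
  have fg: "f t \<bullet> x \<le> f i \<bullet> x \<longleftrightarrow> 0 \<le> g i t \<bullet> x" if it: "i \<in> I" "t \<in> I" for i t x
  proof -
    obtain \<theta> where \<theta>: "0 < \<theta>" "f i - f t = \<theta> *\<^sub>R g i t" using f(2)[OF it] by blast
    have "f i \<bullet> x - f t \<bullet> x = \<theta> * (g i t \<bullet> x)" using arg_cong[OF \<theta>(2), of "\<lambda>w. w \<bullet> x"] by (simp add: inner_diff_left)
    moreover have "0 \<le> \<theta> * (g i t \<bullet> x) \<longleftrightarrow> 0 \<le> g i t \<bullet> x" using \<theta>(1) by (simp add: zero_le_mult_iff)
    ultimately show ?thesis by linarith
  qed
  have cells: "i = {x \<in> ?P. \<forall>t\<in>I. f t \<bullet> x \<le> f i \<bullet> x}" if i: "i \<in> I" for i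
  proof (intro set_eqI iffI)
    fix x assume "x \<in> i"
    thus "x \<in> {x \<in> ?P. \<forall>t\<in>I. f t \<bullet> x \<le> f i \<bullet> x}" using cell(1)[OF i] gpos[OF i] fg[OF i] by auto
  next
    fix x assume "x \<in> {x \<in> ?P. \<forall>t\<in>I. f t \<bullet> x \<le> f i \<bullet> x}"
    thus "x \<in> i" using inI[OF i] fg[OF i] by auto
  qed
  have "simplicial_fan d I f e0 (\<lambda>i. {x \<in> ?P. \<forall>t\<in>I. f t \<bullet> x \<le> f i \<bullet> x}) c"
  proof
    fix i x assume ix: "i \<in> I" "x \<in> {x \<in> ?P. \<forall>t\<in>I. f t \<bullet> x \<le> f i \<bullet> x}"
    have eq: "{x \<in> ?P. \<forall>t\<in>I. f t \<bullet> x \<le> f i \<bullet> x} = i" using cells[OF ix(1)] by (rule sym)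
    have "x \<in> i" using ix(2) unfolding eq .
    also have "i = convex hull {x. x extreme_point_of i}" by (intro Krein_Milman_Minkowski cell ix)
    also have "\<dots> \<subseteq> convex hull (i \<inter> {v. \<forall>a. v $ a \<in> {0,1}})"
    proof (rule hull_mono, rule subsetI)
      fix w assume w: "w \<in> {x. x extreme_point_of i}"
      hence "w extreme_point_of ?P" using sub IS[OF ix(1)] by (auto simp: subdivision_def)
      hence "\<forall>a. w $ a \<in> {0,1}" using hypersimplex_extreme by blast
      thus "w \<in> i \<inter> {v. \<forall>a. v $ a \<in> {0,1}}" using w by (auto simp: extreme_point_of_def)
    qed
    finally show "x \<in> convex hull ({x \<in> ?P. \<forall>t\<in>I. f t \<bullet> x \<le> f i \<bullet> x} \<inter> {v. \<forall>a. v $ a \<in> {0,1}})" unfolding eq .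
  next
    fix i assume i: "i \<in> I"
    obtain \<theta> where "f i - f e0 = \<theta> *\<^sub>R g i e0" using f(2)[OF i e0I] by blast
    thus "f i \<bullet> c = 0" using f(1) gc by simp
  next
    fix \<alpha> i assume "sum \<alpha> I = 0" "(\<Sum>i\<in>I. \<alpha> i *\<^sub>R f i) = 0" "i \<in> I"
    thus "\<alpha> i = 0" by (rule f(3))
  qed (use finI e0I f(1) d cP c01 in auto)
  thus ?thesis using cells unfolding I_def by blast
qed

section \<open>Splits defined by blocks\<close>

locale block_sys =
  fixes k d :: nat and g :: "'n::finite \<Rightarrow> nat" and dd :: "nat \<Rightarrow> nat"
  assumes data: "(g, dd) \<in> block_data k d" and k2: "2 \<le> k"
begin

abbreviation P :: "(real ^ 'n) set" where "P \<equiv> hypersimplex d"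
abbreviation S :: "nat \<Rightarrow> real ^ 'n \<Rightarrow> real" where "S \<equiv> excess g dd"
abbreviation B :: "nat \<Rightarrow> (real ^ 'n) set" where "B \<equiv> block_cell k d g dd"
abbreviation L :: "nat \<Rightarrow> 'n set" where "L r \<equiv> {a. g a = r}"

lemma g_range: "1 \<le> g a" "g a \<le> k" using data by (auto simp: block_data_def)

lemma g_nz: "g a \<noteq> 0" using g_range(1)[of a] by simp

lemma dd: "r \<in> {1..k} \<Longrightarrow> 0 < dd r" "r \<in> {1..k} \<Longrightarrow> dd r < card (L r)" "(\<Sum>r=1..k. dd r) = d"
  using data by (auto simp: block_data_def)

lemma sum_blocks: "(\<Sum>r=1..k. \<Sum>a\<in>L r. h a) = (\<Sum>a\<in>UNIV. h a)" for h :: "'n \<Rightarrow> 'x::comm_monoid_add"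
  using sum.group[of UNIV "{1..k}" g h] g_range by (auto simp: image_subset_iff)

lemma d_range: "0 < d" "d < CARD('n)"
proof -
  have ne: "{1..k} \<noteq> {}" using k2 by simp
  have "0 < (\<Sum>r=1..k. dd r)" using ne dd(1) by (intro sum_pos) auto
  thus "0 < d" using dd(3) by simp
  have "(\<Sum>r=1..k. dd r) < (\<Sum>r=1..k. card (L r))" using ne dd(2) by (intro sum_strict_mono) auto
  also have "\<dots> = CARD('n)" using sum_blocks[of "\<lambda>_. 1 :: nat"] by simp
  finally show "d < CARD('n)" using dd(3) by simp
qed

lemma B_eq: "B r = {x \<in> P. \<forall>s\<in>{1..k}. S s x \<le> S r x}" by (simp add: block_cell_def)

lemma S_top: "x \<in> P \<Longrightarrow> S k x = 0"
  using g_range dd(3) by (simp add: excess_def hypersimplex_def flip: of_nat_sum)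

lemma S_inner: "S r x = chi {a. g a \<le> r} \<bullet> x - (\<Sum>s=1..r. real (dd s))"
  by (simp only: excess_def inner_commute[of "chi _"] inner_chi)

lemma S_ex: assumes "a \<noteq> b"
  shows "S r (v + \<eta> *\<^sub>R coord_diff a b) = S r v + \<eta> * (of_bool (g a \<le> r) - of_bool (g b \<le> r))"
  by (simp add: S_inner inner_add_right coord_diff_inner)

lemma S_diff: assumes "r \<in> {1..k}"
  shows "S r x - S (r - 1) x = (\<Sum>a\<in>L r. x $ a) - dd r"
proof -
  have "{a. g a \<le> r} = {a. g a \<le> r - 1} \<union> L r" using assms by auto
  hence "(\<Sum>a | g a \<le> r. x $ a) = (\<Sum>a | g a \<le> r - 1. x $ a) + (\<Sum>a\<in>L r. x $ a)"
    using assms by (simp only:) (intro sum.union_disjoint, auto)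
  moreover have "{1..r} = insert r {1..r - 1}" using assms by auto
  hence "(\<Sum>s=1..r. real (dd s)) = real (dd r) + (\<Sum>s=1..r - 1. real (dd s))"
    using assms by (simp only:) (subst sum.insert, auto)
  ultimately show ?thesis by (simp add: excess_def)
qed

definition al :: "nat \<Rightarrow> 'n" where "al t = (SOME a. g a = t)"
definition nxt :: "nat \<Rightarrow> nat" where "nxt t = (if t = k then 1 else Suc t)"
text \<open>Moves one unit of mass from block \<open>t\<close> to the cyclically next block. Up to a
  shift common to all excesses, only \<open>S t\<close> changes, namely by -1. Over all
  \<open>t\<close> the directions sum to 0.\<close>

definition dir :: "nat \<Rightarrow> real ^ 'n" where "dir t = coord_diff (al (nxt t)) (al t)"

lemma al: assumes "t \<in> {1..k}" shows "g (al t) = t"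
proof -
  have "L t \<noteq> {}" using dd(2)[of t] assms by fastforce
  hence "\<exists>a. g a = t" by blast
  thus ?thesis unfolding al_def by (rule someI_ex)
qed

lemma nxt: "t \<in> {1..k} \<Longrightarrow> nxt t \<in> {1..k}" "t \<in> {1..k} \<Longrightarrow> nxt t \<noteq> t"
  using k2 by (auto simp: nxt_def)

lemma al_ne: "t \<in> {1..k} \<Longrightarrow> al (nxt t) \<noteq> al t"
  using al[of t] al[of "nxt t"] nxt[of t] by auto

lemma S_dir: assumes "t \<in> {1..k}" "s \<in> {1..k}"
  shows "S s (v + \<eta> *\<^sub>R dir t) = S s v + \<eta> * (of_bool (t = k) - of_bool (s = t))"
  unfolding dir_def S_ex[OF al_ne[OF assms(1)]] al[OF assms(1)] al[OF nxt(1)[OF assms(1)]]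
  using assms by (auto simp: nxt_def)

lemma nxt_bij: "bij_betw nxt {1..k} {1..k}"
  by (rule bij_betw_byWitness[where f' = "\<lambda>t. if t = 1 then k else t - 1"]) (use k2 in \<open>auto simp: nxt_def\<close>)

lemma sum_dir: "(\<Sum>t=1..k. dir t) = 0"
proof -
  have "(\<Sum>t=1..k. axis (al (nxt t)) 1 :: real ^ 'n) = (\<Sum>t=1..k. axis (al t) 1)"
    by (rule sum.reindex_bij_betw[OF nxt_bij])
  thus ?thesis by (simp add: dir_def coord_diff_def sum_subtractf)
qed

lemma dir_sum0: "(\<Sum>a\<in>UNIV. dir t $ a) = 0" by (simp add: dir_def coord_diff_sum)

definition centre :: "real ^ 'n" where "centre = (\<chi> a. dd (g a) / card (L (g a)))"

lemma centre_pos: "0 < centre $ a" "centre $ a < 1"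
  using dd(1,2)[of "g a"] g_range[of a] by (auto simp: centre_def)

lemma centre_block: assumes "r \<in> {1..k}" shows "(\<Sum>a\<in>L r. centre $ a) = dd r"
proof -
  have "(\<Sum>a\<in>L r. centre $ a) = (\<Sum>a\<in>L r. dd r / card (L r))" by (intro sum.cong) (auto simp: centre_def)
  also have "\<dots> = real (card (L r)) * (dd r / card (L r))" by (simp only: sum_constant)
  also have "\<dots> = dd r"
  proof -
    have "real (card (L r)) \<noteq> 0" using dd(2)[OF assms] by linarith
    from nonzero_mult_div_cancel_left[OF this, of "real (dd r)"] show ?thesis by (simp only: times_divide_eq_right)
  qed
  finally show ?thesis .
qed

lemma block_sums_hyp:
  fixes x :: "real ^ 'n"
  assumes "\<And>r. r \<in> {1..k} \<Longrightarrow> (\<Sum>a\<in>L r. x $ a) = real (dd r)"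
  shows "(\<Sum>a\<in>UNIV. x $ a) = d"
proof -
  have "(\<Sum>a\<in>UNIV. x $ a) = (\<Sum>r=1..k. \<Sum>a\<in>L r. x $ a)" by (rule sum_blocks[symmetric])
  also have "\<dots> = (\<Sum>r=1..k. real (dd r))" using assms by (intro sum.cong) auto
  also have "\<dots> = d" using dd(3) by (simp flip: of_nat_sum)
  finally show ?thesis .
qed

lemma centre_P: "centre \<in> P"
  using block_sums_hyp[of centre] centre_block centre_pos by (auto simp: hypersimplex_def less_imp_le)

lemma S_0: "S 0 x = 0"
proof -
  have "{a. g a \<le> 0} = {}" using g_nz by simp
  thus ?thesis unfolding excess_def by (simp only:) simp
qed

lemma block_sums_S: assumes "\<And>r. r \<in> {1..k} \<Longrightarrow> (\<Sum>a\<in>L r. x $ a) = real (dd r)" and "r \<le> k"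
  shows "S r x = 0"
  using assms(2)
proof (induction r)
  case 0
  show ?case by (rule S_0)
next
  case (Suc r)
  thus ?case using S_diff[of "Suc r" x] assms(1)[of "Suc r"] by simp
qed

lemma S_zero_block_sums: assumes "\<And>r. r \<in> {1..k} \<Longrightarrow> S r x = 0" and r: "r \<in> {1..k}"
  shows "(\<Sum>a\<in>L r. x $ a) = dd r"
proof -
  have "S (r - 1) x = 0"
  proof (cases "r = 1")
    case False
    hence "r - 1 \<in> {1..k}" using r by auto
    thus ?thesis by (rule assms(1))
  qed (simp add: S_0)
  thus ?thesis using S_diff[OF r, of x] assms(1)[OF r] by simp
qed

lemma centre_S: "r \<in> {1..k} \<Longrightarrow> S r centre = 0" using block_sums_S[OF centre_block] by simp

lemma dir_near: obtains \<epsilon> where "0 < \<epsilon>"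
  "\<And>t \<eta>. \<lbrakk>t \<in> {1..k}; \<bar>\<eta>\<bar> \<le> \<epsilon>\<rbrakk> \<Longrightarrow> centre + \<eta> *\<^sub>R dir t \<in> P"
proof -
  have "\<forall>t. \<exists>\<epsilon>>0. \<forall>\<eta>. \<bar>\<eta>\<bar> \<le> \<epsilon> \<longrightarrow> centre + \<eta> *\<^sub>R dir t \<in> P"
    by (intro allI near_exists centre_P centre_pos dir_sum0)
  then obtain e where e: "\<And>t. 0 < e t" "\<And>t \<eta>. \<bar>\<eta>\<bar> \<le> e t \<Longrightarrow> centre + \<eta> *\<^sub>R dir t \<in> P" by metis
  have ne: "e ` {1..k} \<noteq> {}" using k2 by simp
  define \<epsilon> where "\<epsilon> = Min (e ` {1..k})"
  have "\<epsilon> \<in> e ` {1..k}" unfolding \<epsilon>_def using ne by (intro Min_in) auto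
  hence "0 < \<epsilon>" using e(1) by auto
  moreover have "\<epsilon> \<le> e t" if "t \<in> {1..k}" for t unfolding \<epsilon>_def using that by (intro Min_le) auto
  hence "centre + \<eta> *\<^sub>R dir t \<in> P" if "t \<in> {1..k}" "\<bar>\<eta>\<bar> \<le> \<epsilon>" for t \<eta> using e(2)[of \<eta> t] that by (meson order_trans)
  ultimately show thesis using that by blast
qed

text \<open>Defined by strict inequalities in the whole space, so that openness is immediate. Its
  points in the hypersimplex are relative interior points of every set between \<open>B r\<close>
  and \<open>P\<close>.\<close>

definition core :: "nat \<Rightarrow> (real ^ 'n) set" where
  "core r = {x. (\<forall>a. 0 < x $ a \<and> x $ a < 1) \<and> (\<forall>s\<in>{1..k} - {r}. S s x < S r x)}"

lemma open_core: "open (core r)"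
proof -
  have "core r = (\<Inter>a. {x. 0 < x $ a} \<inter> {x. x $ a < 1}) \<inter> (\<Inter>s\<in>{1..k} - {r}. {x. S s x < S r x})"
    by (auto simp: core_def)
  also have "open \<dots>"
    unfolding S_inner by (intro open_Int open_INT ballI open_Collect_less continuous_intros) auto
  finally show ?thesis .
qed

lemma core_hplane: assumes "r \<in> {1..k}" shows "core r \<inter> hplane d \<subseteq> B r"
proof
  fix x assume x: "x \<in> core r \<inter> hplane d"
  have "S s x \<le> S r x" if "s \<in> {1..k}" for s using x that by (cases "s = r") (auto simp: core_def less_imp_le)
  thus "x \<in> B r" using x by (auto simp: B_eq core_def hypersimplex_def hplane_def ones_inner less_imp_le)
qed

lemma core_rel_interior:
  assumes "r \<in> {1..k}" "B r \<subseteq> D" "D \<subseteq> P" "x \<in> core r" "x \<in> P"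
  shows "x \<in> rel_interior D"
proof -
  have "D \<subseteq> hplane d" using assms(3) hypersimplex_hplane[of d] by blast
  hence "affine hull D \<subseteq> hplane d" unfolding hplane_def by (intro hull_minimal affine_hyperplane)
  hence "core r \<inter> affine hull D \<subseteq> D" using core_hplane[OF assms(1)] assms(2) by blast
  moreover have "x \<in> D" using core_hplane[OF assms(1)] assms hypersimplex_hplane[of d] by blast
  ultimately show ?thesis using open_core assms(4) unfolding rel_interior by blast
qed

text \<open>The point is \<open>centre\<close> moved by -\<eta> along \<open>dir r\<close>. As the
  directions sum to 0, it is also the average of \<open>centre\<close> moved by \<eta> times
  \<open>k - 1\<close> along \<open>dir t\<close>, over all \<open>t \<noteq> r\<close>. Each of
  these points lies in every cell \<open>B s\<close> with \<open>s \<noteq> t\<close>, hence in one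
  of any two given cells.\<close>

lemma core_exists: obtains u where "\<And>r. r \<in> {1..k} \<Longrightarrow> u r \<in> core r \<and> u r \<in> P"
  "\<And>D i j r. \<lbrakk>convex D; i \<in> {1..k}; j \<in> {1..k}; i \<noteq> j; B i \<subseteq> D; B j \<subseteq> D; r \<in> {1..k}\<rbrakk> \<Longrightarrow> u r \<in> D"
proof -
  obtain \<epsilon> where \<epsilon>: "0 < \<epsilon>" "\<And>t \<eta>. \<lbrakk>t \<in> {1..k}; \<bar>\<eta>\<bar> \<le> \<epsilon>\<rbrakk> \<Longrightarrow> centre + \<eta> *\<^sub>R dir t \<in> P" by (rule dir_near) blast
  \<comment> \<open>Small enough that the multiple by \<open>k - 1\<close> used in the average still
    stays within \<epsilon>.\<close>
  define \<eta> where "\<eta> = \<epsilon> / (2 * k)"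
  have \<eta>: "0 < \<eta>" "\<eta> < \<epsilon>" "\<eta> * (k - 1) \<le> \<epsilon>" using \<epsilon>(1) k2 by (auto simp: \<eta>_def field_simps of_nat_diff)
  define u where "u r = centre + (- \<eta>) *\<^sub>R dir r" for r
  have uP: "u r \<in> P" if "r \<in> {1..k}" for r using \<epsilon>(2)[OF that, of "- \<eta>"] \<eta> by (simp add: u_def)
  have ucore: "u r \<in> core r" if r: "r \<in> {1..k}" for r
    unfolding core_def
  proof (intro CollectI conjI allI ballI)
    fix a
    have m: "u r = (1 - \<eta> / \<epsilon>) *\<^sub>R centre + (\<eta> / \<epsilon>) *\<^sub>R (centre + (- \<epsilon>) *\<^sub>R dir r)"
      using \<epsilon>(1) by (simp add: u_def algebra_simps)
    have q: "centre + (- \<epsilon>) *\<^sub>R dir r \<in> P" using \<epsilon>(2)[OF r, of "- \<epsilon>"] \<epsilon>(1) by simp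
    define y where "y = (centre + (- \<epsilon>) *\<^sub>R dir r) $ a"
    have y: "0 \<le> y" "y \<le> 1" using q by (auto simp: y_def hypersimplex_def)
    define \<theta> where "\<theta> = \<eta> / \<epsilon>"
    have l: "0 < \<theta>" "\<theta> < 1" using \<eta> \<epsilon>(1) by (auto simp: \<theta>_def)
    have ua: "u r $ a = (1 - \<theta>) * centre $ a + \<theta> * y" using arg_cong[OF m, of "\<lambda>v. v $ a"] by (simp add: y_def \<theta>_def)
    show "0 < u r $ a" unfolding ua using l y centre_pos[of a] by (intro add_pos_nonneg mult_pos_pos mult_nonneg_nonneg) auto
    have "(1 - \<theta>) * centre $ a < (1 - \<theta>) * 1" using l centre_pos[of a] by (intro mult_strict_left_mono) auto
    moreover have "\<theta> * y \<le> \<theta> * 1" using l y by (intro mult_left_mono) auto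
    ultimately have "(1 - \<theta>) * centre $ a + \<theta> * y < (1 - \<theta>) * 1 + \<theta> * 1" by (rule add_less_le_mono)
    thus "u r $ a < 1" unfolding ua by simp
  next
    fix s assume "s \<in> {1..k} - {r}"
    hence s: "s \<in> {1..k}" "s \<noteq> r" by auto
    show "S s (u r) < S r (u r)"
      unfolding u_def S_dir[OF r s(1)] S_dir[OF r r] centre_S[OF s(1)] centre_S[OF r] using \<eta>(1) s(2) by simp
  qed
  have dirB: "centre + \<zeta> *\<^sub>R dir t \<in> B s" if "t \<in> {1..k}" "s \<in> {1..k}" "s \<noteq> t" "0 \<le> \<zeta>" "\<zeta> \<le> \<epsilon>" for t s \<zeta>
    unfolding B_eq using that \<epsilon>(2)[of t \<zeta>] centre_S by (auto simp: S_dir mult_nonneg_nonneg)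
  have uD: "u r \<in> D" if D: "convex D" "i \<in> {1..k}" "j \<in> {1..k}" "i \<noteq> j" "B i \<subseteq> D" "B j \<subseteq> D" and r: "r \<in> {1..k}" for D i j r
  proof -
    have pD: "centre + (\<eta> * (k - 1)) *\<^sub>R dir t \<in> D" if "t \<in> {1..k}" for t
    proof (cases "t = i")
      case True thus ?thesis using dirB[OF that D(3), of "\<eta> * (k - 1)"] D \<eta> k2 by (auto simp: mult_nonneg_nonneg)
    next
      case False thus ?thesis using dirB[OF that D(2), of "\<eta> * (k - 1)"] D \<eta> k2 by (auto simp: mult_nonneg_nonneg)
    qed
    have cd: "card ({1..k} - {r}) = k - 1" using r by simp
    have "(\<Sum>t\<in>{1..k} - {r}. (1 / real (k - 1)) *\<^sub>R (centre + (\<eta> * (k - 1)) *\<^sub>R dir t)) \<in> D"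
      using pD k2 cd by (intro convex_sum D(1)) auto
    also have "(\<Sum>t\<in>{1..k} - {r}. (1 / real (k - 1)) *\<^sub>R (centre + (\<eta> * (k - 1)) *\<^sub>R dir t))
      = (\<Sum>t\<in>{1..k} - {r}. (1 / real (k - 1)) *\<^sub>R centre) + (\<Sum>t\<in>{1..k} - {r}. \<eta> *\<^sub>R dir t)"
      using k2 by (simp add: scaleR_add_right sum.distrib)
    also have "(\<Sum>t\<in>{1..k} - {r}. (1 / real (k - 1)) *\<^sub>R centre) = centre" using cd k2 by (simp only: sum_constant_scaleR) simp
    also have "(\<Sum>t\<in>{1..k} - {r}. \<eta> *\<^sub>R dir t) = \<eta> *\<^sub>R (- dir r)"
    proof -
      have "dir r + (\<Sum>t\<in>{1..k} - {r}. dir t) = 0" using sum_dir sum.remove[of "{1..k}" r dir] r by simp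
      hence "(\<Sum>t\<in>{1..k} - {r}. dir t) = - dir r" by (simp add: eq_neg_iff_add_eq_0 add.commute)
      thus ?thesis by (simp add: scaleR_sum_right[symmetric])
    qed
    finally show ?thesis by (simp add: u_def)
  qed
  show thesis using that[of u] ucore uP uD by blast
qed

end

lemma polytope_hypersimplex: "polytope (hypersimplex d :: (real ^ 'n::finite) set)"
proof -
  have eq: "(hypersimplex d :: (real ^ 'n) set) =
      (\<Inter>a. {x. axis a 1 \<bullet> x \<ge> 0} \<inter> {x. axis a 1 \<bullet> x \<le> 1}) \<inter> ({x. chi UNIV \<bullet> x \<le> real d} \<inter> {x. chi UNIV \<bullet> x \<ge> real d})"
    by (auto simp: hypersimplex_def inner_axis' ones_inner)
  have "polyhedron (hypersimplex d :: (real ^ 'n) set)"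
    unfolding eq
    by (intro polyhedron_Int polyhedron_Inter polyhedron_halfspace_le polyhedron_halfspace_ge)
      (auto intro: polyhedron_Int polyhedron_halfspace_le polyhedron_halfspace_ge)
  moreover have "bounded (hypersimplex d :: (real ^ 'n) set)"
    by (rule bounded_subset[OF bounded_cbox[of 0 "chi UNIV"]]) (auto simp: hypersimplex_def mem_box_cart)
  ultimately show ?thesis by (simp add: polytope_eq_bounded_polyhedron)
qed

lemma zero_one_extreme:
  fixes v :: "real ^ 'n::finite"
  assumes v: "v \<in> hypersimplex d" "\<And>a. v $ a = 0 \<or> v $ a = 1"
  shows "v extreme_point_of hypersimplex d"
  unfolding extreme_point_of_def
proof (intro conjI ballI notI)
  fix x y assume xy: "x \<in> hypersimplex d" "y \<in> hypersimplex d" "v \<in> open_segment x y"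
  then obtain u where u: "x \<noteq> y" "0 < u" "u < 1" "v = (1 - u) *\<^sub>R x + u *\<^sub>R y" by (auto simp: in_segment)
  have "x $ a = y $ a" for a
  proof -
    have b: "0 \<le> x $ a" "x $ a \<le> 1" "0 \<le> y $ a" "y $ a \<le> 1" using xy by (auto simp: hypersimplex_def)
    have va: "v $ a = (1 - u) * x $ a + u * y $ a" using u(4) by simp
    have nn: "0 \<le> (1 - u) * x $ a" "0 \<le> u * y $ a" "0 \<le> (1 - u) * (1 - x $ a)" "0 \<le> u * (1 - y $ a)"
      using b u by (auto intro: mult_nonneg_nonneg)
    from v(2)[of a] show ?thesis
    proof
      assume "v $ a = 0"
      hence "(1 - u) * x $ a = 0" "u * y $ a = 0" using va nn by linarith+
      thus ?thesis using u by simp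
    next
      assume "v $ a = 1"
      moreover have "(1 - u) * (1 - x $ a) + u * (1 - y $ a) = 1 - ((1 - u) * x $ a + u * y $ a)" by (simp add: algebra_simps)
      ultimately have "(1 - u) * (1 - x $ a) = 0" "u * (1 - y $ a) = 0" using va nn by linarith+
      thus ?thesis using u by simp
    qed
  qed
  thus False using u(1) by (simp add: vec_eq_iff)
qed (rule v)

section \<open>The block cells form a subdivision without new vertices\<close>

context block_sys
begin

text \<open>The position of block \<open>s\<close> when the blocks are read cyclically starting
  right after \<open>r\<close>; block \<open>r\<close> itself comes last. In this order
  \<open>S s - S r\<close> is a prefix sum minus an integer.\<close>

definition rot :: "nat \<Rightarrow> nat \<Rightarrow> nat" where "rot r s = (if r < s then s - r else s + k - r)"

lemma rot_sum:
  assumes x: "x \<in> P" and r: "r \<in> {1..k}" and s: "s \<in> {1..k}"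
  shows "\<exists>z::int. S s x - S r x = (\<Sum>a | rot r (g a) \<le> rot r s. x $ a) - of_int z"
proof (cases "r < s")
  case True
  have pt: "g a \<le> s \<longleftrightarrow> g a \<le> r \<or> rot r (g a) \<le> rot r s" "\<not> (g a \<le> r \<and> rot r (g a) \<le> rot r s)" for a
    using True g_range[of a] s r by (auto simp: rot_def)
  have "{a. g a \<le> s} = {a. g a \<le> r} \<union> {a. rot r (g a) \<le> rot r s}" using pt(1) by blast
  moreover have "{a. g a \<le> r} \<inter> {a. rot r (g a) \<le> rot r s} = {}" using pt(2) by blast
  ultimately have "(\<Sum>a | g a \<le> s. x $ a) = (\<Sum>a | g a \<le> r. x $ a) + (\<Sum>a | rot r (g a) \<le> rot r s. x $ a)"
    by (simp add: sum.union_disjoint)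
  thus ?thesis
    by (intro exI[of _ "int (\<Sum>t=1..s. dd t) - int (\<Sum>t=1..r. dd t)"]) (simp add: excess_def)
next
  case False
  have pt: "rot r (g a) \<le> rot r s \<longleftrightarrow> \<not> (s < g a \<and> g a \<le> r)" for a
    using False g_range[of a] s r by (auto simp: rot_def)
  hence U: "(UNIV :: 'n set) = {a. rot r (g a) \<le> rot r s} \<union> {a. s < g a \<and> g a \<le> r}" by blast
  have "(\<Sum>a\<in>UNIV. x $ a) = (\<Sum>a | rot r (g a) \<le> rot r s. x $ a) + (\<Sum>a | s < g a \<and> g a \<le> r. x $ a)"
    by (subst U, rule sum.union_disjoint) (use pt in auto)
  moreover have "{a. g a \<le> r} = {a. g a \<le> s} \<union> {a. s < g a \<and> g a \<le> r}" using False by auto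
  hence "(\<Sum>a | g a \<le> r. x $ a) = (\<Sum>a | g a \<le> s. x $ a) + (\<Sum>a | s < g a \<and> g a \<le> r. x $ a)"
    by (simp only:) (intro sum.union_disjoint, auto)
  moreover have "(\<Sum>a\<in>UNIV. x $ a) = real d" using x by (simp add: hypersimplex_def)
  ultimately have "(\<Sum>a | g a \<le> s. x $ a) - (\<Sum>a | g a \<le> r. x $ a) = (\<Sum>a | rot r (g a) \<le> rot r s. x $ a) - real d"
    by linarith
  thus ?thesis
    by (intro exI[of _ "int d + int (\<Sum>t=1..s. dd t) - int (\<Sum>t=1..r. dd t)"]) (simp add: excess_def)
qed

lemma S_ex_diff:
  assumes "a \<noteq> b" "r \<in> {1..k}" "s \<in> {1..k}"
  shows "S s (v + \<eta> *\<^sub>R coord_diff a b) - S r (v + \<eta> *\<^sub>R coord_diff a b)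
    = S s v - S r v + \<eta> * (of_bool (rot r (g a) \<le> rot r s) - of_bool (rot r (g b) \<le> rot r s))"
proof -
  have key: "of_bool (g c \<le> s) - of_bool (g c \<le> r) = of_bool (rot r (g c) \<le> rot r s) - (if r < s then 0 else 1 :: real)" for c
    using g_range[of c] assms(2,3) by (auto simp: rot_def)
  have "S s (v + \<eta> *\<^sub>R coord_diff a b) - S r (v + \<eta> *\<^sub>R coord_diff a b) = S s v - S r v
      + \<eta> * ((of_bool (g a \<le> s) - of_bool (g a \<le> r)) - (of_bool (g b \<le> s) - of_bool (g b \<le> r)))"
    by (simp add: S_ex[OF assms(1)] algebra_simps)
  thus ?thesis unfolding key by (simp add: algebra_simps)
qed

text \<open>In the rotated order the constraints of \<open>B r\<close> bound prefix sums by
  integers. Mass can be moved between the first two fractional coordinates: a prefix containing only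
  one of them has a non-integral sum, so its constraint is slack, and the other prefix sums do not
  change.\<close>

lemma B_extreme:
  assumes r: "r \<in> {1..k}" and v: "v extreme_point_of B r"
  shows "v extreme_point_of P"
proof (rule zero_one_extreme)
  have vB: "v \<in> B r" using v by (simp add: extreme_point_of_def)
  thus vP: "v \<in> P" by (simp add: B_eq)
  have v01: "0 \<le> v $ b \<and> v $ b \<le> 1" for b using vP by (simp add: hypersimplex_def)
  have min: "\<exists>a\<in>Q. \<forall>b\<in>Q. rot r (g a) \<le> rot r (g b)" if "Q \<noteq> {}" for Q
    using that arg_min_if_finite(1)[of Q "\<lambda>a. rot r (g a)"] arg_min_least[of Q _ "\<lambda>a. rot r (g a)"] by (meson finite)
  fix a0 show "v $ a0 = 0 \<or> v $ a0 = 1"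
  proof (rule ccontr)
    assume nb: "\<not> (v $ a0 = 0 \<or> v $ a0 = 1)"
    define Fr where "Fr = {a. 0 < v $ a \<and> v $ a < 1}"
    have "a0 \<in> Fr" using nb v01[of a0] by (auto simp: Fr_def)
    then obtain a where a: "a \<in> Fr" "\<And>b. b \<in> Fr \<Longrightarrow> rot r (g a) \<le> rot r (g b)"
      using min[of Fr] by blast
    have "(\<Sum>b\<in>UNIV. v $ b) \<in> \<int>" using vP by (simp add: hypersimplex_def)
    then obtain b0 where "b0 \<in> Fr - {a}"
      using fractional_partner[of UNIV a "\<lambda>b. v $ b"] a(1) v01 by (auto simp: Fr_def)
    then obtain b where b: "b \<in> Fr - {a}" "\<And>c. c \<in> Fr - {a} \<Longrightarrow> rot r (g b) \<le> rot r (g c)"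
      using min[of "Fr - {a}"] by blast
    have ab: "a \<noteq> b" using b(1) by blast
    have strict: "S s v < S r v" if s: "s \<in> {1..k}" "rot r (g a) \<le> rot r s" "\<not> rot r (g b) \<le> rot r s" for s
    proof -
      have "S s v \<noteq> S r v"
      proof
        assume "S s v = S r v"
        hence "(\<Sum>c | rot r (g c) \<le> rot r s. v $ c) \<in> \<int>" using rot_sum[OF vP r s(1)] by auto
        then obtain c where "c \<in> {c. rot r (g c) \<le> rot r s}" "c \<noteq> a" "0 < v $ c" "v $ c < 1"
          using fractional_partner[of "{c. rot r (g c) \<le> rot r s}" a "\<lambda>b. v $ b"] a(1) s(2) v01 by (auto simp: Fr_def)
        thus False using b(2)[of c] s(3) by (auto simp: Fr_def)
      qed
      thus ?thesis using vB s(1) by (force simp: B_eq)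
    qed
    obtain \<epsilon>1 where e1: "0 < \<epsilon>1" "\<And>\<eta>. \<bar>\<eta>\<bar> \<le> \<epsilon>1 \<Longrightarrow> v + \<eta> *\<^sub>R coord_diff a b \<in> P"
      using shift_mass[OF vP ab] a(1) b(1) unfolding Fr_def by (metis (mono_tags, lifting) DiffD1 mem_Collect_eq)
    define T where "T = insert \<epsilon>1 ((\<lambda>s. S r v - S s v) ` {s \<in> {1..k}. S s v < S r v})"
    have finT: "finite T" "T \<noteq> {}" by (auto simp: T_def)
    define \<epsilon> where "\<epsilon> = Min T"
    have "\<epsilon> \<in> T" unfolding \<epsilon>_def by (rule Min_in[OF finT])
    hence \<epsilon>0: "0 < \<epsilon>" using e1(1) by (auto simp: T_def)
    have \<epsilon>le: "\<epsilon> \<le> t" if "t \<in> T" for t unfolding \<epsilon>_def using finT that by simp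
    have mem: "v + \<eta> *\<^sub>R coord_diff a b \<in> B r" if \<eta>: "\<bar>\<eta>\<bar> \<le> \<epsilon>" for \<eta>
      unfolding B_eq
    proof (intro CollectI conjI ballI)
      show "v + \<eta> *\<^sub>R coord_diff a b \<in> P" using e1(2) \<eta> \<epsilon>le[of \<epsilon>1] by (simp add: T_def)
      fix s assume s: "s \<in> {1..k}"
      have le: "S s v \<le> S r v" using vB s by (simp add: B_eq)
      have mono: "rot r (g a) \<le> rot r (g b)" using a(2) b(1) by blast
      note dif = S_ex_diff[OF ab r s, of v \<eta>]
      consider "rot r (g a) \<le> rot r s" "\<not> rot r (g b) \<le> rot r s" | "rot r (g a) \<le> rot r s \<longleftrightarrow> rot r (g b) \<le> rot r s"
        using mono by linarith
      thus "S s (v + \<eta> *\<^sub>R coord_diff a b) \<le> S r (v + \<eta> *\<^sub>R coord_diff a b)"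
      proof cases
        case 1
        have "\<epsilon> \<le> S r v - S s v" using strict[OF s 1] s by (intro \<epsilon>le) (auto simp: T_def)
        thus ?thesis using dif 1 \<eta> by (simp add: abs_le_iff)
      next
        case 2 thus ?thesis using dif le by simp
      qed
    qed
    have "v - \<epsilon> *\<^sub>R coord_diff a b \<in> B r" "v + \<epsilon> *\<^sub>R coord_diff a b \<in> B r" using mem[of "- \<epsilon>"] mem[of \<epsilon>] \<epsilon>0 by simp_all
    moreover have "v \<in> open_segment (v - \<epsilon> *\<^sub>R coord_diff a b) (v + \<epsilon> *\<^sub>R coord_diff a b)"
      using \<epsilon>0 coord_diff_nonzero[OF ab] by (intro in_open_segment_mid) simp
    ultimately show False using v by (auto simp: extreme_point_of_def)
  qed
qed

lemma B_sub: "B r \<subseteq> P" by (auto simp: B_eq)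

lemma polytope_B: "polytope (B r)"
proof -
  have eq: "B r = P \<inter> (\<Inter>s\<in>{1..k}. {x. (chi {a. g a \<le> s} - chi {a. g a \<le> r}) \<bullet> x \<le> (\<Sum>t=1..s. real (dd t)) - (\<Sum>t=1..r. real (dd t))})"
    by (auto simp: B_eq S_inner inner_diff_left algebra_simps)
  have "polyhedron (\<Inter>s\<in>{1..k}. {x. (chi {a. g a \<le> s} - chi {a. g a \<le> r}) \<bullet> x \<le> (\<Sum>t=1..s. real (dd t)) - (\<Sum>t=1..r. real (dd t))})"
    by (intro polyhedron_Inter) (auto intro: polyhedron_halfspace_le)
  thus ?thesis unfolding eq by (rule polytope_Int_polyhedron[OF polytope_hypersimplex])
qed

lemma convex_B: "convex (B r)" by (rule polytope_imp_convex[OF polytope_B])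

lemma B_Int_face: assumes "r \<in> {1..k}" "s \<in> {1..k}" shows "(B r \<inter> B s) face_of B r"
proof -
  let ?h = "chi {a. g a \<le> s} - chi {a. g a \<le> r}" and ?q = "(\<Sum>t=1..s. real (dd t)) - (\<Sum>t=1..r. real (dd t))"
  have h: "S s x - S r x = ?h \<bullet> x - ?q" for x by (simp add: S_inner inner_diff_left)
  have "(B r \<inter> {x. ?h \<bullet> x = ?q}) face_of B r"
    using convex_B
  proof (rule face_of_Int_supporting_hyperplane_le)
    fix x assume "x \<in> B r"
    hence "S s x \<le> S r x" using assms(2) by (simp add: B_eq)
    thus "?h \<bullet> x \<le> ?q" using h[of x] by linarith
  qed
  moreover have "B r \<inter> {x. ?h \<bullet> x = ?q} = B r \<inter> B s"
  proof (intro set_eqI iffI)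
    fix x assume "x \<in> B r \<inter> {x. ?h \<bullet> x = ?q}"
    hence "x \<in> B r" "S s x = S r x" using h[of x] by auto
    thus "x \<in> B r \<inter> B s" by (auto simp: B_eq)
  next
    fix x assume "x \<in> B r \<inter> B s"
    hence "S s x = S r x" "x \<in> B r" using assms by (auto simp: B_eq intro: antisym)
    thus "x \<in> B r \<inter> {x. ?h \<bullet> x = ?q}" using h[of x] by auto
  qed
  ultimately show ?thesis by simp
qed

lemma B_cover: assumes "x \<in> P" shows "\<exists>r\<in>{1..k}. x \<in> B r"
proof -
  have "Max ((\<lambda>s. S s x) ` {1..k}) \<in> (\<lambda>s. S s x) ` {1..k}" using k2 by (intro Max_in) auto
  then obtain r where r: "r \<in> {1..k}" "S r x = Max ((\<lambda>s. S s x) ` {1..k})" by auto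
  have "S s x \<le> S r x" if "s \<in> {1..k}" for s unfolding r(2) using that by (intro Max_ge) auto
  thus ?thesis using r(1) assms unfolding B_eq by blast
qed

definition cells :: "(real ^ 'n) set set" where "cells = {F. \<exists>r\<in>{1..k}. F face_of B r}"

lemma B_cells: "r \<in> {1..k} \<Longrightarrow> B r \<in> cells" unfolding cells_def using face_of_refl[OF convex_B] by blast

lemma subdivision_cells: "subdivision P cells"
  unfolding subdivision_def
proof (intro conjI ballI allI impI)
  have "cells = (\<Union>r\<in>{1..k}. {F. F face_of B r})" by (auto simp: cells_def)
  thus "finite cells" using finite_polytope_faces[OF polytope_B] by simp
  fix F assume "F \<in> cells"
  then obtain r where r: "r \<in> {1..k}" "F face_of B r" by (auto simp: cells_def)
  show "polytope F" using r(2) polytope_B by (rule face_of_polytope_polytope[rotated])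
  show "{v. v extreme_point_of F} \<subseteq> {v. v extreme_point_of P}"
    using B_extreme[OF r(1)] extreme_point_of_face[OF r(2)] by blast
  show "G \<in> cells" if "G face_of F" for G using face_of_trans[OF that r(2)] r(1) by (auto simp: cells_def)
  fix G assume "G \<in> cells"
  then obtain s where s: "s \<in> {1..k}" "G face_of B s" by (auto simp: cells_def)
  \<comment> \<open>Both cells are compared inside the common face of the two maximal cells above
    them.\<close>
  let ?N = "B r \<inter> B s"
  have N: "?N face_of B r" "?N face_of B s"
    using B_Int_face[OF r(1) s(1)] B_Int_face[OF s(1) r(1)] by (auto simp: Int_commute)
  have FG: "F \<subseteq> B r" "G \<subseteq> B s" using r(2) s(2) face_of_imp_subset by auto
  have "(F \<inter> ?N) face_of ?N" using face_of_Int[OF r(2) N(1)] by (rule face_of_subset) auto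
  moreover have "(G \<inter> ?N) face_of ?N" using face_of_Int[OF s(2) N(2)] by (rule face_of_subset) auto
  ultimately have "((F \<inter> ?N) \<inter> (G \<inter> ?N)) face_of ?N" by (rule face_of_Int)
  moreover have "(F \<inter> ?N) \<inter> (G \<inter> ?N) = F \<inter> G" using FG by blast
  ultimately have FN: "(F \<inter> G) face_of ?N" by simp
  show "(F \<inter> G) face_of F" using face_of_trans[OF FN N(1)] by (rule face_of_subset) (use FG in auto)
  show "(F \<inter> G) face_of G" using face_of_trans[OF FN N(2)] by (rule face_of_subset) (use FG in auto)
next
  have "\<Union>cells \<subseteq> P" using B_sub face_of_imp_subset by (fastforce simp: cells_def)
  moreover have "P \<subseteq> \<Union>cells" using B_cover B_cells by blast
  ultimately show "\<Union>cells = P" by blast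
qed

lemma core_disjoint: assumes "x \<in> core r" "x \<in> B s" "r \<in> {1..k}" "s \<in> {1..k}" shows "s = r"
proof (rule ccontr)
  assume "s \<noteq> r"
  hence "S s x < S r x" using assms(1,4) by (simp add: core_def)
  moreover have "S r x \<le> S s x" using assms(2,3) by (simp add: B_eq)
  ultimately show False by simp
qed

lemma B_incl: assumes "B r \<subseteq> B s" "r \<in> {1..k}" "s \<in> {1..k}" shows "s = r"
proof -
  obtain u where "u \<in> core r" "u \<in> P" using core_exists assms(2) by metis
  thus ?thesis using core_disjoint core_hplane[OF assms(2)] hypersimplex_hplane[of d] assms by blast
qed

lemma maximal_cells_eq: "maximal_cells cells = B ` {1..k}"
proof (intro set_eqI iffI)
  fix F assume "F \<in> maximal_cells cells"
  then obtain r where "r \<in> {1..k}" "F face_of B r" "\<And>D. D \<in> cells \<Longrightarrow> F \<subseteq> D \<Longrightarrow> D = F"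
    by (auto simp: maximal_cells_def cells_def)
  thus "F \<in> B ` {1..k}" using B_cells face_of_imp_subset by blast
next
  fix F assume "F \<in> B ` {1..k}"
  then obtain r where r: "r \<in> {1..k}" "F = B r" by blast
  have "D = F" if D: "D \<in> cells" "F \<subseteq> D" for D
  proof -
    obtain s where s: "s \<in> {1..k}" "D face_of B s" using D(1) by (auto simp: cells_def)
    have "B r \<subseteq> B s" using D(2) r(2) face_of_imp_subset[OF s(2)] by blast
    hence "s = r" using B_incl r(1) s(1) by blast
    thus ?thesis using D(2) r(2) face_of_imp_subset[OF s(2)] by blast
  qed
  thus "F \<in> maximal_cells cells" using B_cells[OF r(1)] r(2) by (simp add: maximal_cells_def)
qed

lemma card_maximal: "card (maximal_cells cells) = k"
proof -
  have "inj_on B {1..k}" using B_incl by (intro inj_onI) blast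
  thus ?thesis unfolding maximal_cells_eq by (simp add: card_image)
qed

end

section \<open>The block subdivision is a k-split\<close>

context block_sys
begin

text \<open>On the span of the common cell the block sums are proportional to \<open>dd\<close>;
  this form compares block \<open>s\<close> with the last block.\<close>

definition block_form :: "nat \<Rightarrow> real ^ 'n" where
  "block_form s = (1 / real (dd s)) *\<^sub>R chi (L s) - (1 / real (dd k)) *\<^sub>R chi (L k)"

lemma chi_L: "chi (L s) \<bullet> x = (\<Sum>a\<in>L s. x $ a)" for x :: "real ^ 'n"
  by (simp only: inner_commute[of "chi _"] inner_chi)

definition common_cell :: "(real ^ 'n) set" where "common_cell = (\<Inter>r\<in>{1..k}. B r)"

lemma common_cell_iff: "x \<in> common_cell \<longleftrightarrow> x \<in> P \<and> (\<forall>r\<in>{1..k}. S r x = 0)"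
proof
  have kk: "k \<in> {1..k}" using k2 by simp
  assume x: "x \<in> common_cell"
  hence P: "x \<in> P" using kk by (auto simp: common_cell_def B_eq)
  have "S r x = 0" if r: "r \<in> {1..k}" for r
  proof (rule antisym)
    have xB: "x \<in> B k" "x \<in> B r" using x r kk by (auto simp: common_cell_def)
    have "S r x \<le> S k x" using xB(1) r by (simp add: B_eq)
    thus "S r x \<le> 0" using S_top[OF P] by simp
    have "S k x \<le> S r x" using xB(2) kk by (simp add: B_eq)
    thus "0 \<le> S r x" using S_top[OF P] by simp
  qed
  thus "x \<in> P \<and> (\<forall>r\<in>{1..k}. S r x = 0)" using P by blast
next
  assume "x \<in> P \<and> (\<forall>r\<in>{1..k}. S r x = 0)"
  thus "x \<in> common_cell" by (simp add: common_cell_def B_eq)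
qed

lemma centre_common_cell: "centre \<in> common_cell" using centre_P centre_S by (simp add: common_cell_iff)

lemma common_cell_cell: "common_cell \<in> cells"
proof -
  have kk: "k \<in> {1..k}" using k2 by simp
  have "common_cell = \<Inter>((\<lambda>r. B k \<inter> B r) ` {1..k})" using kk by (auto simp: common_cell_def)
  moreover have "\<Inter>((\<lambda>r. B k \<inter> B r) ` {1..k}) face_of B k"
    by (rule face_of_Inter) (use kk B_Int_face in auto)
  ultimately show ?thesis using kk by (auto simp: cells_def)
qed

lemma common_cell_sub: "r \<in> {1..k} \<Longrightarrow> common_cell \<subseteq> B r" by (auto simp: common_cell_def)

lemma dd_pos: "r \<in> {1..k} \<Longrightarrow> 0 < real (dd r)" using dd(1) by simp

text \<open>A vector whose block sums are proportional to \<open>dd\<close> is a multiple of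
  \<open>centre\<close> plus a vector with zero block sums, and \<open>centre\<close> can be moved a
  little along the latter within the common cell.\<close>

lemma span_common_cell: "span common_cell = {y. \<forall>s\<in>{1..k-1}. block_form s \<bullet> y = 0}"
proof (intro subset_antisym subsetI)
  have kk: "k \<in> {1..k}" using k2 by simp
  have "block_form s \<bullet> x = 0" if "x \<in> common_cell" "s \<in> {1..k-1}" for x s
  proof -
    have s: "s \<in> {1..k}" using that(2) by auto
    have "(\<Sum>a\<in>L r. x $ a) = dd r" if "r \<in> {1..k}" for r
      using S_zero_block_sums[of x r] \<open>x \<in> common_cell\<close> that by (simp add: common_cell_iff)
    from this[OF s] this[OF kk] show ?thesis
      using dd_pos[OF s] dd_pos[OF kk] by (simp add: block_form_def inner_diff_left chi_L)
  qed
  hence "common_cell \<subseteq> {y. block_form s \<bullet> y = 0}" if "s \<in> {1..k-1}" for s using that by blast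
  hence "span common_cell \<subseteq> {y. block_form s \<bullet> y = 0}" if "s \<in> {1..k-1}" for s
    using that by (intro span_minimal subspace_hyperplane)
  thus "y \<in> {y. \<forall>s\<in>{1..k-1}. block_form s \<bullet> y = 0}" if "y \<in> span common_cell" for y using that by blast
  fix y assume "y \<in> {y. \<forall>s\<in>{1..k-1}. block_form s \<bullet> y = 0}"
  hence y: "\<And>s. s \<in> {1..k-1} \<Longrightarrow> block_form s \<bullet> y = 0" by blast
  define \<theta> where "\<theta> = (\<Sum>a\<in>L k. y $ a) / dd k"
  define z where "z = y - \<theta> *\<^sub>R centre"
  have yb: "(\<Sum>a\<in>L r. y $ a) = \<theta> * dd r" if r: "r \<in> {1..k}" for r
  proof (cases "r = k")
    case True thus ?thesis using dd_pos[OF kk] by (simp add: \<theta>_def)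
  next
    case False
    hence "r \<in> {1..k-1}" using r by auto
    from y[OF this] show ?thesis using dd_pos[OF r] by (simp add: block_form_def inner_diff_left chi_L \<theta>_def field_simps)
  qed
  have zb: "(\<Sum>a\<in>L r. z $ a) = 0" if r: "r \<in> {1..k}" for r
    using yb[OF r] centre_block[OF r] by (simp add: z_def sum_subtractf sum_distrib_left[symmetric])
  have z0: "(\<Sum>a\<in>UNIV. z $ a) = 0" unfolding sum_blocks[symmetric] using zb by (intro sum.neutral) blast
  obtain \<epsilon> where \<epsilon>: "0 < \<epsilon>" "\<forall>\<eta>. \<bar>\<eta>\<bar> \<le> \<epsilon> \<longrightarrow> centre + \<eta> *\<^sub>R z \<in> P"
    using near_exists[OF centre_P centre_pos z0] by blast
  have "(\<Sum>a\<in>L r. (centre + \<epsilon> *\<^sub>R z) $ a) = real (dd r)" if "r \<in> {1..k}" for r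
    using zb[OF that] centre_block[OF that] by (simp add: sum.distrib sum_distrib_left[symmetric])
  hence "S r (centre + \<epsilon> *\<^sub>R z) = 0" if "r \<in> {1..k}" for r using block_sums_S that by auto
  hence "centre + \<epsilon> *\<^sub>R z \<in> common_cell" using \<epsilon> by (simp add: common_cell_iff)
  hence "(centre + \<epsilon> *\<^sub>R z) - centre \<in> span common_cell" using centre_common_cell by (intro span_diff span_base)
  hence "(1 / \<epsilon>) *\<^sub>R ((centre + \<epsilon> *\<^sub>R z) - centre) \<in> span common_cell" by (rule span_scale)
  hence "z \<in> span common_cell" using \<epsilon>(1) by simp
  moreover have "\<theta> *\<^sub>R centre \<in> span common_cell" using centre_common_cell by (intro span_scale span_base)
  ultimately have "z + \<theta> *\<^sub>R centre \<in> span common_cell" by (rule span_add)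
  thus "y \<in> span common_cell" by (simp add: z_def)
qed

lemma block_form_al: assumes "s \<in> {1..k-1}" "t \<in> {1..k-1}" shows "block_form s $ al t = of_bool (s = t) / real (dd s)"
proof -
  have t: "t \<in> {1..k}" "t \<noteq> k" using assms(2) k2 by auto
  show ?thesis using al[OF t(1)] t(2) by (auto simp: block_form_def)
qed

lemma dim_common_cell: "dim common_cell + (k - 1) = CARD('n)"
proof -
  let ?H = "block_form ` {1..k-1}"
  have ddn: "real (dd s) \<noteq> 0" if "s \<in> {1..k-1}" for s using dd_pos[of s] that by auto
  have inj: "inj_on block_form {1..k-1}"
  proof (rule inj_onI, rule ccontr)
    fix s t assume st: "s \<in> {1..k-1}" "t \<in> {1..k-1}" "block_form s = block_form t" "s \<noteq> t"
    have "block_form s $ al s = block_form t $ al s" using st(3) by simp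
    thus False using block_form_al[OF st(1,1)] block_form_al[OF st(2,1)] st(4) ddn[OF st(1)] by simp
  qed
  have "independent ?H"
    unfolding independent_explicit
  proof (intro conjI allI impI)
    fix u assume "(\<Sum>v\<in>?H. u v *\<^sub>R v) = 0"
    hence z: "(\<Sum>s\<in>{1..k-1}. u (block_form s) *\<^sub>R block_form s) = 0" using inj by (simp add: sum.reindex)
    show "\<forall>v\<in>?H. u v = 0"
    proof clarify
      fix t assume t: "t \<in> {1..k-1}"
      have "(\<Sum>s\<in>{1..k-1}. u (block_form s) * (block_form s $ al t)) = (\<Sum>s\<in>{1..k-1}. if s = t then u (block_form t) / real (dd t) else 0)"
        using block_form_al[OF _ t] by (intro sum.cong) auto
      also have "\<dots> = u (block_form t) / real (dd t)" using t by simp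
      finally have "u (block_form t) / real (dd t) = (\<Sum>s\<in>{1..k-1}. u (block_form s) *\<^sub>R block_form s) $ al t" by (simp add: sum_component)
      hence "u (block_form t) / real (dd t) = (0 :: real ^ 'n) $ al t" unfolding z .
      thus "u (block_form t) = 0" using ddn[OF t] by (simp only: zero_index divide_eq_0_iff)  simp
    qed
  qed simp
  hence "dim ?H = card ?H" by (rule dim_eq_card_independent)
  also have "\<dots> = k - 1" using inj by (simp add: card_image)
  finally have dH: "dim (span ?H) = k - 1" by simp
  have "{y \<in> UNIV. \<forall>x\<in>span ?H. orthogonal x y} = span common_cell"
  proof (intro set_eqI iffI)
    fix y assume y: "y \<in> {y \<in> UNIV. \<forall>x\<in>span ?H. orthogonal x y}"
    have "block_form s \<bullet> y = 0" if "s \<in> {1..k-1}" for s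
    proof -
      have "block_form s \<in> span ?H" using that by (intro span_base) auto
      thus ?thesis using y by (auto simp: orthogonal_def)
    qed
    thus "y \<in> span common_cell" by (simp add: span_common_cell)
  next
    fix y assume "y \<in> span common_cell"
    hence "?H \<subseteq> {x. y \<bullet> x = 0}" by (auto simp: span_common_cell inner_commute)
    hence "span ?H \<subseteq> {x. y \<bullet> x = 0}" by (intro span_minimal subspace_hyperplane)
    thus "y \<in> {y \<in> UNIV. \<forall>x\<in>span ?H. orthogonal x y}" by (auto simp: orthogonal_def inner_commute)
  qed
  moreover have "dim {y \<in> UNIV. \<forall>x\<in>span ?H. orthogonal x y} + dim (span ?H) = dim (UNIV :: (real ^ 'n) set)"
    by (intro dim_subspace_orthogonal_to_vectors) auto
  ultimately have "dim (span common_cell) + (k - 1) = CARD('n)" unfolding dH by simp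
  thus ?thesis unfolding dim_span .
qed

lemma aff_dim_common_cell: "aff_dim P - aff_dim common_cell = int k - 1"
proof -
  have "common_cell \<subseteq> hplane d" using hypersimplex_hplane[of d] common_cell_iff by blast
  hence "int (dim common_cell) = aff_dim common_cell + 1" using d_range(1) by (rule dim_in_hplane)
  moreover have "int (dim P) = aff_dim P + 1" using hypersimplex_hplane d_range(1) by (rule dim_in_hplane)
  ultimately show ?thesis using dim_common_cell dim_hypersimplex[OF d_range] k2 by linarith
qed

lemma centre_rel_interior: "centre \<in> rel_interior P"
proof -
  let ?T = "\<Inter>a. {x :: real ^ 'n. 0 < x $ a} \<inter> {x. x $ a < 1}"
  have "open ?T" by (intro open_INT ballI open_Int open_Collect_less continuous_intros) auto
  moreover have "centre \<in> ?T" using centre_pos by auto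
  moreover have "affine hull P \<subseteq> hplane d"
    using hypersimplex_hplane[of d] unfolding hplane_def by (intro hull_minimal affine_hyperplane)
  hence "?T \<inter> affine hull P \<subseteq> P" by (fastforce simp: hplane_def hypersimplex_def ones_inner less_imp_le)
  ultimately show ?thesis using centre_P unfolding rel_interior by blast
qed

lemma cells_nontrivial: "cells \<noteq> trivial_subdivision P"
proof
  assume "cells = trivial_subdivision P"
  hence "P \<in> cells" using face_of_refl[OF convex_hypersimplex] by (simp add: trivial_subdivision_def)
  then obtain s where s: "s \<in> {1..k}" "P face_of B s" by (auto simp: cells_def)
  have PB: "P \<subseteq> B s" using face_of_imp_subset[OF s(2)] .
  obtain u where u: "\<And>r. r \<in> {1..k} \<Longrightarrow> u r \<in> core r \<and> u r \<in> P" by (rule core_exists) blast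
  have n: "nxt s \<in> {1..k}" "nxt s \<noteq> s" using nxt s(1) by auto
  have "u (nxt s) \<in> B s" using conjunct2[OF u[OF n(1)]] PB by blast
  from core_disjoint[OF conjunct1[OF u[OF n(1)]] this n(1) s(1)] n(2) show False by simp
qed

lemma full_B: assumes "r \<in> {1..k}" shows "dim (B r) = CARD('n)"
  using maximal_cell_full[OF d_range subdivision_cells] maximal_cells_eq assms by blast

text \<open>\<open>core_exists\<close> puts a relative interior point of each \<open>B r\<close>
  into \<open>D\<close>. The coarser cell \<open>D'\<close> above \<open>B r\<close> meets
  \<open>D\<close> in a face of \<open>D'\<close> through this point, and that face contains
  \<open>B r\<close>. So \<open>D\<close> contains all block cells.\<close>

lemma coarser_merge:
  assumes sub: "subdivision P \<Sigma>'" and co: "coarser \<Sigma>' cells"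
    and D: "D \<in> \<Sigma>'" "i \<in> {1..k}" "j \<in> {1..k}" "i \<noteq> j" "B i \<subseteq> D" "B j \<subseteq> D"
  shows "\<Sigma>' = trivial_subdivision P"
proof -
  obtain u where u: "\<And>r. r \<in> {1..k} \<Longrightarrow> u r \<in> core r \<and> u r \<in> P"
    "\<And>D i j r. \<lbrakk>convex D; i \<in> {1..k}; j \<in> {1..k}; i \<noteq> j; B i \<subseteq> D; B j \<subseteq> D; r \<in> {1..k}\<rbrakk> \<Longrightarrow> u r \<in> D"
    using core_exists by metis
  have "B r \<subseteq> D" if r: "r \<in> {1..k}" for r
  proof -
    have uD: "u r \<in> D" using u(2)[OF subdivision_cellD(3)[OF sub D(1)] D(2-6) r] .
    have ur: "u r \<in> rel_interior (B r)" using u(1)[OF r] B_sub r by (intro core_rel_interior[OF r]) auto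
    obtain D' where D': "D' \<in> \<Sigma>'" "B r \<subseteq> D'" using co B_cells[OF r] by (auto simp: coarser_def)
    have face: "(D' \<inter> D) face_of D'" using sub D(1) D'(1) by (auto simp: subdivision_def)
    have "u r \<in> B r" using ur rel_interior_subset by blast
    hence "D' \<inter> D \<inter> rel_interior (B r) \<noteq> {}" using ur uD D'(2) by blast
    from subset_of_face_of[OF face D'(2) this] show ?thesis by blast
  qed
  hence "P \<subseteq> D" using B_cover by blast
  hence PD: "D = P" using subdivision_cellD(1)[OF sub D(1)] by blast
  show ?thesis
    unfolding trivial_subdivision_def
  proof (intro set_eqI iffI)
    fix F assume F: "F \<in> \<Sigma>'"
    have "(F \<inter> P) face_of P" using sub F D(1) unfolding PD subdivision_def by blast
    moreover have "F \<inter> P = F" using subdivision_cellD(1)[OF sub F] by blast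
    ultimately show "F \<in> {F. F face_of P}" by simp
  next
    fix F assume "F \<in> {F. F face_of P}"
    thus "F \<in> \<Sigma>'" using sub D(1) unfolding PD subdivision_def by blast
  qed
qed

text \<open>Suppose \<open>D\<close> contains \<open>B r\<close>. A relative interior point of
  \<open>D\<close> lying in some \<open>B s\<close> is approximated by relative interior points of
  \<open>B s\<close> that are still in \<open>D\<close>, which forces \<open>B s\<close> into
  \<open>D\<close> and hence \<open>s = r\<close>. By closedness all of \<open>D\<close> lies in
  \<open>B r\<close>.\<close>

lemma coarser_same:
  assumes sub: "subdivision P \<Sigma>'" and co: "coarser \<Sigma>' cells"
    and no: "\<And>D i j. \<lbrakk>D \<in> \<Sigma>'; i \<in> {1..k}; j \<in> {1..k}; B i \<subseteq> D; B j \<subseteq> D\<rbrakk> \<Longrightarrow> i = j"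
  shows "\<Sigma>' = cells"
proof -
  have BS: "B r \<in> \<Sigma>'" if r: "r \<in> {1..k}" for r
  proof -
    obtain D where D: "D \<in> \<Sigma>'" "B r \<subseteq> D" using co B_cells[OF r] by (auto simp: coarser_def)
    have DP: "D \<subseteq> P" and cD: "convex D" using subdivision_cellD[OF sub D(1)] by auto
    obtain u where u: "u \<in> core r" "u \<in> P" using core_exists r by metis
    have ui: "u \<in> rel_interior D" using core_rel_interior[OF r D(2) DP u] .
    have DH: "D \<subseteq> hplane d" using DP hypersimplex_hplane[of d] by blast
    have dimD: "dim D = CARD('n)" using dim_subset[OF D(2)] full_B[OF r] dim_subset_UNIV_cart[of D] by simp
    have hullD: "affine hull D = hplane d" by (rule affine_hull_full[OF DH d_range(1) dimD])
    have "D \<subseteq> B r"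
    proof
      fix x assume x: "x \<in> D"
      show "x \<in> B r"
      proof (rule closed_ray_limit[of "B r" x "u - x"])
        show "closed (B r)" by (rule polytope_imp_closed[OF polytope_B])
        fix \<epsilon> :: real assume \<epsilon>: "0 < \<epsilon>" "\<epsilon> \<le> 1"
        define y where "y = x - \<epsilon> *\<^sub>R (x - u)"
        have yi: "y \<in> rel_interior D" unfolding y_def using rel_interior_convex_shrink[OF cD ui x \<epsilon>] .
        obtain e where e: "0 < e" "ball y e \<inter> affine hull D \<subseteq> D" using yi by (auto simp: mem_rel_interior_ball)
        have "y \<in> P" using yi rel_interior_subset DP by blast
        then obtain s where s: "s \<in> {1..k}" "y \<in> B s" using B_cover by blast
        have "y \<in> closure (rel_interior (B s))" using convex_closure_rel_interior[OF convex_B] s(2) closure_subset by blast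
        then obtain w where w: "w \<in> rel_interior (B s)" "dist w y < e" using e(1) by (meson closure_approachable)
        have wB: "w \<in> B s" using w(1) rel_interior_subset by blast
        hence "w \<in> hplane d" using B_sub hypersimplex_hplane by blast
        hence wD: "w \<in> D" using e(2) w(2) hullD by (auto simp: dist_commute)
        obtain D' where D': "D' \<in> \<Sigma>'" "B s \<subseteq> D'" using co B_cells[OF s(1)] by (auto simp: coarser_def)
        have face: "(D' \<inter> D) face_of D'" using sub D(1) D'(1) by (auto simp: subdivision_def)
        have "D' \<inter> D \<inter> rel_interior (B s) \<noteq> {}" using w(1) wD wB D'(2) by blast
        from subset_of_face_of[OF face D'(2) this] have "B s \<subseteq> D" by blast
        hence "s = r" using no[OF D(1) s(1) r _ D(2)] by blast
        thus "x + \<epsilon> *\<^sub>R (u - x) \<in> B r" using s(2) by (simp add: y_def algebra_simps)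
      qed
    qed
    thus ?thesis using D by (metis subset_antisym)
  qed
  show ?thesis
  proof (intro set_eqI iffI)
    fix F assume F: "F \<in> \<Sigma>'"
    show "F \<in> cells"
    proof (cases "F = {}")
      case True
      have "1 \<in> {1..k}" using k2 by simp
      thus ?thesis using True by (auto simp: cells_def)
    next
      case False
      then obtain x where x: "x \<in> rel_interior F" using rel_interior_eq_empty[OF subdivision_cellD(3)[OF sub F]] by blast
      hence "x \<in> P" using rel_interior_subset subdivision_cellD(1)[OF sub F] by blast
      then obtain r where r: "r \<in> {1..k}" "x \<in> B r" using B_cover by blast
      have "F \<subseteq> B r" using face_inter_subset[OF sub F BS[OF r(1)] x r(2)] .
      hence "F \<inter> B r = F" by blast
      moreover have "(F \<inter> B r) face_of B r" using sub F BS[OF r(1)] by (auto simp: subdivision_def)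
      ultimately show ?thesis using r(1) by (auto simp: cells_def)
    qed
  next
    fix F assume "F \<in> cells"
    then obtain r where "r \<in> {1..k}" "F face_of B r" by (auto simp: cells_def)
    thus "F \<in> \<Sigma>'" using BS sub by (auto simp: subdivision_def)
  qed
qed

theorem k_split_cells: "k_split k P cells"
  unfolding k_split_def coarsest_subdivision_def
proof (intro conjI allI impI)
  show "subdivision P cells" by (rule subdivision_cells)
  show "cells \<noteq> trivial_subdivision P" by (rule cells_nontrivial)
  show "card (maximal_cells cells) = k" by (rule card_maximal)
  show "\<Sigma>' = trivial_subdivision P" if "subdivision P \<Sigma>' \<and> coarser \<Sigma>' cells \<and> \<Sigma>' \<noteq> cells" for \<Sigma>'
  proof -
    have s: "subdivision P \<Sigma>'" "coarser \<Sigma>' cells" "\<Sigma>' \<noteq> cells" using that by auto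
    have "\<exists>D i j. D \<in> \<Sigma>' \<and> i \<in> {1..k} \<and> j \<in> {1..k} \<and> i \<noteq> j \<and> B i \<subseteq> D \<and> B j \<subseteq> D"
      using coarser_same[OF s(1,2)] s(3) by blast
    thus ?thesis using coarser_merge[OF s(1,2)] by blast
  qed
  show "\<exists>C\<in>cells. (\<forall>M\<in>maximal_cells cells. C \<subseteq> M) \<and> aff_dim P - aff_dim C = int k - 1 \<and> C \<inter> rel_interior P \<noteq> {}"
    using common_cell_cell common_cell_sub aff_dim_common_cell centre_common_cell centre_rel_interior unfolding maximal_cells_eq by blast
qed

end

section \<open>Counting block data\<close>

context block_sys
begin

lemma top_cell: "B k = {x \<in> P. \<forall>s\<in>{1..k}. S s x \<le> 0}"
  using S_top by (auto simp: B_eq)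

text \<open>Moving mass from \<open>a\<close> to the same or a later block can only lower excesses,
  while moving it to an earlier block from \<open>centre\<close> raises one of them above 0. The top
  cell alone therefore determines the order of the blocks.\<close>

lemma order_from_top: assumes "a \<noteq> b"
  shows "g a \<le> g b \<longleftrightarrow> (\<forall>x\<in>B k. \<forall>\<eta>\<ge>0. x + \<eta> *\<^sub>R coord_diff b a \<in> P \<longrightarrow> x + \<eta> *\<^sub>R coord_diff b a \<in> B k)"
proof
  assume ab: "g a \<le> g b"
  show "\<forall>x\<in>B k. \<forall>\<eta>\<ge>0. x + \<eta> *\<^sub>R coord_diff b a \<in> P \<longrightarrow> x + \<eta> *\<^sub>R coord_diff b a \<in> B k"
  proof (intro ballI allI impI)
    fix x and \<eta> :: real assume x: "x \<in> B k" "0 \<le> \<eta>" "x + \<eta> *\<^sub>R coord_diff b a \<in> P"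
    have "S s (x + \<eta> *\<^sub>R coord_diff b a) \<le> 0" if s: "s \<in> {1..k}" for s
    proof -
      have "\<eta> * (of_bool (g b \<le> s) - of_bool (g a \<le> s)) \<le> 0" using ab x(2) by (intro mult_nonneg_nonpos) auto
      moreover have "S s x \<le> 0" using x(1) s by (simp add: top_cell)
      ultimately show ?thesis unfolding S_ex[OF assms[symmetric]] by linarith
    qed
    thus "x + \<eta> *\<^sub>R coord_diff b a \<in> B k" using x(3) by (simp add: top_cell)
  qed
next
  assume R: "\<forall>x\<in>B k. \<forall>\<eta>\<ge>0. x + \<eta> *\<^sub>R coord_diff b a \<in> P \<longrightarrow> x + \<eta> *\<^sub>R coord_diff b a \<in> B k"
  show "g a \<le> g b"
  proof (rule ccontr)
    assume n: "\<not> g a \<le> g b"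
    obtain \<epsilon> where \<epsilon>: "0 < \<epsilon>" "\<forall>\<eta>. \<bar>\<eta>\<bar> \<le> \<epsilon> \<longrightarrow> centre + \<eta> *\<^sub>R coord_diff b a \<in> P"
      using near_exists[OF centre_P centre_pos coord_diff_sum] by blast
    have "centre \<in> B k" using centre_P centre_S by (simp add: top_cell)
    hence "centre + \<epsilon> *\<^sub>R coord_diff b a \<in> B k" using R \<epsilon> by simp
    moreover have gb: "g b \<in> {1..k}" using g_range by simp
    ultimately have "S (g b) (centre + \<epsilon> *\<^sub>R coord_diff b a) \<le> 0" by (simp add: top_cell)
    thus False using \<epsilon>(1) n centre_S[OF gb] unfolding S_ex[OF assms[symmetric]] by simp
  qed
qed

text \<open>As every block is nonempty, the block number of \<open>a\<close> counts the initial
  segments up to that of \<open>a\<close>; the right-hand side depends only on the preorder that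
  \<open>g\<close> induces.\<close>

lemma g_rank: "g a = card ((\<lambda>b. {c. g c \<le> g b}) ` {b. g b \<le> g a})"
proof -
  have "(\<lambda>b. {c. g c \<le> g b}) ` {b. g b \<le> g a} = (\<lambda>r. {c. g c \<le> r}) ` {1..g a}"
  proof (intro set_eqI iffI)
    fix X assume "X \<in> (\<lambda>b. {c. g c \<le> g b}) ` {b. g b \<le> g a}"
    thus "X \<in> (\<lambda>r. {c. g c \<le> r}) ` {1..g a}" using g_range by auto
  next
    fix X assume "X \<in> (\<lambda>r. {c. g c \<le> r}) ` {1..g a}"
    then obtain r where r: "1 \<le> r" "r \<le> g a" "X = {c. g c \<le> r}" by auto
    have "g (al r) = r" using r g_range(2)[of a] by (intro al) auto
    thus "X \<in> (\<lambda>b. {c. g c \<le> g b}) ` {b. g b \<le> g a}" using r by (intro image_eqI[of _ _ "al r"]) auto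
  qed
  moreover have "inj_on (\<lambda>r. {c. g c \<le> r}) {1..g a}"
  proof (rule inj_onI)
    fix r s assume rs: "r \<in> {1..g a}" "s \<in> {1..g a}" "{c. g c \<le> r} = {c. g c \<le> s}"
    have e: "g (al r) = r" "g (al s) = s" using rs(1,2) g_range(2)[of a] by (auto intro: al)
    have "al r \<in> {c. g c \<le> r}" "al s \<in> {c. g c \<le> s}" using e by simp_all
    hence "al r \<in> {c. g c \<le> s}" "al s \<in> {c. g c \<le> r}" unfolding rs(3) .
    thus "r = s" using e by simp
  qed
  ultimately show ?thesis by (simp add: card_image)
qed

end

text \<open>The order fixes \<open>g\<close>. The centre of either datum lies in the common top
  cell, and the constraints of the other datum there compare the partial sums of \<open>dd\<close>
  and \<open>dd'\<close> in both directions.\<close>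

lemma block_data_inj:
  fixes g g' :: "'n::finite \<Rightarrow> nat"
  assumes k: "2 \<le> k" and D: "(g, dd) \<in> block_data k d" "(g', dd') \<in> block_data k d"
    and top: "block_cell k d g dd k = block_cell k d g' dd' k"
  shows "g = g' \<and> dd = dd'"
proof -
  interpret A: block_sys k d g dd by unfold_locales (use k D in auto)
  interpret B: block_sys k d g' dd' by unfold_locales (use k D in auto)
  have ord: "g a \<le> g b \<longleftrightarrow> g' a \<le> g' b" for a b
    using A.order_from_top[of a b] B.order_from_top[of a b] top by (cases "a = b") simp_all
  have "g a = g' a" for a
    using A.g_rank[of a] B.g_rank[of a] by (simp add: ord)
  hence gg: "g = g'" by blast
  have le: "(\<Sum>r=1..s. dd1 r) \<le> (\<Sum>r=1..s. dd2 r)"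
    if "(g, dd1) \<in> block_data k d" "(g, dd2) \<in> block_data k d" "block_cell k d g dd1 k = block_cell k d g dd2 k"
      "s \<in> {1..k}" for dd1 dd2 s
  proof -
    interpret X: block_sys k d g dd1 by unfold_locales (use k that in auto)
    interpret Y: block_sys k d g dd2 by unfold_locales (use k that in auto)
    have "X.centre \<in> block_cell k d g dd1 k" using X.centre_P X.centre_S by (simp add: X.top_cell)
    hence "excess g dd2 s X.centre \<le> 0" using that by (simp add: Y.top_cell)
    moreover have "excess g dd1 s X.centre = 0" using X.centre_S that by blast
    ultimately have "real (\<Sum>r=1..s. dd1 r) \<le> real (\<Sum>r=1..s. dd2 r)" by (simp add: excess_def)
    thus ?thesis by (simp only: of_nat_le_iff)
  qed
  have ps: "(\<Sum>r=1..s. dd r) = (\<Sum>r=1..s. dd' r)" if "s \<le> k" for s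
  proof (cases "s = 0")
    case False
    hence s: "s \<in> {1..k}" using that by simp
    have D': "(g, dd') \<in> block_data k d" and top': "block_cell k d g dd k = block_cell k d g dd' k" using D(2) top gg by auto
    show ?thesis using le[OF D(1) D' top' s] le[OF D' D(1) top'[symmetric] s] by simp
  qed simp
  have "dd r = dd' r" for r
  proof (cases "r \<in> {1..k}")
    case True
    then obtain s where s: "r = Suc s" "Suc s \<le> k" by (cases r) auto
    show ?thesis using ps[of s] ps[of "Suc s"] s by simp
  next
    case False
    thus ?thesis using D by (auto simp: block_data_def PiE_def extensional_def)
  qed
  thus ?thesis using gg by blast
qed

lemma subdivision_from_maximal:
  assumes sub: "subdivision P \<Sigma>" shows "\<Sigma> = {F. \<exists>M\<in>maximal_cells \<Sigma>. F face_of M}"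
proof (intro set_eqI iffI)
  fix F assume F: "F \<in> \<Sigma>"
  have "finite \<Sigma>" using sub by (simp add: subdivision_def)
  then obtain M where M: "M \<in> maximal_cells \<Sigma>" "F \<subseteq> M" using F by (rule cell_below_maximal)
  have "M \<in> \<Sigma>" using M(1) by (simp add: maximal_cells_def)
  hence "(F \<inter> M) face_of M" using sub F unfolding subdivision_def by blast
  moreover have "F \<inter> M = F" using M(2) by blast
  ultimately show "F \<in> {F. \<exists>M\<in>maximal_cells \<Sigma>. F face_of M}" using M(1) by auto
next
  fix F assume "F \<in> {F. \<exists>M\<in>maximal_cells \<Sigma>. F face_of M}"
  thus "F \<in> \<Sigma>" using sub unfolding subdivision_def maximal_cells_def by blast
qed

lemma split_block_data_bij:
  assumes k: "2 \<le> k" and d: "0 < d" "d < CARD('n::finite)"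
  shows "bij_betw (\<lambda>(g, dd). (block_sys.cells k d g dd, block_cell k d g dd k))
    (block_data k d :: (('n \<Rightarrow> nat) \<times> (nat \<Rightarrow> nat)) set)
    (SIGMA \<Sigma>:{\<Sigma>. k_split k (hypersimplex d :: (real ^ 'n) set) \<Sigma>}. maximal_cells \<Sigma>)"
  unfolding bij_betw_def
proof (intro conjI)
  show "inj_on (\<lambda>(g, dd). (block_sys.cells k d g dd, block_cell k d g dd k))
    (block_data k d :: (('n \<Rightarrow> nat) \<times> (nat \<Rightarrow> nat)) set)"
  proof (rule inj_onI)
    fix y y' :: "('n \<Rightarrow> nat) \<times> (nat \<Rightarrow> nat)"
    obtain g dd g' dd' where yy: "y = (g, dd)" "y' = (g', dd')" by (cases y; cases y') auto
    assume "y \<in> block_data k d" "y' \<in> block_data k d"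
      "(case y of (g, dd) \<Rightarrow> (block_sys.cells k d g dd, block_cell k d g dd k)) =
       (case y' of (g, dd) \<Rightarrow> (block_sys.cells k d g dd, block_cell k d g dd k))"
    hence "(g, dd) \<in> block_data k d" "(g', dd') \<in> block_data k d" "block_cell k d g dd k = block_cell k d g' dd' k"
      by (simp_all add: yy)
    from block_data_inj[OF k this] show "y = y'" by (simp add: yy)
  qed
  show "(\<lambda>(g, dd). (block_sys.cells k d g dd, block_cell k d g dd k)) ` (block_data k d :: (('n \<Rightarrow> nat) \<times> (nat \<Rightarrow> nat)) set)
    = (SIGMA \<Sigma>:{\<Sigma>. k_split k (hypersimplex d :: (real ^ 'n) set) \<Sigma>}. maximal_cells \<Sigma>)"
  proof (intro subset_antisym subsetI)
    fix y assume "y \<in> (\<lambda>(g, dd). (block_sys.cells k d g dd, block_cell k d g dd k)) ` (block_data k d :: (('n \<Rightarrow> nat) \<times> (nat \<Rightarrow> nat)) set)"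
    then obtain g :: "'n \<Rightarrow> nat" and dd where D: "(g, dd) \<in> block_data k d" "y = (block_sys.cells k d g dd, block_cell k d g dd k)"
      by auto
    interpret block_sys k d g dd by unfold_locales (use k D in auto)
    have "B k \<in> maximal_cells cells" using k maximal_cells_eq by auto
    thus "y \<in> (SIGMA \<Sigma>:{\<Sigma>. k_split k P \<Sigma>}. maximal_cells \<Sigma>)" using k_split_cells D(2) by simp
  next
    fix y assume "y \<in> (SIGMA \<Sigma>:{\<Sigma>. k_split k (hypersimplex d :: (real ^ 'n) set) \<Sigma>}. maximal_cells \<Sigma>)"
    then obtain \<Sigma> :: "(real ^ 'n) set set" and M where y: "y = (\<Sigma>, M)" "k_split k (hypersimplex d) \<Sigma>" "M \<in> maximal_cells \<Sigma>" by auto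
    let ?I = "maximal_cells \<Sigma>"
    have cI: "card ?I = k" and sub: "subdivision (hypersimplex d) \<Sigma>"
      using y(2) by (auto simp: k_split_def coarsest_subdivision_def)
    \<comment> \<open>The form of the chosen cell \<open>M\<close> is normalised to 0, and the
      cyclic order is cut there, so \<open>M\<close> becomes the top cell
      \<open>B k\<close>.\<close>
    obtain f c where fan: "simplicial_fan d ?I f M (\<lambda>i. {x \<in> hypersimplex d. \<forall>t\<in>?I. f t \<bullet> x \<le> f i \<bullet> x}) c"
      and cells: "\<forall>i\<in>?I. i = {x \<in> hypersimplex d. \<forall>t\<in>?I. f t \<bullet> x \<le> f i \<bullet> x}"
      using k_split_fan[OF d y(2) k y(3)] by blast
    have c2: "2 \<le> card ?I" using cI k by simp
    have "\<exists>g dd p. (g, dd) \<in> block_data (card ?I) d \<and> bij_betw p ?I {1..card ?I} \<and> p M = card ?I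
        \<and> (\<forall>i\<in>?I. {x \<in> hypersimplex d. \<forall>t\<in>?I. f t \<bullet> x \<le> f i \<bullet> x} = block_cell (card ?I) d g dd (p i))"
    proof (rule simplicial_fan.fan_cells[OF fan c2])
      fix g :: "'n \<Rightarrow> nat" and dd p
      assume A: "(g, dd) \<in> block_data (card ?I) d" "bij_betw p ?I {1..card ?I}" "p M = card ?I"
        "\<And>i. i \<in> ?I \<Longrightarrow> {x \<in> hypersimplex d. \<forall>t\<in>?I. f t \<bullet> x \<le> f i \<bullet> x} = block_cell (card ?I) d g dd (p i)"
      have "\<forall>i\<in>?I. {x \<in> hypersimplex d. \<forall>t\<in>?I. f t \<bullet> x \<le> f i \<bullet> x} = block_cell (card ?I) d g dd (p i)" by (intro ballI A(4))
      with A(1-3) show ?thesis by (intro exI[of _ g] exI[of _ dd] exI[of _ p] conjI)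
    qed
    then obtain g :: "'n \<Rightarrow> nat" and dd p where gd: "(g, dd) \<in> block_data (card ?I) d"
      "bij_betw p ?I {1..card ?I}" "p M = card ?I" and M: "\<forall>i\<in>?I. {x \<in> hypersimplex d. \<forall>t\<in>?I. f t \<bullet> x \<le> f i \<bullet> x} = block_cell (card ?I) d g dd (p i)"
      by (elim exE conjE)
    have iB: "i = block_cell k d g dd (p i)" if "i \<in> ?I" for i
      using bspec[OF M that] bspec[OF cells that] cI by simp
    have D: "(g, dd) \<in> block_data k d" using gd(1) cI by simp
    interpret block_sys k d g dd by unfold_locales (use k D in auto)
    have "?I = B ` {1..k}"
    proof -
      have "?I = B ` p ` ?I" using iB by (force simp: image_image)
      thus ?thesis using gd(2) cI by (simp add: bij_betw_def)
    qed
    hence "\<Sigma> = cells" using subdivision_from_maximal[OF sub] by (auto simp: cells_def)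
    moreover have "M = B k" using iB[OF y(3)] gd(3) cI by simp
    ultimately show "y \<in> (\<lambda>(g, dd). (block_sys.cells k d g dd, block_cell k d g dd k)) ` (block_data k d :: (('n \<Rightarrow> nat) \<times> (nat \<Rightarrow> nat)) set)"
      using y(1) D by force
  qed
qed

section \<open>Block data with prescribed block sizes\<close>

definition with_fibers :: "(nat \<Rightarrow> nat) \<Rightarrow> nat \<Rightarrow> ('n::finite \<Rightarrow> nat) set" where
  "with_fibers \<alpha> m = {g. (\<forall>a. g a \<in> {1..Suc m}) \<and> (\<forall>i\<in>{1..m}. card {a. g a = i} = \<alpha> i)}"

lemma fiber_sum:
  fixes g :: "'n::finite \<Rightarrow> nat"
  assumes "\<And>a. g a \<in> {1..Suc m}" shows "(\<Sum>i=1..m. card {a. g a = i}) + card {a. g a = Suc m} = CARD('n)"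
proof -
  have "(\<Sum>i=1..Suc m. \<Sum>a\<in>{a \<in> UNIV. g a = i}. 1) = (\<Sum>a\<in>(UNIV :: 'n set). 1 :: nat)"
    using assms by (intro sum.group) auto
  thus ?thesis by simp
qed

text \<open>The last block collects the remaining coordinates, and its size is not prescribed. In
  the induction step one chooses which of its members stay, and the others form the new last block;
  before the choice it has \<open>\<beta> CARD('n) \<alpha> (Suc m)\<close> elements.\<close>

lemma card_with_fibers:
  "finite (with_fibers \<alpha> m :: ('n::finite \<Rightarrow> nat) set) \<and>
   card (with_fibers \<alpha> m :: ('n \<Rightarrow> nat) set) = (\<Prod>j\<in>{1..m}. \<beta> CARD('n) \<alpha> j choose \<alpha> j)"
proof (induction m)
  case 0
  have "with_fibers \<alpha> 0 = {(\<lambda>_. 1) :: 'n \<Rightarrow> nat}" by (auto simp: with_fibers_def)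
  thus ?case by simp
next
  case (Suc m)
  let ?Q = "\<lambda>h :: 'n \<Rightarrow> nat. {X. X \<subseteq> {a. h a = Suc m} \<and> card X = \<alpha> (Suc m)}"
  let ?D = "SIGMA h:with_fibers \<alpha> m. ?Q h"
  define F where "F = (\<lambda>(h :: 'n \<Rightarrow> nat, X) a. if h a = Suc m \<and> a \<notin> X then Suc (Suc m) else h a)"
  define G where "G = (\<lambda>g :: 'n \<Rightarrow> nat. (\<lambda>a. min (g a) (Suc m), {a. g a = Suc m}))"
  have bij: "bij_betw F ?D (with_fibers \<alpha> (Suc m))"
  proof (rule bij_betw_byWitness[where f' = G])
    show "\<forall>y\<in>?D. G (F y) = y"
    proof (rule ballI)
      fix y assume "y \<in> ?D"
      then obtain h X where y: "y = (h, X)" and h: "h \<in> with_fibers \<alpha> m" and X: "X \<subseteq> {a. h a = Suc m}" "card X = \<alpha> (Suc m)"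
        by blast
      have hr: "h a \<le> Suc m" for a using h by (auto simp: with_fibers_def)
      show "G (F y) = y" unfolding y using hr X(1) by (auto simp: F_def G_def fun_eq_iff min_def)
    qed
    show "\<forall>g\<in>with_fibers \<alpha> (Suc m). F (G g) = g"
    proof (rule ballI)
      fix g :: "'n \<Rightarrow> nat" assume g: "g \<in> with_fibers \<alpha> (Suc m)"
      have gr: "g a \<le> Suc (Suc m)" for a using g by (auto simp: with_fibers_def)
      have "F (G g) a = g a" for a using gr[of a] by (auto simp: F_def G_def min_def)
      thus "F (G g) = g" by blast
    qed
    show "F ` ?D \<subseteq> with_fibers \<alpha> (Suc m)"
    proof (rule image_subsetI)
      fix y assume "y \<in> ?D"
      then obtain h X where y: "y = (h, X)" and h: "h \<in> with_fibers \<alpha> m" and X: "X \<subseteq> {a. h a = Suc m}" "card X = \<alpha> (Suc m)"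
        by blast
      have hr: "1 \<le> h a" "h a \<le> Suc m" for a using h by (auto simp: with_fibers_def)
      have hc: "card {a. h a = i} = \<alpha> i" if "i \<in> {1..m}" for i using h that by (simp add: with_fibers_def)
      have "{a. F (h, X) a = Suc m} = X" using X(1) hr by (auto simp: F_def)
      moreover have "{a. F (h, X) a = i} = {a. h a = i}" if "i \<in> {1..m}" for i using that by (auto simp: F_def)
      ultimately have "card {a. F (h, X) a = i} = \<alpha> i" if "i \<in> {1..Suc m}" for i
        using that X(2) hc[of i] by (cases "i = Suc m") auto
      moreover have "F (h, X) a \<in> {1..Suc (Suc m)}" for a using hr[of a] by (auto simp: F_def)
      ultimately show "F y \<in> with_fibers \<alpha> (Suc m)" unfolding y by (simp add: with_fibers_def)
    qed
    show "G ` with_fibers \<alpha> (Suc m) \<subseteq> ?D"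
    proof (rule image_subsetI)
      fix g :: "'n \<Rightarrow> nat" assume g: "g \<in> with_fibers \<alpha> (Suc m)"
      have gr: "1 \<le> g a" for a using g by (auto simp: with_fibers_def)
      have "{a. min (g a) (Suc m) = i} = {a. g a = i}" if "i \<in> {1..m}" for i using that by (auto simp: min_def)
      hence "card {a. min (g a) (Suc m) = i} = \<alpha> i" if "i \<in> {1..m}" for i using g that by (simp add: with_fibers_def)
      moreover have "min (g a) (Suc m) \<in> {1..Suc m}" for a using gr[of a] by auto
      ultimately have "(\<lambda>a. min (g a) (Suc m)) \<in> with_fibers \<alpha> m" by (simp add: with_fibers_def)
      moreover have "card {a. g a = Suc m} = \<alpha> (Suc m)" using g by (simp add: with_fibers_def)
      ultimately show "G g \<in> ?D" by (auto simp: G_def)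
    qed
  qed
  have cQ: "card (?Q h) = (\<beta> CARD('n) \<alpha> (Suc m) choose \<alpha> (Suc m))" if h: "h \<in> with_fibers \<alpha> m" for h
  proof -
    have "(\<Sum>i=1..m. card {a. h a = i}) + card {a. h a = Suc m} = CARD('n)"
      using h by (intro fiber_sum) (auto simp: with_fibers_def)
    moreover have "(\<Sum>i=1..m. card {a. h a = i}) = (\<Sum>i=1..m. \<alpha> i)" using h by (intro sum.cong) (auto simp: with_fibers_def)
    moreover have "{1..<Suc m} = {1..m}" by auto
    ultimately have "card {a. h a = Suc m} = \<beta> CARD('n) \<alpha> (Suc m)" unfolding \<beta>_def by simp
    thus ?thesis using n_subsets[of "{a. h a = Suc m}" "\<alpha> (Suc m)"] by simp
  qed
  have fin: "finite ?D" using Suc by (intro finite_SigmaI) auto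
  have "card (with_fibers \<alpha> (Suc m) :: ('n \<Rightarrow> nat) set) = card ?D" using bij_betw_same_card[OF bij] by simp
  also have "\<dots> = (\<Sum>h\<in>with_fibers \<alpha> m. card (?Q h))" using Suc by (intro card_SigmaI) auto
  also have "\<dots> = (\<Sum>h\<in>(with_fibers \<alpha> m :: ('n \<Rightarrow> nat) set). (\<beta> CARD('n) \<alpha> (Suc m) choose \<alpha> (Suc m)))" by (intro sum.cong refl cQ)
  also have "\<dots> = (\<Prod>j\<in>{1..Suc m}. \<beta> CARD('n) \<alpha> j choose \<alpha> j)" using Suc by simp
  finally show ?case using bij_betw_finite[OF bij] fin by simp
qed

text \<open>The tuples counted by \<open>\<mu>\<close>, with natural numbers in place of integers as
  in \<open>block_data\<close>.\<close>

definition split_types :: "nat \<Rightarrow> nat \<Rightarrow> nat \<Rightarrow> (nat \<Rightarrow> nat) \<Rightarrow> (nat \<Rightarrow> nat) set" where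
  "split_types k d n \<alpha> = {dd \<in> {1..k} \<rightarrow>\<^sub>E UNIV. (\<Sum>i\<in>{1..k}. dd i) = d \<and>
     (\<forall>j\<in>{1..k}. 0 < dd j \<and> dd j < (\<alpha>(k := \<beta> n \<alpha> k)) j)}"

lemma card_split_types: "finite (split_types k d n \<alpha>) \<and> card (split_types k d n \<alpha>) = \<mu> k d n \<alpha>"
proof -
  let ?Z = "{x \<in> {1..k} \<rightarrow>\<^sub>E (UNIV :: int set). (\<Sum>i\<in>{1..k}. x i) = int d \<and>
             (\<forall>j\<in>{1..k}. 0 < x j \<and> x j < int ((\<alpha>(k := \<beta> n \<alpha> k)) j))}"
  have "bij_betw (\<lambda>dd. \<lambda>i\<in>{1..k}. int (dd i)) (split_types k d n \<alpha>) ?Z"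
  proof (rule bij_betw_byWitness[where f' = "\<lambda>x. \<lambda>i\<in>{1..k}. nat (x i)"])
    show "\<forall>dd\<in>split_types k d n \<alpha>. (\<lambda>i\<in>{1..k}. nat ((\<lambda>i\<in>{1..k}. int (dd i)) i)) = dd"
      by (auto simp: split_types_def PiE_def extensional_def fun_eq_iff)
    show "\<forall>x\<in>?Z. (\<lambda>i\<in>{1..k}. int ((\<lambda>i\<in>{1..k}. nat (x i)) i)) = x"
      by (auto simp: PiE_def extensional_def fun_eq_iff less_imp_le)
    show "(\<lambda>dd. \<lambda>i\<in>{1..k}. int (dd i)) ` split_types k d n \<alpha> \<subseteq> ?Z"
    proof (clarify, intro conjI)
      fix dd assume dd: "dd \<in> split_types k d n \<alpha>"
      have "(\<Sum>i\<in>{1..k}. (\<lambda>i\<in>{1..k}. int (dd i)) i) = int (\<Sum>i\<in>{1..k}. dd i)" by simp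
      thus "(\<Sum>i\<in>{1..k}. (\<lambda>i\<in>{1..k}. int (dd i)) i) = int d" using dd by (simp only: split_types_def mem_Collect_eq)
      show "\<forall>j\<in>{1..k}. 0 < (\<lambda>i\<in>{1..k}. int (dd i)) j \<and> (\<lambda>i\<in>{1..k}. int (dd i)) j < int ((\<alpha>(k := \<beta> n \<alpha> k)) j)"
      proof
        fix j assume j: "j \<in> {1..k}"
        hence "0 < dd j \<and> dd j < (\<alpha>(k := \<beta> n \<alpha> k)) j" using dd unfolding split_types_def by blast
        thus "0 < (\<lambda>i\<in>{1..k}. int (dd i)) j \<and> (\<lambda>i\<in>{1..k}. int (dd i)) j < int ((\<alpha>(k := \<beta> n \<alpha> k)) j)"
          using j by (simp only: restrict_apply' of_nat_0_less_iff of_nat_less_iff)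
      qed
    qed simp
    show "(\<lambda>x. \<lambda>i\<in>{1..k}. nat (x i)) ` ?Z \<subseteq> split_types k d n \<alpha>"
    proof clarify
      fix x :: "nat \<Rightarrow> int" assume x: "x \<in> {1..k} \<rightarrow>\<^sub>E UNIV" "(\<Sum>i\<in>{1..k}. x i) = int d"
        "\<forall>j\<in>{1..k}. 0 < x j \<and> x j < int ((\<alpha>(k := \<beta> n \<alpha> k)) j)"
      have "int (\<Sum>i\<in>{1..k}. (\<lambda>i\<in>{1..k}. nat (x i)) i) = (\<Sum>i\<in>{1..k}. x i)"
        unfolding of_nat_sum using x(3) by (intro sum.cong) (auto simp: less_imp_le)
      hence "int (\<Sum>i\<in>{1..k}. (\<lambda>i\<in>{1..k}. nat (x i)) i) = int d" using x(2) by (rule trans)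
      hence "(\<Sum>i\<in>{1..k}. (\<lambda>i\<in>{1..k}. nat (x i)) i) = d" by (simp only: of_nat_eq_iff)
      moreover have "0 < (\<lambda>i\<in>{1..k}. nat (x i)) j \<and> (\<lambda>i\<in>{1..k}. nat (x i)) j < (\<alpha>(k := \<beta> n \<alpha> k)) j" if j: "j \<in> {1..k}" for j
      proof -
        have "0 < x j" "x j < int ((\<alpha>(k := \<beta> n \<alpha> k)) j)" using x(3) j by auto
        thus ?thesis using j by (simp only: restrict_apply') linarith
      qed
      ultimately show "(\<lambda>i\<in>{1..k}. nat (x i)) \<in> split_types k d n \<alpha>" unfolding split_types_def by simp
    qed
  qed
  moreover have "finite (split_types k d n \<alpha>)"
  proof (rule finite_subset)
    show "split_types k d n \<alpha> \<subseteq> {1..k} \<rightarrow>\<^sub>E {..d}"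
    proof
      fix dd assume dd: "dd \<in> split_types k d n \<alpha>"
      have "dd i \<le> d" if "i \<in> {1..k}" for i
        using member_le_sum[of i "{1..k}" dd] dd that by (auto simp: split_types_def)
      thus "dd \<in> {1..k} \<rightarrow>\<^sub>E {..d}" using dd by (auto simp: split_types_def PiE_def)
    qed
  qed (intro finite_PiE; simp)
  ultimately show ?thesis using bij_betw_same_card unfolding \<mu>_def by blast
qed

text \<open>The sizes of the first \<open>k - 1\<close> blocks form \<alpha>. Each block has at
  least two elements because an integer lies strictly between 0 and its size; since
  \<open>\<beta>\<close> at \<open>i\<close> counts the elements of blocks \<open>i\<close> to
  \<open>k\<close>, this gives the upper limits of the sums.\<close>

lemma block_data_partition:
  assumes k: "2 \<le> k"
  shows "(block_data k d :: (('n::finite \<Rightarrow> nat) \<times> (nat \<Rightarrow> nat)) set) =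
    (\<Union>\<alpha>\<in>alpha_range k CARD('n). with_fibers \<alpha> (k - 1) \<times> split_types k d CARD('n) \<alpha>)"
proof (intro subset_antisym subsetI)
  fix y assume "y \<in> (block_data k d :: (('n \<Rightarrow> nat) \<times> (nat \<Rightarrow> nat)) set)"
  then obtain g :: "'n \<Rightarrow> nat" and dd where y: "y = (g, dd)" "(g, dd) \<in> block_data k d" by (cases y) auto
  interpret block_sys k d g dd by unfold_locales (use y k in auto)
  define \<alpha> where "\<alpha> = (\<lambda>i\<in>{1..k-1}. card (L i))"
  have a2: "2 \<le> card (L i)" if "i \<in> {1..k}" for i using dd(1,2)[OF that] by linarith
  have tot: "(\<Sum>i=1..k. card (L i)) = CARD('n)" using sum_blocks[of "\<lambda>_. 1 :: nat"] by simp
  have be: "\<beta> CARD('n) \<alpha> i = (\<Sum>l\<in>{i..k}. card (L l))" if i: "i \<in> {1..k}" for i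
  proof -
    have "{1..k} = {1..<i} \<union> {i..k}" using i by auto
    hence "CARD('n) = (\<Sum>l\<in>{1..<i}. card (L l)) + (\<Sum>l\<in>{i..k}. card (L l))"
      unfolding tot[symmetric] by (simp only:) (rule sum.union_disjoint, auto)
    moreover have "(\<Sum>l\<in>{1..<i}. \<alpha> l) = (\<Sum>l\<in>{1..<i}. card (L l))" using i by (intro sum.cong) (auto simp: \<alpha>_def)
    ultimately show ?thesis by (simp add: \<beta>_def)
  qed
  have ar: "\<alpha> \<in> alpha_range k CARD('n)"
    unfolding alpha_range_def
  proof (intro CollectI conjI ballI)
    show "\<alpha> \<in> {1..k-1} \<rightarrow>\<^sub>E UNIV" by (simp add: \<alpha>_def)
    fix i assume i: "i \<in> {1..k-1}"
    hence ik: "i \<in> {1..k}" by auto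
    have ai: "\<alpha> i = card (L i)" using i by (simp add: \<alpha>_def)
    show "2 \<le> \<alpha> i" using a2[OF ik] ai by simp
    have "{i..k} = insert i {Suc i..k}" using ik by auto
    hence "\<beta> CARD('n) \<alpha> i = card (L i) + (\<Sum>l\<in>{Suc i..k}. card (L l))" unfolding be[OF ik] by (simp only:) (subst sum.insert, auto)
    moreover have "(\<Sum>l\<in>{Suc i..k}. 2) \<le> (\<Sum>l\<in>{Suc i..k}. card (L l))" using a2 i by (intro sum_mono) auto
    ultimately show "\<alpha> i \<le> \<beta> CARD('n) \<alpha> i - 2 * (k - i)" using ai by simp
  qed
  have "g \<in> with_fibers \<alpha> (k - 1)" using g_range k by (auto simp: with_fibers_def \<alpha>_def)
  moreover have "dd \<in> split_types k d CARD('n) \<alpha>"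
  proof -
    have "(\<alpha>(k := \<beta> CARD('n) \<alpha> k)) j = card (L j)" if "j \<in> {1..k}" for j
      using that be[of k] k by (cases "j = k") (auto simp: \<alpha>_def)
    thus ?thesis using data dd by (auto simp: split_types_def block_data_def)
  qed
  ultimately show "y \<in> (\<Union>\<alpha>\<in>alpha_range k CARD('n). with_fibers \<alpha> (k - 1) \<times> split_types k d CARD('n) \<alpha>)"
    using ar y(1) by blast
next
  fix y assume "y \<in> (\<Union>\<alpha>\<in>alpha_range k CARD('n). (with_fibers \<alpha> (k - 1) :: ('n \<Rightarrow> nat) set) \<times> split_types k d CARD('n) \<alpha>)"
  then obtain \<alpha> and g :: "'n \<Rightarrow> nat" and dd where y: "y = (g, dd)" "g \<in> with_fibers \<alpha> (k - 1)" "dd \<in> split_types k d CARD('n) \<alpha>" by blast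
  have kk: "Suc (k - 1) = k" using k by simp
  have gr: "g a \<in> {1..k}" for a using y(2) unfolding with_fibers_def kk by blast
  have gc: "card {a. g a = i} = \<alpha> i" if "i \<in> {1..k-1}" for i using y(2) that by (simp add: with_fibers_def)
  have "(\<Sum>i=1..k-1. card {a. g a = i}) + card {a. g a = k} = CARD('n)" using fiber_sum[of g "k - 1"] gr unfolding kk by blast
  moreover have "(\<Sum>i=1..k-1. card {a. g a = i}) = (\<Sum>i=1..k-1. \<alpha> i)" by (intro sum.cong refl gc)
  moreover have "{1..<k} = {1..k-1}" using k by auto
  ultimately have bk: "card {a. g a = k} = \<beta> CARD('n) \<alpha> k" unfolding \<beta>_def by simp
  have "(\<alpha>(k := \<beta> CARD('n) \<alpha> k)) j = card {a. g a = j}" if "j \<in> {1..k}" for j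
    using that gc[of j] bk by (cases "j = k") auto
  thus "y \<in> block_data k d" using y(1,3) gr by (auto simp: split_types_def block_data_def)
qed

lemma card_block_data:
  assumes k: "2 \<le> k"
  shows "finite (block_data k d :: (('n::finite \<Rightarrow> nat) \<times> (nat \<Rightarrow> nat)) set) \<and>
    card (block_data k d :: (('n \<Rightarrow> nat) \<times> (nat \<Rightarrow> nat)) set) =
      (\<Sum>\<alpha>\<in>alpha_range k CARD('n). \<mu> k d CARD('n) \<alpha> * (\<Prod>j\<in>{1..k-1}. \<beta> CARD('n) \<alpha> j choose \<alpha> j))"
proof -
  have finA: "finite (alpha_range k CARD('n))"
  proof (rule finite_subset)
    show "alpha_range k CARD('n) \<subseteq> {1..k-1} \<rightarrow>\<^sub>E {..CARD('n)}"
    proof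
      fix \<alpha> assume \<alpha>: "\<alpha> \<in> alpha_range k CARD('n)"
      have "\<alpha> i \<le> CARD('n)" if "i \<in> {1..k-1}" for i
      proof -
        have "\<alpha> i \<le> \<beta> CARD('n) \<alpha> i - 2 * (k - i)" using \<alpha> that unfolding alpha_range_def by blast
        also have "\<dots> \<le> CARD('n)" by (simp add: \<beta>_def)
        finally show ?thesis .
      qed
      thus "\<alpha> \<in> {1..k-1} \<rightarrow>\<^sub>E {..CARD('n)}" using \<alpha> by (auto simp: alpha_range_def PiE_def)
    qed
  qed (intro finite_PiE; simp)
  let ?U = "\<lambda>\<alpha>. (with_fibers \<alpha> (k - 1) :: ('n \<Rightarrow> nat) set) \<times> split_types k d CARD('n) \<alpha>"
  have finU: "finite (?U \<alpha>)" for \<alpha> using card_with_fibers card_split_types by (intro finite_cartesian_product) blast+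
  have disj: "?U \<alpha> \<inter> ?U \<alpha>' = {}" if "\<alpha> \<in> alpha_range k CARD('n)" "\<alpha>' \<in> alpha_range k CARD('n)" "\<alpha> \<noteq> \<alpha>'" for \<alpha> \<alpha>'
  proof (rule ccontr)
    assume "\<not> ?thesis"
    then obtain g :: "'n \<Rightarrow> nat" where "g \<in> with_fibers \<alpha> (k - 1)" "g \<in> with_fibers \<alpha>' (k - 1)" by blast
    hence eq: "\<alpha> i = \<alpha>' i" if "i \<in> {1..k-1}" for i using that by (auto simp: with_fibers_def)
    have "\<alpha> = \<alpha>'"
    proof (rule PiE_ext)
      show "\<alpha> \<in> {1..k-1} \<rightarrow>\<^sub>E UNIV" "\<alpha>' \<in> {1..k-1} \<rightarrow>\<^sub>E UNIV" using that by (auto simp: alpha_range_def)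
    qed (rule eq)
    thus False using that by blast
  qed
  have "card (block_data k d :: (('n \<Rightarrow> nat) \<times> (nat \<Rightarrow> nat)) set) = (\<Sum>\<alpha>\<in>alpha_range k CARD('n). card (?U \<alpha>))"
    unfolding block_data_partition[OF k] using finA finU disj by (intro card_UN_disjoint) auto
  also have "\<dots> = (\<Sum>\<alpha>\<in>alpha_range k CARD('n). \<mu> k d CARD('n) \<alpha> * (\<Prod>j\<in>{1..k-1}. \<beta> CARD('n) \<alpha> j choose \<alpha> j))"
    using card_with_fibers[where ?'n = 'n] card_split_types by (intro sum.cong refl) (simp only: card_cartesian_product mult.commute)
  finally show ?thesis using finA finU unfolding block_data_partition[OF k] by blast
qed

theorem proposition30:
  fixes k d :: nat
  assumes "2 \<le> k" and "0 < d" and "d < CARD('n::finite)"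
  shows "finite {\<Sigma>. k_split k (hypersimplex d :: (real ^ 'n) set) \<Sigma>} \<and>
    real (card {\<Sigma>. k_split k (hypersimplex d :: (real ^ 'n) set) \<Sigma>}) =
      1 / real k *
        (\<Sum>\<alpha>\<in>alpha_range k CARD('n).
           real (\<mu> k d CARD('n) \<alpha>) * (\<Prod>j\<in>{1..k-1}. real (\<beta> CARD('n) \<alpha> j choose \<alpha> j)))"
proof -
  let ?K = "{\<Sigma>. k_split k (hypersimplex d :: (real ^ 'n) set) \<Sigma>}"
  let ?\<Lambda> = "block_data k d :: (('n \<Rightarrow> nat) \<times> (nat \<Rightarrow> nat)) set"
  let ?S = "SIGMA \<Sigma>:?K. maximal_cells \<Sigma>"
  note bij = split_block_data_bij[OF assms]
  have cm: "card (maximal_cells \<Sigma>) = k" if "\<Sigma> \<in> ?K" for \<Sigma> using that by (simp add: k_split_def)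
  have "finite ?S" using bij_betw_finite[OF bij] card_block_data[OF assms(1), where ?'n = 'n] by blast
  moreover have "?K = fst ` ?S"
  proof -
    have "maximal_cells \<Sigma> \<noteq> {}" if "\<Sigma> \<in> ?K" for \<Sigma> using cm[OF that] assms(1) by auto
    thus ?thesis by force
  qed
  ultimately have finK: "finite ?K" by (metis finite_imageI)
  have fm: "finite (maximal_cells \<Sigma>)" if "\<Sigma> \<in> ?K" for \<Sigma>
    using cm[OF that] assms(1) by (intro card_ge_0_finite) simp
  have "card ?\<Lambda> = card ?S" by (rule bij_betw_same_card[OF bij])
  also have "\<dots> = (\<Sum>\<Sigma>\<in>?K. card (maximal_cells \<Sigma>))" using finK fm by (intro card_SigmaI) auto
  also have "\<dots> = card ?K * k" using cm by simp
  finally have "card ?K * k = (\<Sum>\<alpha>\<in>alpha_range k CARD('n). \<mu> k d CARD('n) \<alpha> * (\<Prod>j\<in>{1..k-1}. \<beta> CARD('n) \<alpha> j choose \<alpha> j))"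
    using card_block_data[OF assms(1), where ?'n = 'n] by simp
  from arg_cong[OF this, of real] have "real (card ?K) * real k = (\<Sum>\<alpha>\<in>alpha_range k CARD('n).
      real (\<mu> k d CARD('n) \<alpha>) * (\<Prod>j\<in>{1..k-1}. real (\<beta> CARD('n) \<alpha> j choose \<alpha> j)))"
    by simp
  thus ?thesis using finK assms(1) by (simp add: eq_divide_eq)
qed

end
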